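(* Let $A\in\mathbb{R}^{N\times N}$ be symmetric positive semidefinite of rank $K$, let $\mathcal{P}=\{P_m\}_{m=1}^M$ be a partition of $[N]$ that is regular-sparse with respect to $A$, and assume that the intrinsic sparse modes of $A$ under $\mathcal{P}$ are pairwise identifiable. Let $\hat A=A+\epsilon\tilde A$ be symmetric positive semidefinite, with $\tilde A$ symmetric, $\|\tilde A\|_2\le 1$ and $\epsilon>0$, where $\epsilon\ll 1$ is so small that for every $m$ there is a gap between the eigenvalues $\hat\gamma_{m,K_m}$ and $\hat\gamma_{m,K_m+1}$ of $\hat A_{mm}$ (so that truncation captures the correct local rank $K_m=\operatorname{rank}A_{mm}$). Assume that for every $m\in[M]$ there is a matrix $E_m^{(eig)}$ with $$\hat A_{mm}^{(t)}=(I+\epsilon E_m^{(eig)})A_{mm}\bigl(I+\epsilon (E_m^{(eig)})^T\bigr),\qquad \|E_m^{(eig)}\|_2\le C_{eig},$$ where $C_{eig}$ is a constant depending on $A$ but not on $\epsilon$ or $\tilde A$. Under these hypotheses the local pieces $G_m$, $\hat G_m$ constructed by the ISMD from $A$ and $\hat A$ are related by $$\hat G_m=(I+\epsilon E_m^{(eig)})\,G_m\,(I+\epsilon E_m^{(jd)}+O(\epsilon^2))\,J_m,\qquad \|E_m^{(jd)}\|_F\le C_{jd},$$ where $E_m^{(jd)}\in\mathbb{R}^{K_m\times K_m}$, $J_m$ is the product of a permutation matrix and a diagonal matrix with diagonal entries $\pm1$, and $C_{jd}$ is a constant depending on $A$ but not on $\epsilon$ or $\tilde A$. Assume, without loss of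 generality, that $J_m=\mathbb{I}_{K_m}$ (the identity) for all $m$. Then: (a) $\|\hat\Omega-\Omega\|_2\le C_{ismd}\,\epsilon$, where $C_{ismd}$ depends on the smallest singular value of the $G_m$ and on the constants $C_{eig}$ and $C_{jd}$. (b) The entries of $\Omega$ are either $0$ or $\pm1$, and when $C_{ismd}\,\epsilon$ is small enough, $\Omega$ is recovered exactly from $\hat\Omega$ by thresholding: $\Omega_{ij}=-1$ if $\hat\Omega_{ij}<-0.5$, $\Omega_{ij}=0$ if $\hat\Omega_{ij}\in[-0.5,0.5]$, and $\Omega_{ij}=1$ if $\hat\Omega_{ij}>0.5$. (c) In that case, let $\Omega=PLL^TP^T$ be the pivoted Cholesky decomposition of the recovered matrix, let $\hat G=\hat G_{ext}PL$ be the output of the thresholded ISMD applied to $(\hat A,\mathcal{P})$, and let $G=G_{ext}PL$ be the output of the ISMD applied to $(A,\mathcal{P})$. Then $\hat G$ has the same patch-wise sparse structure as $G$, i.e. corresponding columns $\hat g_k,g_k$ satisfy $\{P'\in\mathcal{P}:\hat g_k|_{P'}\ne0\}=\{P'\in\mathcal{P}:g_k|_{P'}\neq0\}$ for all $k$, and $$\|\hat G-G\|_2\le C_g\,\epsilon,$$ where the constant $C_g$ only depends on the constants $C_{eig}$ and $C_{jd}$.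
   Context: **Basic notions.** $[N]=\{1,\dots,N\}$; $\|\cdot\|_2$ is the spectral norm and $\|\cdot\|_F$ the Frobenius norm. For $\psi\in\mathbb{R}^N$, $\psi|_{P'}$ is its restriction to $P'$; $s(\psi;\mathcal{P})=\#\{P'\in\mathcal{P}:\psi|_{P'}\ne 0\}$. A set of *intrinsic sparse modes* of $A$ under $\mathcal{P}$ is a minimizer $(\psi_1,\dots,\psi_K)$ of $\sum_{k=1}^K s(\psi_k;\mathcal{P})$ over all $\psi_k\in\mathbb{R}^N$ with $A=\sum_{k=1}^K\psi_k\psi_k^T$, $K=\operatorname{rank}A$. $\mathcal{P}$ is *regular-sparse with respect to $A$* if there is a decomposition $A=\sum_{k=1}^K g_kg_k^T$ such that on every patch $P_m$ the restrictions $g_k|_{P_m}$ of the modes nonzero on $P_m$ are linearly independent. Two modes $g,g'$ are *identifiable* on $\mathcal{P}$ if $\{P'\in\mathcal{P}:g|_{P'}\neq0\}\ne\{P'\in\mathcal{P}:g'|_{P'}\neq0\}$. **ISMD for $(A,\mathcal{P})$.** Order indices so that $A$ has blocks $A_{mn}$ (rows in $P_m$, columns in $P_n$). (1) With $K_m=\operatorname{rank}A_{mm}$, take an eigendecomposition $A_{mm}=\sum_{i=1}^{K_m}\gamma_{m,i}h_{m,i}h_{m,i}^T$ ($\gamma_{m,i}>0$, $h_{m,i}$ orthonormal), $H_m=[\gamma_{m,1}^{1/2}h_{m,1},\dots,\gamma_{m,K_m}^{1/2}h_{m,K_m}]$, $H_m^\dagger=(H_m^TH_m)^{-1}H_m^T$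 (pseudo-inverse), and $\Lambda_{mn}=H_m^\dagger A_{mn}(H_n^\dagger)^T$ (blocks of $\Lambda$). (2) With $\Sigma_{n;m}=\Lambda_{mn}\Lambda_{mn}^T$, let $D_m$ be a global minimizer of $\sum_{n=1}^M\sum_{i\ne j}|(V^T\Sigma_{n;m}V)_{i,j}|^2$ over orthogonal $V\in\mathbb{R}^{K_m\times K_m}$; put $G_m=H_mD_m$, $G_{ext}=\operatorname{diag}\{G_1,\dots,G_M\}$, $D=\operatorname{diag}\{D_1,\dots,D_M\}$, $\Omega=D^T\Lambda D$. (3) Take a pivoted Cholesky decomposition $\Omega=PLL^TP^T$ ($P$ a permutation matrix, $L$ lower triangular (trapezoidal) with $K$ columns and positive diagonal entries) and output $G=G_{ext}PL$. **Thresholded ISMD for the noisy input $(\hat A,\mathcal{P})$.** With blocks $\hat A_{mn}$ of $\hat A$, let $\hat A_{mm}^{(t)}=\sum_{i=1}^{K_m}\hat\gamma_{m,i}\hat h_{m,i}\hat h_{m,i}^T=\hat H_m\hat H_m^T$ be the eigendecomposition of $\hat A_{mm}$ (eigenvalues $\hat\gamma_{m,1}\ge\hat\gamma_{m,2}\ge\dots$, orthonormal eigenvectors $\hat h_{m,i}$) truncated to its $K_m=\operatorname{rank}(A_{mm})$ largest eigenvalues, where $\hat H_m=[\hat\gamma_{m,1}^{1/2}\hat h_{m,1},\dots,\hat\gamma_{m,K_m}^{1/2}\hat h_{m,K_m}]$. Compute $\hat\Lambda_{mn}=\hat H_m^\dagger\hat A_{mn}(\hat H_n^\dagger)^T$,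 then $\hat D_m$, $\hat G_m=\hat H_m\hat D_m$ and $\hat G_{ext}=\operatorname{diag}\{\hat G_1,\dots,\hat G_M\}$ as in step (2) with $\hat\Lambda$ in place of $\Lambda$, and $\hat\Omega$ with blocks $\hat\Omega_{mn}=\hat G_m^\dagger\hat A_{mn}(\hat G_n^\dagger)^T$. Replace each entry of $\hat\Omega$ by $-1$ if it is $<-0.5$, by $0$ if it lies in $[-0.5,0.5]$, and by $1$ if it is $>0.5$; take a pivoted Cholesky decomposition $PLL^TP^T$ of the resulting matrix as in step (3), and output $\hat G=\hat G_{ext}PL$. The matrices $J_m$ only affect the sign of the recovered modes $\hat g_1,\dots,\hat g_K$ when the pivoted Cholesky decomposition is used, which is the reason for the normalization $J_m=\mathbb{I}_{K_m}$.
   Formalization: The constants C_ismd and C_g are also allowed to depend on N and on the spectral norm of A; uniformly over all A, dependence only on C_eig, C_jd (and the smallest singular value of the G_m) would be false. *)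

theory Defs
  imports
    Complex_Main
    "HOL-Library.Disjoint_Sets"
    "HOL-Combinatorics.Permutations"
    "Jordan_Normal_Form.Char_Poly"
    "Jordan_Normal_Form.Gauss_Jordan_Elimination"
    "Jordan_Normal_Form.DL_Rank"
    "Jordan_Normal_Form.DL_Submatrix"
begin

text \<open>
  All indices are zero-based: $[N]$ is \<open>{..<N}\<close>, the patches are \<open>Ps ! m\<close> for
  \<open>m < length Ps\<close>, and so on. Families indexed by patches are functions on \<open>nat\<close> of which
  only the values at \<open>m < length Ps\<close> matter.
\<close>

subsection \<open>Matrices\<close>

definition mrank :: "real mat \<Rightarrow> nat" where
  "mrank A = vec_space.rank (dim_row A) A"

definition sym_psd :: "nat \<Rightarrow> real mat \<Rightarrow> bool" where
  "sym_psd n A \<longleftrightarrow> A \<in> carrier_mat n n \<and> transpose_mat A = A \<and>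
     (\<forall>v \<in> carrier_vec n. v \<bullet> (A *\<^sub>v v) \<ge> 0)"

text \<open>Unit ball rather than unit sphere, so that the set is nonempty also without columns.\<close>

definition spec_norm :: "real mat \<Rightarrow> real" where
  "spec_norm A = Sup {sqrt ((A *\<^sub>v v) \<bullet> (A *\<^sub>v v)) | v. v \<in> carrier_vec (dim_col A) \<and> v \<bullet> v \<le> 1}"

definition frob_norm :: "real mat \<Rightarrow> real" where
  "frob_norm A = sqrt (\<Sum>i<dim_row A. \<Sum>j<dim_col A. (A $$ (i,j))\<^sup>2)"

text \<open>
  The singular values obtained from \<open>G\<^sup>T G\<close>: all of them if \<open>G\<close> has at least as many rows as
  columns, which holds for the local pieces below.
\<close>

definition singular_values :: "real mat \<Rightarrow> real set" where
  "singular_values G = {sqrt x | x. eigenvalue (transpose_mat G * G) x}"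

text \<open>Note that \<open>orthogonal_mat\<close> of the library does not require unit columns.\<close>

definition orthonormal_cols :: "real mat \<Rightarrow> bool" where
  "orthonormal_cols V \<longleftrightarrow> transpose_mat V * V = 1\<^sub>m (dim_col V)"

definition orth_mat :: "nat \<Rightarrow> real mat \<Rightarrow> bool" where
  "orth_mat k V \<longleftrightarrow> V \<in> carrier_mat k k \<and> orthonormal_cols V"

definition perm_mat :: "nat \<Rightarrow> real mat \<Rightarrow> bool" where
  "perm_mat n P \<longleftrightarrow> (\<exists>\<pi>. \<pi> permutes {..<n} \<and> P = mat n n (\<lambda>(i,j). if i = \<pi> j then 1 else 0))"

definition signed_perm_mat :: "nat \<Rightarrow> real mat \<Rightarrow> bool" where
  "signed_perm_mat n J \<longleftrightarrow>
     (\<exists>Q s. perm_mat n Q \<and> (\<forall>i<n. s i = 1 \<or> s i = -1) \<and> J = Q * mat_diag n s)"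

text \<open>Only meaningful for full column rank; otherwise the value is unspecified.\<close>

definition pinv :: "real mat \<Rightarrow> real mat" where
  "pinv H = the (mat_inverse (transpose_mat H * H)) * transpose_mat H"

subsection \<open>Partitions, decompositions and intrinsic sparse modes\<close>

definition patch_partition :: "nat \<Rightarrow> nat set list \<Rightarrow> bool" where
  "patch_partition N Ps \<longleftrightarrow> distinct Ps \<and> partition_on {..<N} (set Ps)"

definition restr :: "nat set \<Rightarrow> real vec \<Rightarrow> real vec" where
  "restr P v = vec (card P) (\<lambda>i. v $ pick P i)"

definition patch_support :: "nat set list \<Rightarrow> real vec \<Rightarrow> nat set set" where
  "patch_support Ps v = {P \<in> set Ps. restr P v \<noteq> 0\<^sub>v (card P)}"

text \<open>\<open>A = (\<Sum>k<K. g k (g k)\<^sup>T)\<close>, written out entrywise.\<close>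

definition decomposes :: "real mat \<Rightarrow> nat \<Rightarrow> (nat \<Rightarrow> real vec) \<Rightarrow> bool" where
  "decomposes A K g \<longleftrightarrow> (\<forall>k<K. g k \<in> carrier_vec (dim_row A)) \<and>
     A = mat (dim_row A) (dim_row A) (\<lambda>(i,j). \<Sum>k<K. g k $ i * g k $ j)"

definition intrinsic_sparse_modes :: "real mat \<Rightarrow> nat set list \<Rightarrow> (nat \<Rightarrow> real vec) \<Rightarrow> bool" where
  "intrinsic_sparse_modes A Ps \<psi> \<longleftrightarrow> decomposes A (mrank A) \<psi> \<and>
     (\<forall>\<phi>. decomposes A (mrank A) \<phi> \<longrightarrow>
        (\<Sum>k<mrank A. card (patch_support Ps (\<psi> k))) \<le> (\<Sum>k<mrank A. card (patch_support Ps (\<phi> k))))"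

text \<open>
  Linear independence of an indexed family: the set-based \<open>lin_indpt\<close> of the library would
  identify two modes whose restrictions to \<open>P\<close> coincide.
\<close>

definition lin_indep_family :: "nat \<Rightarrow> nat set \<Rightarrow> (nat \<Rightarrow> real vec) \<Rightarrow> bool" where
  "lin_indep_family n S v \<longleftrightarrow>
     (\<forall>c. (\<forall>i<n. (\<Sum>k\<in>S. c k * v k $ i) = 0) \<longrightarrow> (\<forall>k\<in>S. c k = 0))"

definition regular_sparse :: "real mat \<Rightarrow> nat set list \<Rightarrow> bool" where
  "regular_sparse A Ps \<longleftrightarrow> (\<exists>g. decomposes A (mrank A) g \<and>
     (\<forall>P\<in>set Ps. lin_indep_family (card P)
        {k. k < mrank A \<and> restr P (g k) \<noteq> 0\<^sub>v (card P)} (\<lambda>k. restr P (g k))))"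

definition pairwise_identifiable :: "nat set list \<Rightarrow> nat \<Rightarrow> (nat \<Rightarrow> real vec) \<Rightarrow> bool" where
  "pairwise_identifiable Ps K g \<longleftrightarrow>
     (\<forall>k<K. \<forall>l<K. k \<noteq> l \<longrightarrow> patch_support Ps (g k) \<noteq> patch_support Ps (g l))"

subsection \<open>Block matrices\<close>

definition blk :: "real mat \<Rightarrow> nat set list \<Rightarrow> nat \<Rightarrow> nat \<Rightarrow> real mat" where
  "blk A Ps m n = submatrix A (Ps ! m) (Ps ! n)"

definition loc_rank :: "real mat \<Rightarrow> nat set list \<Rightarrow> nat \<Rightarrow> nat" where
  "loc_rank A Ps m = mrank (blk A Ps m m)"

text \<open>
  Block sizes \<open>ks 0, ..., ks (M - 1)\<close>: the global index \<open>i < blk_offset ks M\<close> is the local index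
  \<open>blk_pos ks i\<close> in block number \<open>blk_of ks i\<close>.
\<close>

definition blk_offset :: "(nat \<Rightarrow> nat) \<Rightarrow> nat \<Rightarrow> nat" where
  "blk_offset ks m = (\<Sum>l<m. ks l)"

definition blk_of :: "(nat \<Rightarrow> nat) \<Rightarrow> nat \<Rightarrow> nat" where
  "blk_of ks i = (LEAST m. i < blk_offset ks (Suc m))"

definition blk_pos :: "(nat \<Rightarrow> nat) \<Rightarrow> nat \<Rightarrow> nat" where
  "blk_pos ks i = i - blk_offset ks (blk_of ks i)"

definition block_mat :: "(nat \<Rightarrow> nat) \<Rightarrow> nat \<Rightarrow> (nat \<Rightarrow> nat \<Rightarrow> real mat) \<Rightarrow> real mat" where
  "block_mat ks M B = mat (blk_offset ks M) (blk_offset ks M)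
     (\<lambda>(i,j). B (blk_of ks i) (blk_of ks j) $$ (blk_pos ks i, blk_pos ks j))"

text \<open>
  The matrix \<open>diag {G 0, ..., G (M - 1)}\<close>, with its rows in the original order of \<open>[N]\<close> instead
  of patch by patch; row \<open>r \<in> P\<close> of the full matrix is row \<open>card {x \<in> P. x < r}\<close> of the local piece.
\<close>

definition g_ext :: "nat \<Rightarrow> nat set list \<Rightarrow> (nat \<Rightarrow> nat) \<Rightarrow> (nat \<Rightarrow> real mat) \<Rightarrow> real mat" where
  "g_ext N Ps ks G = mat N (blk_offset ks (length Ps))
     (\<lambda>(r,j). let m = blk_of ks j in
        if r \<in> Ps ! m then G m $$ (card {x \<in> Ps ! m. x < r}, blk_pos ks j) else 0)"

subsection \<open>The ISMD\<close>

text \<open>The matrix with columns \<open>sqrt (\<gamma> i) h i\<close> for \<open>i < k\<close>, where \<open>h i\<close> are the columns of \<open>h\<close>.\<close>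

definition eig_factor :: "nat \<Rightarrow> real vec \<Rightarrow> real mat \<Rightarrow> real mat" where
  "eig_factor k \<gamma> h = mat (dim_row h) k (\<lambda>(i,j). sqrt (\<gamma> $ j) * h $$ (i,j))"

definition reduced_eigen_decomp :: "real mat \<Rightarrow> real vec \<Rightarrow> real mat \<Rightarrow> bool" where
  "reduced_eigen_decomp B \<gamma> h \<longleftrightarrow>
     \<gamma> \<in> carrier_vec (mrank B) \<and> h \<in> carrier_mat (dim_row B) (mrank B) \<and> orthonormal_cols h \<and>
     (\<forall>i<mrank B. \<gamma> $ i > 0) \<and>
     B = h * mat_diag (mrank B) (\<lambda>i. \<gamma> $ i) * transpose_mat h"

definition Lam :: "real mat \<Rightarrow> nat set list \<Rightarrow> (nat \<Rightarrow> real mat) \<Rightarrow> nat \<Rightarrow> nat \<Rightarrow> real mat" where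
  "Lam B Ps H m n = pinv (H m) * blk B Ps m n * transpose_mat (pinv (H n))"

definition Sig :: "real mat \<Rightarrow> nat set list \<Rightarrow> (nat \<Rightarrow> real mat) \<Rightarrow> nat \<Rightarrow> nat \<Rightarrow> real mat" where
  "Sig B Ps H m n = Lam B Ps H m n * transpose_mat (Lam B Ps H m n)"

definition jd_objective :: "nat \<Rightarrow> nat \<Rightarrow> (nat \<Rightarrow> real mat) \<Rightarrow> real mat \<Rightarrow> real" where
  "jd_objective M k S V =
     (\<Sum>n<M. \<Sum>(i,j) \<in> {(i,j). i < k \<and> j < k \<and> i \<noteq> j}. \<bar>(transpose_mat V * S n * V) $$ (i,j)\<bar>\<^sup>2)"

definition joint_diagonalizer :: "nat \<Rightarrow> nat \<Rightarrow> (nat \<Rightarrow> real mat) \<Rightarrow> real mat \<Rightarrow> bool" where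
  "joint_diagonalizer M k S D \<longleftrightarrow> orth_mat k D \<and>
     (\<forall>V. orth_mat k V \<longrightarrow> jd_objective M k S D \<le> jd_objective M k S V)"

definition pivoted_cholesky :: "nat \<Rightarrow> real mat \<Rightarrow> real mat \<Rightarrow> real mat \<Rightarrow> bool" where
  "pivoted_cholesky K B P L \<longleftrightarrow> perm_mat (dim_row B) P \<and> L \<in> carrier_mat (dim_row B) K \<and>
     K \<le> dim_row B \<and> (\<forall>i<dim_row B. \<forall>j<K. i < j \<longrightarrow> L $$ (i,j) = 0) \<and> (\<forall>j<K. L $$ (j,j) > 0) \<and>
     B = P * L * transpose_mat L * transpose_mat P"

text \<open>
  Steps (1) and (2) of a run on \<open>A\<close>. The algorithm is not deterministic: a run is determined by the
  chosen eigendecompositions \<open>(\<gamma> m, h m)\<close> and joint diagonalizers \<open>D m\<close>.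
\<close>

definition ismd_H ::
  "real mat \<Rightarrow> nat set list \<Rightarrow> (nat \<Rightarrow> real vec) \<Rightarrow> (nat \<Rightarrow> real mat) \<Rightarrow> nat \<Rightarrow> real mat" where
  "ismd_H A Ps \<gamma> h m = eig_factor (loc_rank A Ps m) (\<gamma> m) (h m)"

definition ismd_run ::
  "real mat \<Rightarrow> nat set list \<Rightarrow> (nat \<Rightarrow> real vec) \<Rightarrow> (nat \<Rightarrow> real mat) \<Rightarrow> (nat \<Rightarrow> real mat) \<Rightarrow> bool" where
  "ismd_run A Ps \<gamma> h D \<longleftrightarrow> (\<forall>m<length Ps.
     reduced_eigen_decomp (blk A Ps m m) (\<gamma> m) (h m) \<and>
     joint_diagonalizer (length Ps) (loc_rank A Ps m) (Sig A Ps (ismd_H A Ps \<gamma> h) m) (D m))"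

text \<open>
  The local pieces. The same formula gives those of the thresholded ISMD, since \<open>ismd_H\<close> keeps the
  first \<open>loc_rank A Ps m\<close> eigenpairs; \<open>A\<close> is there only to supply the local ranks.
\<close>

definition ismd_G ::
  "real mat \<Rightarrow> nat set list \<Rightarrow> (nat \<Rightarrow> real vec) \<Rightarrow> (nat \<Rightarrow> real mat) \<Rightarrow> (nat \<Rightarrow> real mat) \<Rightarrow> nat \<Rightarrow> real mat" where
  "ismd_G A Ps \<gamma> h D m = ismd_H A Ps \<gamma> h m * D m"

definition ismd_Omega ::
  "real mat \<Rightarrow> nat set list \<Rightarrow> (nat \<Rightarrow> real vec) \<Rightarrow> (nat \<Rightarrow> real mat) \<Rightarrow> (nat \<Rightarrow> real mat) \<Rightarrow> real mat" where
  "ismd_Omega A Ps \<gamma> h D =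
     (let DD = diag_block_mat (map D [0..<length Ps]);
          \<Lambda> = block_mat (loc_rank A Ps) (length Ps) (Lam A Ps (ismd_H A Ps \<gamma> h))
      in transpose_mat DD * \<Lambda> * DD)"

subsection \<open>The thresholded ISMD\<close>

text \<open>Full eigendecomposition with the eigenvalues in descending order.\<close>

definition sorted_eigen_decomp :: "real mat \<Rightarrow> real vec \<Rightarrow> real mat \<Rightarrow> bool" where
  "sorted_eigen_decomp B \<gamma> h \<longleftrightarrow>
     \<gamma> \<in> carrier_vec (dim_row B) \<and> orth_mat (dim_row B) h \<and>
     (\<forall>i<dim_row B. \<forall>j<dim_row B. i \<le> j \<longrightarrow> \<gamma> $ j \<le> \<gamma> $ i) \<and>
     B = h * mat_diag (dim_row B) (\<lambda>i. \<gamma> $ i) * transpose_mat h"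

definition truncated :: "nat \<Rightarrow> real vec \<Rightarrow> real mat \<Rightarrow> real mat" where
  "truncated k \<gamma> h = mat (dim_row h) (dim_row h) (\<lambda>(i,j). \<Sum>l<k. \<gamma> $ l * h $$ (i,l) * h $$ (j,l))"

definition thresholded_ismd_run ::
  "real mat \<Rightarrow> real mat \<Rightarrow> nat set list \<Rightarrow> (nat \<Rightarrow> real vec) \<Rightarrow> (nat \<Rightarrow> real mat) \<Rightarrow> (nat \<Rightarrow> real mat) \<Rightarrow> bool" where
  "thresholded_ismd_run A Ahat Ps \<gamma> h D \<longleftrightarrow> (\<forall>m<length Ps.
     sorted_eigen_decomp (blk Ahat Ps m m) (\<gamma> m) (h m) \<and>
     joint_diagonalizer (length Ps) (loc_rank A Ps m) (Sig Ahat Ps (ismd_H A Ps \<gamma> h) m) (D m))"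

text \<open>
  The eigenvalues number \<open>K\<^sub>m\<close> and \<open>K\<^sub>m + 1\<close> (one-based) of the \<open>m\<close>-th diagonal block differ; no
  condition if one of them does not exist.
\<close>

definition spectral_gap :: "real mat \<Rightarrow> nat set list \<Rightarrow> (nat \<Rightarrow> real vec) \<Rightarrow> bool" where
  "spectral_gap A Ps \<gamma> \<longleftrightarrow> (\<forall>m<length Ps. 0 < loc_rank A Ps m \<and> loc_rank A Ps m < card (Ps ! m) \<longrightarrow>
     \<gamma> m $ loc_rank A Ps m < \<gamma> m $ (loc_rank A Ps m - 1))"

definition thresholded_ismd_Omega ::
  "real mat \<Rightarrow> real mat \<Rightarrow> nat set list \<Rightarrow> (nat \<Rightarrow> real vec) \<Rightarrow> (nat \<Rightarrow> real mat) \<Rightarrow> (nat \<Rightarrow> real mat) \<Rightarrow> real mat" where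
  "thresholded_ismd_Omega A Ahat Ps \<gamma> h D =
     block_mat (loc_rank A Ps) (length Ps) (Lam Ahat Ps (ismd_G A Ps \<gamma> h D))"

definition threshold :: "real \<Rightarrow> real" where
  "threshold x = (if x < -0.5 then -1 else if x \<le> 0.5 then 0 else 1)"

text \<open>Step (3): \<open>G_ext P L\<close>.\<close>

definition ismd_output ::
  "real mat \<Rightarrow> nat set list \<Rightarrow> (nat \<Rightarrow> real mat) \<Rightarrow> real mat \<Rightarrow> real mat \<Rightarrow> real mat" where
  "ismd_output A Ps G P L = g_ext (dim_row A) Ps (loc_rank A Ps) G * P * L"

subsection \<open>Perturbation\<close>

definition eig_perturbation ::
  "real mat \<Rightarrow> nat set list \<Rightarrow> real \<Rightarrow> real \<Rightarrow> (nat \<Rightarrow> real vec) \<Rightarrow> (nat \<Rightarrow> real mat) \<Rightarrow> (nat \<Rightarrow> real mat) \<Rightarrow> bool" where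
  "eig_perturbation A Ps Ceig \<epsilon> \<gamma> h E \<longleftrightarrow> (\<forall>m<length Ps.
     E m \<in> carrier_mat (card (Ps ! m)) (card (Ps ! m)) \<and> spec_norm (E m) \<le> Ceig \<and>
     truncated (loc_rank A Ps m) (\<gamma> m) (h m) =
       (1\<^sub>m (card (Ps ! m)) + \<epsilon> \<cdot>\<^sub>m E m) * blk A Ps m m *
       (1\<^sub>m (card (Ps ! m)) + \<epsilon> \<cdot>\<^sub>m transpose_mat (E m)))"

definition noisy_run ::
  "nat \<Rightarrow> real mat \<Rightarrow> nat set list \<Rightarrow> real \<Rightarrow> real \<Rightarrow> real mat \<Rightarrow> (nat \<Rightarrow> real mat) \<Rightarrow>
   (nat \<Rightarrow> real vec) \<Rightarrow> (nat \<Rightarrow> real mat) \<Rightarrow> (nat \<Rightarrow> real mat) \<Rightarrow> bool" where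
  "noisy_run N A Ps Ceig \<epsilon> Atilde E \<gamma> h D \<longleftrightarrow>
     Atilde \<in> carrier_mat N N \<and> transpose_mat Atilde = Atilde \<and> spec_norm Atilde \<le> 1 \<and>
     sym_psd N (A + \<epsilon> \<cdot>\<^sub>m Atilde) \<and>
     thresholded_ismd_run A (A + \<epsilon> \<cdot>\<^sub>m Atilde) Ps \<gamma> h D \<and>
     spectral_gap A Ps \<gamma> \<and>
     eig_perturbation A Ps Ceig \<epsilon> \<gamma> h E"

text \<open>
  \<open>Ghat = (I + \<epsilon> Eeig) G (I + \<epsilon> Ejd + O(\<epsilon>\<^sup>2)) J\<close> with the Frobenius norm of \<open>Ejd\<close> at most \<open>Cjd\<close>; the
  remainder \<open>R\<close> is bounded by \<open>CR * \<epsilon>\<^sup>2\<close>.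
\<close>

definition jd_perturbation ::
  "real \<Rightarrow> real \<Rightarrow> real \<Rightarrow> real mat \<Rightarrow> real mat \<Rightarrow> real mat \<Rightarrow> real mat \<Rightarrow> bool" where
  "jd_perturbation Cjd CR \<epsilon> Eeig G Ghat J \<longleftrightarrow>
     (\<exists>Ejd \<in> carrier_mat (dim_col G) (dim_col G). \<exists>R \<in> carrier_mat (dim_col G) (dim_col G).
        frob_norm Ejd \<le> Cjd \<and> spec_norm R \<le> CR * \<epsilon>\<^sup>2 \<and>
        Ghat = (1\<^sub>m (dim_row G) + \<epsilon> \<cdot>\<^sub>m Eeig) * G * (1\<^sub>m (dim_col G) + \<epsilon> \<cdot>\<^sub>m Ejd + R) * J)"

definition min_singular_value :: "nat set list \<Rightarrow> (nat \<Rightarrow> real mat) \<Rightarrow> real" where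
  "min_singular_value Ps G = Min (\<Union>m<length Ps. singular_values (G m))"

end

theory Submission
  imports Defs "HOL-Analysis.L2_Norm"
begin

text \<open>
  On patch \<open>m\<close> let \<open>B m\<close> have as columns the restrictions of the intrinsic sparse modes that do not
  vanish there. Then \<open>A\<close> has the blocks \<open>B m Pi m n (B n)\<^sup>T\<close>, where the 0/1 matrix \<open>Pi m n\<close> matches
  the columns that come from the same mode. Two factorizations \<open>H H\<^sup>T = B B\<^sup>T\<close> with \<open>B\<close> of full column
  rank and equally many columns differ by an orthogonal factor, so a run of the ISMD only has to find
  an orthogonal matrix \<open>W\<close> that jointly diagonalizes the diagonal 0/1 matrices \<open>Pi m n (Pi m n)\<^sup>T\<close>;
  by identifiability these separate the indices, which forces \<open>W\<close> to be a signed permutation matrix.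
  If the matrices are only known up to \<open>O(\<epsilon>)\<close>, comparing the minimal value of the objective with its
  value at the identity shows that the off-diagonal entries after the joint diagonalization are
  \<open>O(\<epsilon>)\<close>, and \<open>W\<close> is a signed permutation matrix up to \<open>O(\<epsilon>)\<close>. All remaining estimates follow from the
  perturbation theory of the pseudo-inverse; they use the Frobenius norm, which is equivalent to the
  spectral norm up to factors depending on \<open>N\<close>.
\<close>

subsection \<open>Frobenius and spectral norm\<close>

text \<open>The constants have to be fixed before the run and the noise, whereas \<open>H\<close>,
  \<open>D\<close> and the signs and order of the columns vary with the run. Hence everything is
  measured against the fixed modes \<open>B m\<close>: an exact local piece is
  \<open>B m * J\<close> with a signed permutation \<open>J\<close>, so the norm of its
  pseudo-inverse is the same for all runs. For a noisy run the reference is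
  \<open>X m = (I + \<epsilon> E m) * B m\<close>. By the assumption on the truncated blocks,
  \<open>X m\<close> times its transpose is exactly the truncated block, so the orthogonal factor
  between \<open>H m\<close> and \<open>X m\<close> is exact as well and no perturbation theory of
  eigenvectors enters. Smallness and size are kept apart. The bound \<open>\<epsilon>0\<close> may
  depend on all of \<open>A\<close> and is expressed through \<open>B\<close>; the constants of (a)
  and (c) may only see \<open>N\<close>, the norm of \<open>A\<close>, \<open>Ceig\<close>,
  \<open>Cjd\<close> and, in (a), the smallest singular value. The quadratic remainder is therefore
  absorbed by shrinking \<open>\<epsilon>0\<close>. Estimates are kept coarse on purpose: local
  dimensions are replaced by \<open>N\<close>, and square roots by larger polynomials.\<close>

lemma mult_assoc_dim:
  "dim_col A = dim_row B \<Longrightarrow> dim_col B = dim_row C \<Longrightarrow> A * B * C = A * (B * (C :: real mat))"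
  by (intro assoc_mult_mat) auto

lemma transpose_mult_dim:
  "dim_col A = dim_row B \<Longrightarrow> transpose_mat (A * B) = transpose_mat B * transpose_mat (A :: real mat)"
  by (intro transpose_mult) auto

lemma mult_inv_cancel:
  "P * Q = 1\<^sub>m (dim_row A) \<Longrightarrow> dim_col P = dim_row Q \<Longrightarrow> P * (Q * A) = (A :: real mat)"
  by (metis index_mult_mat(3) index_one_mat(3) left_mult_one_mat' mult_assoc_dim)

lemma frob_norm_L2_set:
  "frob_norm A = L2_set (\<lambda>(i,j). A $$ (i,j)) ({..<dim_row A} \<times> {..<dim_col A})"
  by (simp add: frob_norm_def L2_set_def sum.cartesian_product case_prod_beta)

lemma frob_norm_nonneg [simp]: "0 \<le> frob_norm A"
  by (simp add: frob_norm_def sum_nonneg)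

lemma frob_norm_sq: "(frob_norm A)\<^sup>2 = (\<Sum>i<dim_row A. \<Sum>j<dim_col A. (A $$ (i,j))\<^sup>2)"
  by (simp add: frob_norm_def sum_nonneg)

lemma frob_norm_triangle:
  assumes "A \<in> carrier_mat n m" "B \<in> carrier_mat n m"
  shows "frob_norm (A + B) \<le> frob_norm A + frob_norm B"
proof -
  have "frob_norm (A + B) = L2_set (\<lambda>p. A $$ p + B $$ p) ({..<n} \<times> {..<m})"
    unfolding frob_norm_L2_set using assms by (auto intro!: L2_set_cong)
  also have "\<dots> \<le> L2_set (\<lambda>p. A $$ p) ({..<n} \<times> {..<m}) + L2_set (\<lambda>p. B $$ p) ({..<n} \<times> {..<m})"
    by (rule L2_set_triangle_ineq)
  finally show ?thesis
    using assms by (simp add: frob_norm_L2_set case_prod_beta)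
qed

lemma frob_norm_smult: "frob_norm (c \<cdot>\<^sub>m A) = \<bar>c\<bar> * frob_norm A"
proof -
  have "(frob_norm (c \<cdot>\<^sub>m A))\<^sup>2 = (\<bar>c\<bar> * frob_norm A)\<^sup>2"
    by (simp add: frob_norm_sq power_mult_distrib sum_distrib_left)
  then show ?thesis by (simp add: power2_eq_iff_nonneg)
qed

lemma frob_norm_triangle_minus:
  assumes "A \<in> carrier_mat n m" "B \<in> carrier_mat n m"
  shows "frob_norm (A - B) \<le> frob_norm A + frob_norm B"
proof -
  have "A - B = A + (-1) \<cdot>\<^sub>m B" using assms by (intro eq_matI) auto
  moreover have "frob_norm (A + (-1) \<cdot>\<^sub>m B) \<le> frob_norm A + frob_norm ((-1) \<cdot>\<^sub>m B)"
    using assms by (intro frob_norm_triangle) auto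
  ultimately show ?thesis by (simp add: frob_norm_smult)
qed

lemma frob_norm_transpose [simp]: "frob_norm (transpose_mat A) = frob_norm A"
  unfolding frob_norm_def
  by (subst sum.swap) simp

lemma sum_mult_sq_le:
  fixes f g :: "'a \<Rightarrow> real"
  shows "(\<Sum>i\<in>S. f i * g i)\<^sup>2 \<le> (\<Sum>i\<in>S. (f i)\<^sup>2) * (\<Sum>i\<in>S. (g i)\<^sup>2)"
proof -
  have "\<bar>\<Sum>i\<in>S. f i * g i\<bar> \<le> (\<Sum>i\<in>S. \<bar>f i\<bar> * \<bar>g i\<bar>)"
    by (rule order_trans[OF sum_abs]) (simp add: abs_mult)
  also have "\<dots> \<le> L2_set f S * L2_set g S" by (rule L2_set_mult_ineq)
  finally have "\<bar>\<Sum>i\<in>S. f i * g i\<bar>\<^sup>2 \<le> (L2_set f S * L2_set g S)\<^sup>2"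
    by (intro power_mono) auto
  then show ?thesis
    by (simp add: L2_set_def power_mult_distrib sum_nonneg)
qed

lemma frob_norm_mult:
  assumes "A \<in> carrier_mat n k" "B \<in> carrier_mat k m"
  shows "frob_norm (A * B) \<le> frob_norm A * frob_norm B"
proof -
  have "(frob_norm (A * B))\<^sup>2 = (\<Sum>i<n. \<Sum>j<m. (\<Sum>l<k. A $$ (i,l) * B $$ (l,j))\<^sup>2)"
    unfolding frob_norm_sq using assms
    by (auto simp: scalar_prod_def lessThan_atLeast0 intro!: sum.cong)
  also have "\<dots> \<le> (\<Sum>i<n. \<Sum>j<m. (\<Sum>l<k. (A $$ (i,l))\<^sup>2) * (\<Sum>l<k. (B $$ (l,j))\<^sup>2))"
    by (intro sum_mono sum_mult_sq_le)
  also have "\<dots> = (\<Sum>i<n. \<Sum>l<k. (A $$ (i,l))\<^sup>2) * (\<Sum>j<m. \<Sum>l<k. (B $$ (l,j))\<^sup>2)"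
    by (simp add: sum_product)
  also have "(\<Sum>j<m. \<Sum>l<k. (B $$ (l,j))\<^sup>2) = (\<Sum>l<k. \<Sum>j<m. (B $$ (l,j))\<^sup>2)"
    by (rule sum.swap)
  also have "(\<Sum>i<n. \<Sum>l<k. (A $$ (i,l))\<^sup>2) * \<dots> = (frob_norm A * frob_norm B)\<^sup>2"
    using assms by (simp add: power_mult_distrib frob_norm_sq)
  finally show ?thesis
    by (rule power2_le_imp_le) auto
qed

lemma frob_norm_mult_le:
  assumes "A \<in> carrier_mat n k" "B \<in> carrier_mat k m" "frob_norm A \<le> a" "frob_norm B \<le> b"
  shows "frob_norm (A * B) \<le> a * b"
  using assms frob_norm_mult[OF assms(1,2)]
  by (meson frob_norm_nonneg mult_mono order_trans)

lemma entry_le_frob_norm: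
  assumes "i < dim_row A" "j < dim_col A"
  shows "\<bar>A $$ (i,j)\<bar> \<le> frob_norm A"
proof -
  have "(A $$ (i,j))\<^sup>2 \<le> (\<Sum>j<dim_col A. (A $$ (i,j))\<^sup>2)"
    using assms by (intro member_le_sum) auto
  also have "\<dots> \<le> (frob_norm A)\<^sup>2"
    unfolding frob_norm_sq using assms
    by (intro member_le_sum[where f = "\<lambda>i. \<Sum>j<dim_col A. (A $$ (i,j))\<^sup>2"]) (auto intro: sum_nonneg)
  finally show ?thesis
    by (simp add: abs_le_square_iff[symmetric])
qed

lemma frob_norm_le_entries:
  assumes entries: "\<And>i j. i < dim_row A \<Longrightarrow> j < dim_col A \<Longrightarrow> \<bar>A $$ (i,j)\<bar> \<le> c"
    and N: "dim_row A \<le> N" "dim_col A \<le> N" and c: "0 \<le> c"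
  shows "frob_norm A \<le> real N * c"
proof -
  have sq: "(A $$ (i,j))\<^sup>2 \<le> c\<^sup>2" if "i < dim_row A" "j < dim_col A" for i j
    using power_mono[OF entries[OF that] abs_ge_zero, of 2] by (simp only: power2_abs)
  have "(frob_norm A)\<^sup>2 \<le> (\<Sum>i<dim_row A. \<Sum>j<dim_col A. c\<^sup>2)"
    unfolding frob_norm_sq by (intro sum_mono sq) (simp_all only: lessThan_iff)
  also have "\<dots> = (real (dim_row A) * real (dim_col A)) * c\<^sup>2"
    by (simp only: sum_constant card_lessThan mult.assoc)
  also have "\<dots> \<le> (real N * real N) * c\<^sup>2"
    using N by (intro mult_right_mono mult_mono) (simp_all only: of_nat_le_iff of_nat_0_le_iff zero_le_power2)
  also have "\<dots> = (real N * c)\<^sup>2" by (simp only: power2_eq_square mult_ac)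
  finally show ?thesis
    by (rule power2_le_imp_le) (simp add: c)
qed

lemma frob_norm_sq_gram:
  "(frob_norm A)\<^sup>2 = (\<Sum>j<dim_col A. (transpose_mat A * A) $$ (j,j))"
  unfolding frob_norm_sq
  by (subst sum.swap) (auto simp: scalar_prod_def power2_eq_square lessThan_atLeast0 intro!: sum.cong)

text \<open>The squared norm is the trace of the Gram matrix. A left factor with orthonormal columns
  cancels in the Gram matrix, which is how the isometry lemma below uses this.\<close>

lemma frob_norm_gram_cong:
  assumes "transpose_mat A * A = transpose_mat B * B"
  shows "frob_norm A = frob_norm B"
proof -
  have "dim_col A = dim_col B"
    using arg_cong[OF assms, of dim_col] by simp
  then have "(frob_norm A)\<^sup>2 = (frob_norm B)\<^sup>2"
    unfolding frob_norm_sq_gram assms by simp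
  then show ?thesis by (simp add: power2_eq_iff_nonneg)
qed

lemma frob_norm_isometry:
  assumes "U \<in> carrier_mat n k" "transpose_mat U * U = 1\<^sub>m k" "A \<in> carrier_mat k m"
  shows "frob_norm (U * A) = frob_norm A"
proof (rule frob_norm_gram_cong)
  have d: "dim_row U = n" "dim_col U = k" "dim_row A = k" using assms by auto
  then have "transpose_mat U * (U * A) = A"
    by (intro mult_inv_cancel) (simp_all add: assms(2))
  then show "transpose_mat (U * A) * (U * A) = transpose_mat A * A"
    by (simp add: d transpose_mult_dim mult_assoc_dim)
qed

lemma frob_norm_one_le: "frob_norm (1\<^sub>m k) \<le> real k"
  using frob_norm_le_entries[of "1\<^sub>m k" 1 k] by simp

lemma mult_mat_vec_sq_le:
  assumes "A \<in> carrier_mat n m" "v \<in> carrier_vec m"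
  shows "(A *\<^sub>v v) \<bullet> (A *\<^sub>v v) \<le> (frob_norm A)\<^sup>2 * (v \<bullet> v)"
proof -
  have "(A *\<^sub>v v) \<bullet> (A *\<^sub>v v) = (\<Sum>i<n. (\<Sum>j<m. A $$ (i,j) * v $ j)\<^sup>2)"
    using assms by (auto simp: scalar_prod_def power2_eq_square lessThan_atLeast0 intro!: sum.cong)
  also have "\<dots> \<le> (\<Sum>i<n. (\<Sum>j<m. (A $$ (i,j))\<^sup>2) * (\<Sum>j<m. (v $ j)\<^sup>2))"
    by (intro sum_mono sum_mult_sq_le)
  also have "\<dots> = (frob_norm A)\<^sup>2 * (v \<bullet> v)"
    unfolding frob_norm_sq sum_distrib_right
    using assms by (auto simp: scalar_prod_def power2_eq_square lessThan_atLeast0 intro!: sum.cong)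
  finally show ?thesis .
qed

lemma scalar_prod_self_nonneg: "0 \<le> v \<bullet> (v :: real vec)"
  by (simp add: scalar_prod_def sum_nonneg)

lemma scalar_prod_self_eq_0:
  assumes "v \<in> carrier_vec n" "v \<bullet> (v :: real vec) = 0"
  shows "v = 0\<^sub>v n"
  using conjugate_square_eq_0_vec[OF assms(1)] assms(2)
  by (simp add: conjugate_vec_def scalar_prod_def)

lemma spec_norm_bdd:
  "sqrt ((A *\<^sub>v v) \<bullet> (A *\<^sub>v v)) \<le> frob_norm A" if "v \<in> carrier_vec (dim_col A)" "v \<bullet> v \<le> 1"
proof -
  have "(A *\<^sub>v v) \<bullet> (A *\<^sub>v v) \<le> (frob_norm A)\<^sup>2 * (v \<bullet> v)"
    using that by (intro mult_mat_vec_sq_le) auto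
  also have "\<dots> \<le> (frob_norm A)\<^sup>2" using that by (simp add: mult_left_le)
  finally show ?thesis by (simp add: real_le_lsqrt)
qed

lemma spec_norm_le_frob_norm: "spec_norm A \<le> frob_norm A"
  unfolding spec_norm_def
proof (rule cSup_least)
  show "{sqrt ((A *\<^sub>v v) \<bullet> (A *\<^sub>v v)) |v. v \<in> carrier_vec (dim_col A) \<and> v \<bullet> v \<le> 1} \<noteq> {}"
    by (auto intro: exI[of _ "0\<^sub>v (dim_col A)"])
qed (auto intro: spec_norm_bdd)

lemma spec_norm_upper:
  assumes "v \<in> carrier_vec (dim_col A)" "v \<bullet> v \<le> 1"
  shows "sqrt ((A *\<^sub>v v) \<bullet> (A *\<^sub>v v)) \<le> spec_norm A"
  unfolding spec_norm_def
  using assms by (intro cSup_upper bdd_aboveI[of _ "frob_norm A"]) (auto intro: spec_norm_bdd)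

lemma spec_norm_nonneg [simp]: "0 \<le> spec_norm A"
  by (rule order_trans[OF _ spec_norm_upper[of "0\<^sub>v (dim_col A)"]])
     (auto simp: scalar_prod_self_nonneg)

lemma col_sq_le_spec_norm:
  assumes "j < dim_col A"
  shows "(\<Sum>i<dim_row A. (A $$ (i,j))\<^sup>2) \<le> (spec_norm A)\<^sup>2"
proof -
  have "A *\<^sub>v unit_vec (dim_col A) j = col A j"
    using assms by (intro eq_vecI) auto
  then have "sqrt (col A j \<bullet> col A j) \<le> spec_norm A"
    using spec_norm_upper[of "unit_vec (dim_col A) j" A] assms by simp
  moreover have "col A j \<bullet> col A j = (\<Sum>i<dim_row A. (A $$ (i,j))\<^sup>2)"
    using assms by (auto simp: scalar_prod_def power2_eq_square lessThan_atLeast0 intro!: sum.cong)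
  ultimately show ?thesis
    by (simp add: real_le_lsqrt sqrt_le_D)
qed

lemma entry_le_spec_norm:
  assumes "i < dim_row A" "j < dim_col A"
  shows "\<bar>A $$ (i,j)\<bar> \<le> spec_norm A"
proof -
  have "(A $$ (i,j))\<^sup>2 \<le> (\<Sum>i<dim_row A. (A $$ (i,j))\<^sup>2)"
    using assms by (intro member_le_sum[where f = "\<lambda>i. (A $$ (i,j))\<^sup>2"]) auto
  also have "\<dots> \<le> (spec_norm A)\<^sup>2" by (rule col_sq_le_spec_norm) fact
  finally show ?thesis
    by (simp add: abs_le_square_iff[symmetric])
qed

lemma frob_norm_le_spec_norm:
  assumes "dim_row A \<le> N" "dim_col A \<le> N"
  shows "frob_norm A \<le> real N * spec_norm A"
  using assms by (intro frob_norm_le_entries entry_le_spec_norm) auto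

subsection \<open>Orthogonal factors and pseudo-inverses\<close>

lemma orth_matD:
  assumes "orth_mat k U"
  shows "U \<in> carrier_mat k k" "transpose_mat U * U = 1\<^sub>m k" "U * transpose_mat U = 1\<^sub>m k"
proof -
  show U: "U \<in> carrier_mat k k" and UU: "transpose_mat U * U = 1\<^sub>m k"
    using assms by (auto simp: orth_mat_def orthonormal_cols_def)
  show "U * transpose_mat U = 1\<^sub>m k"
    by (rule mat_mult_left_right_inverse[OF _ U UU]) (use U in auto)
qed

lemma orth_matI: "U \<in> carrier_mat k k \<Longrightarrow> transpose_mat U * U = 1\<^sub>m k \<Longrightarrow> orth_mat k U"
  by (auto simp: orth_mat_def orthonormal_cols_def)

lemma orth_mat_transpose: "orth_mat k U \<Longrightarrow> orth_mat k (transpose_mat U)"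
  using orth_matD[of k U] by (intro orth_matI) auto

lemma orth_mat_mult:
  assumes "orth_mat k U" "orth_mat k V"
  shows "orth_mat k (U * V)"
proof (rule orth_matI)
  note U = orth_matD[OF assms(1)] and V = orth_matD[OF assms(2)]
  show "U * V \<in> carrier_mat k k" using U(1) V(1) by auto
  have d: "dim_row U = k" "dim_col U = k" "dim_row V = k" "dim_col V = k" using U(1) V(1) by auto
  then have "transpose_mat U * (U * V) = V"
    by (intro mult_inv_cancel) (simp_all add: U(2))
  then show "transpose_mat (U * V) * (U * V) = 1\<^sub>m k"
    by (simp add: d transpose_mult_dim mult_assoc_dim V(2))
qed

lemma frob_norm_orth_left:
  "orth_mat k U \<Longrightarrow> A \<in> carrier_mat k m \<Longrightarrow> frob_norm (U * A) = frob_norm A"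
  using orth_matD[of k U] by (intro frob_norm_isometry) auto

lemma frob_norm_orth_right:
  assumes "orth_mat k U" "A \<in> carrier_mat m k"
  shows "frob_norm (A * U) = frob_norm A"
proof -
  have "frob_norm (A * U) = frob_norm (transpose_mat U * transpose_mat A)"
    using assms orth_matD(1)[OF assms(1)] by (simp flip: frob_norm_transpose[of "A * U"] add: transpose_mult_dim)
  also have "\<dots> = frob_norm A"
    using assms orth_mat_transpose[OF assms(1)] by (simp add: frob_norm_orth_left[of k _ _ m])
  finally show ?thesis .
qed

text \<open>Trivial kernel rather than a rank condition: this gives directly that the Gram matrix is
  invertible, and that a combination of columns vanishing on a patch has zero coefficients.\<close>

definition full_col_rank :: "real mat \<Rightarrow> bool" where
  "full_col_rank H \<longleftrightarrow>
     (\<forall>x \<in> carrier_vec (dim_col H). H *\<^sub>v x = 0\<^sub>v (dim_row H) \<longrightarrow> x = 0\<^sub>v (dim_col H))"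

lemma full_col_rankI_left_inverse:
  assumes "H \<in> carrier_mat n k" "L \<in> carrier_mat k n" "L * H = 1\<^sub>m k"
  shows "full_col_rank H"
  unfolding full_col_rank_def
proof (intro ballI impI)
  fix x assume x: "x \<in> carrier_vec (dim_col H)" and 0: "H *\<^sub>v x = 0\<^sub>v (dim_row H)"
  have "x = (L * H) *\<^sub>v x" using assms x by simp
  also have "\<dots> = L *\<^sub>v (H *\<^sub>v x)" using assms x by (intro assoc_mult_mat_vec) auto
  also have "\<dots> = 0\<^sub>v k" unfolding 0 using assms by (intro eq_vecI) auto
  finally show "x = 0\<^sub>v (dim_col H)" using assms by auto
qed

text \<open>A vector killed by the Gram matrix is killed by \<open>H\<close>, because its scalar
  product with its image is the squared length of \<open>H *\<^sub>v v\<close>.\<close>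

lemma mat_inverse_gram:
  assumes H: "H \<in> carrier_mat n k" and fcr: "full_col_rank H"
  obtains M where "mat_inverse (transpose_mat H * H) = Some M" "M \<in> carrier_mat k k"
    "transpose_mat H * H * M = 1\<^sub>m k" "M * (transpose_mat H * H) = 1\<^sub>m k"
proof -
  let ?S = "transpose_mat H * H"
  have S: "?S \<in> carrier_mat k k" using H by auto
  have "det ?S \<noteq> 0"
  proof
    assume "det ?S = 0"
    then obtain v where v: "v \<in> carrier_vec k" "v \<noteq> 0\<^sub>v k" "?S *\<^sub>v v = 0\<^sub>v k"
      using det_0_iff_vec_prod_zero_field[OF S] by auto
    have Hv: "H *\<^sub>v v \<in> carrier_vec n" using H v by auto
    have "(H *\<^sub>v v) \<bullet> (H *\<^sub>v v) = (transpose_mat H *\<^sub>v (H *\<^sub>v v)) \<bullet> v"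
      by (rule transpose_vec_mult_scalar[symmetric, OF H v(1) Hv])
    also have "transpose_mat H *\<^sub>v (H *\<^sub>v v) = ?S *\<^sub>v v"
      using H v(1) by (intro assoc_mult_mat_vec[symmetric]) auto
    also have "\<dots> \<bullet> v = 0" using v by simp
    finally have "H *\<^sub>v v = 0\<^sub>v n" by (rule scalar_prod_self_eq_0[OF Hv])
    then show False using fcr v H by (auto simp: full_col_rank_def)
  qed
  then have "?S \<in> Units (ring_mat TYPE(real) k ())"
    by (rule det_non_zero_imp_unit[OF S])
  then obtain M where M: "mat_inverse ?S = Some M"
    using mat_inverse(1)[OF S, where b = "()"] by (cases "mat_inverse ?S") auto
  show ?thesis using mat_inverse(2)[OF S M] M that by auto
qed

lemma pinv_full_col_rank:
  assumes H: "H \<in> carrier_mat n k" and fcr: "full_col_rank H"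
  shows "pinv H \<in> carrier_mat k n" "pinv H * H = 1\<^sub>m k"
    "transpose_mat (H * pinv H) = H * pinv H"
proof -
  let ?S = "transpose_mat H * H"
  obtain M where M: "mat_inverse ?S = Some M" "M \<in> carrier_mat k k" "?S * M = 1\<^sub>m k" "M * ?S = 1\<^sub>m k"
    using mat_inverse_gram[OF assms] .
  have eq: "pinv H = M * transpose_mat H" using M(1) by (simp add: pinv_def)
  show "pinv H \<in> carrier_mat k n" using M(2) H unfolding eq by auto
  show "pinv H * H = 1\<^sub>m k"
    unfolding eq using M(2,4) H by (simp add: mult_assoc_dim)
  have St: "transpose_mat ?S = ?S" by (simp add: transpose_mult_dim)
  have d: "dim_row M = k" "dim_col M = k" "dim_row H = n" "dim_col H = k" using M(2) H by auto
  have MtS: "transpose_mat M * ?S = 1\<^sub>m k"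
    using arg_cong[OF M(3), of transpose_mat] by (simp add: transpose_mult_dim d)
  have "transpose_mat M = transpose_mat M * (?S * M)" using M(2) unfolding M(3) by simp
  also have "\<dots> = (transpose_mat M * ?S) * M" by (simp add: mult_assoc_dim d)
  also have "\<dots> = M" using M(2) unfolding MtS by simp
  finally have Mt: "transpose_mat M = M" .
  show "transpose_mat (H * pinv H) = H * pinv H"
    unfolding eq by (simp add: d transpose_mult_dim mult_assoc_dim Mt)
qed

text \<open>Symmetry of \<open>H * P\<close> turns \<open>transpose_mat H * (H * P)\<close> into the
  transpose of \<open>H * P * H = H\<close>; applying the inverse Gram matrix isolates
  \<open>P\<close>. So a left inverse is the pseudo-inverse as soon as it induces an orthogonal
  projection.\<close>

lemma pinv_eqI:
  assumes H: "H \<in> carrier_mat n k" and P: "P \<in> carrier_mat k n" and PH: "P * H = 1\<^sub>m k"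
    and sym: "transpose_mat (H * P) = H * P"
  shows "pinv H = P"
proof -
  have fcr: "full_col_rank H" using full_col_rankI_left_inverse[OF H P PH] .
  obtain M where M: "mat_inverse (transpose_mat H * H) = Some M" "M \<in> carrier_mat k k"
    "M * (transpose_mat H * H) = 1\<^sub>m k"
    using mat_inverse_gram[OF H fcr] .
  have d: "dim_row M = k" "dim_col M = k" "dim_row H = n" "dim_col H = k" "dim_row P = k" "dim_col P = n"
    using M(2) H P by auto
  have "transpose_mat H * (H * P) = transpose_mat H * transpose_mat (H * P)" unfolding sym ..
  also have "\<dots> = transpose_mat (H * P * H)" by (simp add: d transpose_mult_dim)
  also have "H * P * H = H" using H by (simp add: d mult_assoc_dim PH)
  finally have HHP: "transpose_mat H * (H * P) = transpose_mat H" .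
  have "P = M * (transpose_mat H * H) * P" using P unfolding M(3) by simp
  also have "\<dots> = M * (transpose_mat H * (H * P))" by (simp add: d mult_assoc_dim)
  also have "\<dots> = pinv H" unfolding HHP by (simp add: pinv_def M(1))
  finally show ?thesis ..
qed

text \<open>The projection \<open>H * pinv H\<close> onto the range does not change when the basis
  is rotated by \<open>U\<close>, so \<open>pinv_eqI\<close> applies to the obvious
  candidate.\<close>

lemma pinv_mult_orth:
  assumes H: "H \<in> carrier_mat n k" and fcr: "full_col_rank H" and U: "orth_mat k U"
  shows "full_col_rank (H * U)" "pinv (H * U) = transpose_mat U * pinv H"
proof -
  note P = pinv_full_col_rank[OF H fcr] and U = orth_matD[OF U]
  have d: "dim_row H = n" "dim_col H = k" "dim_row (pinv H) = k" "dim_col (pinv H) = n"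
    "dim_row U = k" "dim_col U = k" using H P(1) U(1) by auto
  have PHU: "pinv H * (H * U) = U" by (intro mult_inv_cancel) (simp_all add: P(2) d)
  have UUP: "U * (transpose_mat U * pinv H) = pinv H" by (intro mult_inv_cancel) (simp_all add: U(3) d)
  have 1: "(transpose_mat U * pinv H) * (H * U) = 1\<^sub>m k"
    by (simp add: d mult_assoc_dim PHU U(2))
  show "full_col_rank (H * U)"
    by (rule full_col_rankI_left_inverse[OF _ _ 1]) (use H P(1) U(1) in auto)
  show "pinv (H * U) = transpose_mat U * pinv H"
  proof (rule pinv_eqI[OF _ _ 1])
    have "H * U * (transpose_mat U * pinv H) = H * pinv H"
      by (simp add: d mult_assoc_dim UUP)
    then show "transpose_mat (H * U * (transpose_mat U * pinv H)) = H * U * (transpose_mat U * pinv H)"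
      using P(3) by (simp only:)
  qed (use H P(1) U(1) in auto)
qed

lemma frob_norm_pinv_mult_orth:
  assumes "H \<in> carrier_mat n k" "full_col_rank H" "orth_mat k U"
  shows "frob_norm (pinv (H * U)) = frob_norm (pinv H)"
  unfolding pinv_mult_orth(2)[OF assms]
  using orth_mat_transpose[OF assms(3)] pinv_full_col_rank(1)[OF assms(1,2)]
  by (rule frob_norm_orth_left)

text \<open>Each diagonal entry is the squared length of its column. It therefore dominates its own
  square, which forces it to be at most 1, and it dominates the squares of all other entries of the
  column.\<close>

lemma frob_norm_projection:
  assumes Q: "Q \<in> carrier_mat n n" and sym: "transpose_mat Q = Q" and idem: "Q * Q = Q"
  shows "frob_norm Q \<le> real n" "j < n \<Longrightarrow> Q $$ (j,j) \<le> 1"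
proof -
  have sq: "Q $$ (j,j) = (\<Sum>i<n. (Q $$ (i,j))\<^sup>2)" if j: "j < n" for j
  proof -
    have "Q $$ (j,j) = (transpose_mat Q * Q) $$ (j,j)" by (simp only: sym idem)
    also have "\<dots> = (\<Sum>i<n. (Q $$ (i,j))\<^sup>2)"
      using j Q by (auto simp: scalar_prod_def power2_eq_square lessThan_atLeast0 intro!: sum.cong)
    finally show ?thesis .
  qed
  have ge: "(Q $$ (i,j))\<^sup>2 \<le> Q $$ (j,j)" if "i < n" "j < n" for i j
    unfolding sq[OF that(2)] by (rule member_le_sum) (use that in auto)
  have le1: "Q $$ (j,j) \<le> 1" if j: "j < n" for j
  proof (rule ccontr)
    assume "\<not> ?thesis"
    then have "1 * Q $$ (j,j) < Q $$ (j,j) * Q $$ (j,j)" by (intro mult_strict_right_mono) auto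
    then show False using ge[OF j j] by (simp add: power2_eq_square)
  qed
  then show "j < n \<Longrightarrow> Q $$ (j,j) \<le> 1" .
  have "\<bar>Q $$ (i,j)\<bar> \<le> 1" if "i < n" "j < n" for i j
    using order_trans[OF ge[OF that] le1[OF that(2)]] by (simp add: abs_square_le_1)
  then have "frob_norm Q \<le> real n * 1" using Q by (intro frob_norm_le_entries) auto
  then show "frob_norm Q \<le> real n" by simp
qed

text \<open>
  By traces: \<open>U\<^sup>T U\<close> is an orthogonal projection, so its diagonal entries are at most 1, and its trace
  is that of \<open>U U\<^sup>T\<close>.
\<close>

lemma orthonormal_rows:
  assumes U: "U \<in> carrier_mat k s" and UU: "U * transpose_mat U = 1\<^sub>m k"
  shows "k \<le> s" "k = s \<Longrightarrow> orth_mat k U"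
proof -
  let ?P = "transpose_mat U * U"
  have d: "dim_row U = k" "dim_col U = s" using U by auto
  have "U * (transpose_mat U * U) = U" by (intro mult_inv_cancel) (simp_all add: UU d)
  then have PP: "?P * ?P = ?P" by (simp add: mult_assoc_dim)
  have Pt: "transpose_mat ?P = ?P" by (simp add: transpose_mult_dim)
  have le1: "?P $$ (j,j) \<le> 1" if "j < s" for j
    by (rule frob_norm_projection(2)[OF _ Pt PP that]) (use U in auto)
  have "real k = (\<Sum>j<k. (U * transpose_mat U) $$ (j,j))" unfolding UU by simp
  also have "\<dots> = (frob_norm (transpose_mat U))\<^sup>2" by (subst frob_norm_sq_gram) (simp add: d)
  also have "\<dots> = (\<Sum>j<s. ?P $$ (j,j))" by (simp only: frob_norm_transpose frob_norm_sq_gram d)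
  also have "\<dots> \<le> (\<Sum>j<s. 1)" using le1 by (intro sum_mono) auto
  finally show "k \<le> s" by simp
  assume "k = s"
  then show "orth_mat k U"
    using U UU mat_mult_left_right_inverse[of U k "transpose_mat U"] by (intro orth_matI) auto
qed

text \<open>The traces of \<open>pinv H * H\<close> and \<open>H * pinv H\<close> agree. The first
  is \<open>k\<close>, the second is that of an orthogonal projection of size
  \<open>n\<close>.\<close>

lemma full_col_rank_dim_le:
  assumes H: "H \<in> carrier_mat n k" and fcr: "full_col_rank H"
  shows "k \<le> n"
proof -
  note P = pinv_full_col_rank[OF assms]
  have d: "dim_row H = n" "dim_col H = k" "dim_row (pinv H) = k" "dim_col (pinv H) = n"
    using H P(1) by auto
  have "pinv H * (H * pinv H) = pinv H" by (intro mult_inv_cancel) (simp_all add: P(2) d)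
  then have idem: "H * pinv H * (H * pinv H) = H * pinv H" by (simp add: mult_assoc_dim d)
  have "real k = (\<Sum>j<k. (pinv H * H) $$ (j,j))" unfolding P(2) by simp
  also have "\<dots> = (\<Sum>j<k. \<Sum>a<n. pinv H $$ (j,a) * H $$ (a,j))"
    using d by (intro sum.cong refl) (simp add: scalar_prod_def lessThan_atLeast0)
  also have "\<dots> = (\<Sum>a<n. \<Sum>j<k. H $$ (a,j) * pinv H $$ (j,a))"
    by (subst sum.swap) (simp add: mult.commute)
  also have "\<dots> = (\<Sum>a<n. (H * pinv H) $$ (a,a))"
    using d by (intro sum.cong refl) (simp add: scalar_prod_def lessThan_atLeast0)
  also have "\<dots> \<le> (\<Sum>a<n. 1)"
  proof (intro sum_mono)
    fix a assume "a \<in> {..<n}"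
    then show "(H * pinv H) $$ (a,a) \<le> 1"
      by (intro frob_norm_projection(2)[OF _ P(3) idem, of n]) (use H P(1) in auto)
  qed
  finally show ?thesis by simp
qed

text \<open>\<open>I - H pinv H\<close> annihilates \<open>H H\<^sup>T = B B\<^sup>T\<close>, hence also \<open>B\<close>.\<close>

lemma gram_factor:
  assumes H: "H \<in> carrier_mat n k" and fcr: "full_col_rank H" and B: "B \<in> carrier_mat n s"
    and eq: "H * transpose_mat H = B * transpose_mat B"
  defines "U \<equiv> pinv H * B"
  shows "U \<in> carrier_mat k s" "U * transpose_mat U = 1\<^sub>m k" "H * U = B" "k \<le> s"
    "k = s \<Longrightarrow> orth_mat k U"
proof -
  note P = pinv_full_col_rank[OF H fcr]
  have d: "dim_row H = n" "dim_col H = k" "dim_row (pinv H) = k" "dim_col (pinv H) = n"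
    "dim_row B = n" "dim_col B = s" using H P(1) B by auto
  show U: "U \<in> carrier_mat k s" unfolding U_def using P(1) B by auto
  have PHt: "transpose_mat H * transpose_mat (pinv H) = 1\<^sub>m k"
    using arg_cong[OF P(2), of transpose_mat] by (simp add: transpose_mult_dim d)
  have "U * transpose_mat U = pinv H * (B * transpose_mat B) * transpose_mat (pinv H)"
    by (simp add: U_def d transpose_mult_dim mult_assoc_dim)
  also have "\<dots> = pinv H * (H * (transpose_mat H * transpose_mat (pinv H)))"
    by (simp add: eq[symmetric] d mult_assoc_dim)
  also have "\<dots> = 1\<^sub>m k" using P(1) H by (simp add: PHt P(2))
  finally show UU: "U * transpose_mat U = 1\<^sub>m k" .
  show "k \<le> s" "k = s \<Longrightarrow> orth_mat k U" using orthonormal_rows[OF U UU] .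
  let ?Q = "1\<^sub>m n - H * pinv H"
  have Q: "?Q \<in> carrier_mat n n" using H P(1) by auto
  have "H * pinv H * H = H" using H by (simp add: d mult_assoc_dim P(2))
  then have QH: "?Q * H = 0\<^sub>m n k"
    using H P(1) by (subst minus_mult_distrib_mat[of _ n n]) auto
  have "?Q * B * transpose_mat (?Q * B) = ?Q * (B * transpose_mat B) * transpose_mat ?Q"
    by (simp add: d transpose_mult_dim mult_assoc_dim)
  also have "\<dots> = (?Q * H) * (transpose_mat H * transpose_mat ?Q)"
    by (simp add: eq[symmetric] d mult_assoc_dim)
  also have "\<dots> = 0\<^sub>m n n" unfolding QH using H by auto
  finally have 0: "?Q * B * transpose_mat (?Q * B) = 0\<^sub>m n n" .
  have "(frob_norm (transpose_mat (?Q * B)))\<^sup>2 = 0"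
    by (subst frob_norm_sq_gram) (simp add: 0 d)
  then have fr0: "frob_norm (?Q * B) = 0" by simp
  have "?Q * B = 0\<^sub>m n s"
  proof (rule eq_matI)
    fix i j assume "i < dim_row (0\<^sub>m n s :: real mat)" "j < dim_col (0\<^sub>m n s :: real mat)"
    then show "(?Q * B) $$ (i,j) = 0\<^sub>m n s $$ (i,j)"
      using entry_le_frob_norm[of i "?Q * B" j] fr0 d by (simp del: index_mult_mat(1))
  qed (use d in auto)
  moreover have "?Q * B = B - H * pinv H * B"
    using H P(1) B by (subst minus_mult_distrib_mat[of _ n n]) auto
  moreover have "H * pinv H * B = H * U" by (simp add: U_def d mult_assoc_dim)
  ultimately have z: "B - H * U = 0\<^sub>m n s" by simp
  show "H * U = B"
  proof (rule eq_matI)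
    fix i j assume "i < dim_row B" "j < dim_col B"
    then show "(H * U) $$ (i,j) = B $$ (i,j)"
      using arg_cong[OF z, of "\<lambda>M. M $$ (i,j)"] H U d by (simp del: index_mult_mat(1))
  qed (use H U d in auto)
qed

subsection \<open>Approximate joint diagonalization\<close>

lemma dim_mat_diag [simp]: "dim_row (mat_diag n f) = n" "dim_col (mat_diag n f) = n"
  by (simp_all add: mat_diag_def)

lemma orth_mat_col_sum:
  assumes "orth_mat k W" "j < k"
  shows "(\<Sum>i<k. (W $$ (i,j))\<^sup>2) = 1"
proof -
  note W = orth_matD[OF assms(1)]
  have "1 = (transpose_mat W * W) $$ (j,j)" unfolding W(2) using assms(2) by simp
  also have "\<dots> = (\<Sum>i<k. (W $$ (i,j))\<^sup>2)"
    using assms(2) W(1) by (auto simp: scalar_prod_def power2_eq_square lessThan_atLeast0 intro!: sum.cong)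
  finally show ?thesis ..
qed

lemma orth_mat_row_sum:
  assumes "orth_mat k W" "i < k"
  shows "(\<Sum>j<k. (W $$ (i,j))\<^sup>2) = 1"
proof -
  have "(\<Sum>j<k. (W $$ (i,j))\<^sup>2) = (\<Sum>j<k. (transpose_mat W $$ (j,i))\<^sup>2)"
    using assms orth_matD(1)[OF assms(1)] by (intro sum.cong) auto
  then show ?thesis using orth_mat_col_sum[OF orth_mat_transpose[OF assms(1)] assms(2)] by simp
qed

lemma signed_perm_matI:
  assumes "\<pi> permutes {..<k}" "\<And>i. i < k \<Longrightarrow> s i = 1 \<or> s i = -1"
    and "J = mat k k (\<lambda>(i,j). if i = \<pi> j then s j else 0)"
  shows "signed_perm_mat k J"
  unfolding signed_perm_mat_def
proof (intro exI conjI)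
  let ?Q = "mat k k (\<lambda>(i,j). if i = \<pi> j then 1 else 0 :: real)"
  show "perm_mat k ?Q" using assms(1) by (auto simp: perm_mat_def)
  show "J = ?Q * mat_diag k s"
    by (subst mat_diag_mult_right[of _ k]) (auto simp: assms(3) intro!: eq_matI)
qed (use assms(2) in auto)

lemma signed_perm_matE:
  assumes "signed_perm_mat k J"
  obtains \<pi> s where "\<pi> permutes {..<k}" "\<And>i. i < k \<Longrightarrow> s i = 1 \<or> s i = -1"
    "J = mat k k (\<lambda>(i,j). if i = \<pi> j then s j else 0)"
proof -
  obtain Q s where Q: "perm_mat k Q" and s: "\<forall>i<k. s i = 1 \<or> s i = -1" and J: "J = Q * mat_diag k s"
    using assms by (auto simp: signed_perm_mat_def)
  obtain \<pi> where \<pi>: "\<pi> permutes {..<k}" and Qe: "Q = mat k k (\<lambda>(i,j). if i = \<pi> j then 1 else 0)"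
    using Q by (auto simp: perm_mat_def)
  have "J = mat k k (\<lambda>(i,j). if i = \<pi> j then s j else 0)"
    unfolding J by (subst mat_diag_mult_right[of _ k]) (auto simp: Qe intro!: eq_matI)
  then show ?thesis using that \<pi> s by blast
qed

text \<open>The columns of \<open>W\<close> are approximate eigenvectors of every diagonal matrix
  \<open>mat_diag k (\<sigma> n)\<close>. If \<open>\<sigma> n\<close> tells two indices apart, an
  approximate eigenvector cannot have large entries at both, since the corresponding eigenvalues 0
  and 1 cannot both be close to its Rayleigh quotient. So each column has at most one large entry,
  and having unit length it is almost a signed unit vector.\<close>

lemma near_signed_perm:
  fixes \<sigma> :: "nat \<Rightarrow> nat \<Rightarrow> real"
  assumes W: "orth_mat k W"
    and \<sigma>: "\<And>n i. n < M \<Longrightarrow> i < k \<Longrightarrow> \<sigma> n i \<in> {0,1}"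
    and sep: "\<And>i i'. i < k \<Longrightarrow> i' < k \<Longrightarrow> i \<noteq> i' \<Longrightarrow> \<exists>n<M. \<sigma> n i \<noteq> \<sigma> n i'"
    and T: "\<And>n. n < M \<Longrightarrow> T n \<in> carrier_mat k k"
    and near: "\<And>n. n < M \<Longrightarrow> frob_norm (T n - mat_diag k (\<sigma> n)) \<le> \<eta>"
    and off: "\<And>n i j. n < M \<Longrightarrow> i < k \<Longrightarrow> j < k \<Longrightarrow> i \<noteq> j \<Longrightarrow>
      \<bar>(transpose_mat W * T n * W) $$ (i,j)\<bar> \<le> \<eta>"
    and \<eta>: "0 \<le> \<eta>" and small: "8 * (real k)\<^sup>2 * \<eta> \<le> 1"
  shows "\<exists>J. signed_perm_mat k J \<and> frob_norm (W - J) \<le> 4 * (real k)\<^sup>2 * \<eta>"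
proof (cases "k = 0")
  case True
  have "W \<in> carrier_mat 0 0" using orth_matD(1)[OF W] True by simp
  then have "frob_norm (W - 1\<^sub>m 0) = 0" by (simp add: frob_norm_def)
  moreover have "signed_perm_mat 0 (1\<^sub>m 0)"
    by (rule signed_perm_matI[of id _ "\<lambda>_. 1"]) (auto intro!: eq_matI simp: permutes_id)
  ultimately show ?thesis using True by auto
next
  case False
  then have k1: "1 \<le> real k" by simp
  note WD = orth_matD[OF W]
  have dW: "dim_row W = k" "dim_col W = k" using WD(1) by auto
  \<comment> \<open>The cut between small and large entries: an error of \<open>2 k \<eta>\<close>
    in the eigenvalue equation, divided by the eigenvalue gap of at least 1/2. The smallness
    assumption amounts to \<open>k \<theta> \<le> 1/2\<close>.\<close>
  define \<theta> where "\<theta> = 4 * real k * \<eta>"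
  have \<theta>0: "0 \<le> \<theta>" using \<eta> by (simp add: \<theta>_def)
  have k\<theta>: "real k * \<theta> \<le> 1/2" using small by (simp add: \<theta>_def power2_eq_square algebra_simps)
  have \<theta>k: "\<theta> \<le> real k * \<theta>" using mult_right_mono[OF k1 \<theta>0] by simp
  have k\<theta>2: "real k * \<theta>\<^sup>2 \<le> \<theta> / 2"
    using mult_right_mono[OF k\<theta> \<theta>0] by (simp add: power2_eq_square algebra_simps)
  have k\<theta>4: "real k * \<theta>\<^sup>2 \<le> 1/4" using k\<theta>2 \<theta>k k\<theta> by linarith

  have col1: "(\<Sum>i<k. (W $$ (i,j))\<^sup>2) = 1" if "j < k" for j
    using orth_mat_col_sum[OF W that] .
  have row1: "(\<Sum>j<k. (W $$ (i,j))\<^sup>2) = 1" if "i < k" for i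
    using orth_mat_row_sum[OF W that] .
  have W1: "\<bar>W $$ (i,j)\<bar> \<le> 1" if "i < k" "j < k" for i j
  proof -
    have "(W $$ (i,j))\<^sup>2 \<le> 1"
      unfolding col1[OF that(2), symmetric] using that by (intro member_le_sum[where f = "\<lambda>i. (W $$ (i,j))\<^sup>2"]) auto
    then show ?thesis by (simp add: abs_square_le_1)
  qed

  define Z where "Z n = transpose_mat W * (mat_diag k (\<sigma> n) * W)" for n
  have ZC: "Z n \<in> carrier_mat k k" for n unfolding Z_def using WD(1) by (intro mult_carrier_mat[of _ k k]) auto
  \<comment> \<open>One \<open>\<eta>\<close> comes from the off-diagonal entries for
    \<open>T n\<close>, the other from replacing \<open>T n\<close> by its diagonal model;
    conjugation by \<open>W\<close> preserves the Frobenius norm of the difference.\<close>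
  have Zoff: "\<bar>Z n $$ (i,j)\<bar> \<le> 2 * \<eta>" if n: "n < M" and ij: "i < k" "j < k" "i \<noteq> j" for n i j
  proof -
    let ?X = "T n - mat_diag k (\<sigma> n)"
    have X: "?X \<in> carrier_mat k k" using T[OF n] by (intro minus_carrier_mat) auto
    have "?X * W = T n * W - mat_diag k (\<sigma> n) * W"
      using T[OF n] WD(1) by (intro minus_mult_distrib_mat) auto
    moreover have "transpose_mat W * (T n * W - mat_diag k (\<sigma> n) * W)
        = transpose_mat W * (T n * W) - transpose_mat W * (mat_diag k (\<sigma> n) * W)"
      using T[OF n] WD(1) mult_carrier_mat[OF mat_diag_dim WD(1)] by (intro mult_minus_distrib_mat) auto
    ultimately have "transpose_mat W * (?X * W) = transpose_mat W * T n * W - Z n"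
      using T[OF n] WD(1) by (simp add: Z_def mult_assoc_dim dW)
    moreover have "\<bar>(transpose_mat W * (?X * W)) $$ (i,j)\<bar> \<le> frob_norm (transpose_mat W * (?X * W))"
      using ij X by (intro entry_le_frob_norm) (auto simp: dW)
    moreover have "frob_norm (transpose_mat W * (?X * W)) = frob_norm ?X"
      using X WD(1) by (simp add: frob_norm_orth_left[OF orth_mat_transpose[OF W], of _ k]
          frob_norm_orth_right[OF W, of _ k])
    ultimately have "\<bar>(transpose_mat W * T n * W - Z n) $$ (i,j)\<bar> \<le> \<eta>"
      using near[OF n] by simp
    moreover have "(transpose_mat W * T n * W - Z n) $$ (i,j) = (transpose_mat W * T n * W) $$ (i,j) - Z n $$ (i,j)"
      using ij ZC[of n] by (intro index_minus_mat) auto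
    ultimately show ?thesis using off[OF n ij] by linarith
  qed
  \<comment> \<open>Entry \<open>(i,j)\<close> of
    \<open>W * Z n = mat_diag k (\<sigma> n) * W\<close>, with the diagonal term of the product
    moved to the other side.\<close>
  have key: "\<bar>\<sigma> n i - Z n $$ (j,j)\<bar> * \<bar>W $$ (i,j)\<bar> \<le> \<theta> / 2"
    if n: "n < M" and ij: "i < k" "j < k" for n i j
  proof -
    have "W * Z n = mat_diag k (\<sigma> n) * W"
      unfolding Z_def by (intro mult_inv_cancel) (simp_all add: WD(3) dW)
    then have "(W * Z n) $$ (i,j) = \<sigma> n i * W $$ (i,j)"
      using ij WD(1) by (simp add: mat_diag_mult_left[of _ k k])
    moreover have "(W * Z n) $$ (i,j) = (\<Sum>l<k. W $$ (i,l) * Z n $$ (l,j))"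
      using ij ZC[of n] by (simp add: dW scalar_prod_def lessThan_atLeast0)
    moreover have "\<dots> = W $$ (i,j) * Z n $$ (j,j) + (\<Sum>l\<in>{..<k}-{j}. W $$ (i,l) * Z n $$ (l,j))"
      using ij by (subst sum.remove[of _ j]) auto
    ultimately have eq: "(\<sigma> n i - Z n $$ (j,j)) * W $$ (i,j) = (\<Sum>l\<in>{..<k}-{j}. W $$ (i,l) * Z n $$ (l,j))"
      by (simp add: algebra_simps)
    have "\<bar>\<Sum>l\<in>{..<k}-{j}. W $$ (i,l) * Z n $$ (l,j)\<bar> \<le> (\<Sum>l\<in>{..<k}-{j}. 1 * (2 * \<eta>))"
    proof (intro order_trans[OF sum_abs] sum_mono)
      fix l assume "l \<in> {..<k} - {j}"
      then show "\<bar>W $$ (i,l) * Z n $$ (l,j)\<bar> \<le> 1 * (2 * \<eta>)"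
        unfolding abs_mult using W1[of i l] Zoff[OF n, of l j] ij \<eta> by (intro mult_mono) auto
    qed
    also have "\<dots> = real (k - 1) * (2 * \<eta>)" using ij by simp
    also have "\<dots> \<le> real k * (2 * \<eta>)" using \<eta> by (intro mult_right_mono) auto
    finally show ?thesis by (simp add: eq[symmetric] abs_mult \<theta>_def mult_ac)
  qed
  \<comment> \<open>The values \<open>\<sigma> n i\<close> and \<open>\<sigma> n i'\<close> are 0
    and 1 in some order, so at least one of them has distance 1/2 or more from
    \<open>Z n $$ (j,j)\<close>.\<close>
  have pair: "\<bar>W $$ (i,j)\<bar> \<le> \<theta> \<or> \<bar>W $$ (i',j)\<bar> \<le> \<theta>"
    if ij: "i < k" "i' < k" "j < k" "i \<noteq> i'" for i i' j
  proof -
    obtain n where n: "n < M" "\<sigma> n i \<noteq> \<sigma> n i'" using sep ij by blast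
    have half: "\<bar>W $$ (l,j)\<bar> \<le> \<theta>" if "l < k" "1/2 \<le> \<bar>\<sigma> n l - Z n $$ (j,j)\<bar>" for l
      using key[OF n(1) that(1) ij(3)] mult_right_mono[OF that(2), of "\<bar>W $$ (l,j)\<bar>"] by linarith
    have "1/2 \<le> \<bar>\<sigma> n i - Z n $$ (j,j)\<bar> \<or> 1/2 \<le> \<bar>\<sigma> n i' - Z n $$ (j,j)\<bar>"
      using \<sigma>[OF n(1) ij(1)] \<sigma>[OF n(1) ij(2)] n(2) by (auto simp: abs_if)
    then show ?thesis using half ij by blast
  qed
  have "\<exists>i<k. \<theta> < \<bar>W $$ (i,j)\<bar>" if j: "j < k" for j
  proof (rule ccontr)
    assume "\<not> ?thesis"
    then have "\<bar>W $$ (i,j)\<bar> \<le> \<theta>" if "i < k" for i using that by auto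
    then have "(W $$ (i,j))\<^sup>2 \<le> \<theta>\<^sup>2" if "i < k" for i
      using power_mono[of "\<bar>W $$ (i,j)\<bar>" \<theta> 2] that by simp
    then have "(\<Sum>i<k. (W $$ (i,j))\<^sup>2) \<le> (\<Sum>i<k. \<theta>\<^sup>2)" by (intro sum_mono) auto
    then show False using col1[OF j] k\<theta>4 by simp
  qed
  then obtain \<pi>' where \<pi>': "\<And>j. j < k \<Longrightarrow> \<pi>' j < k \<and> \<theta> < \<bar>W $$ (\<pi>' j,j)\<bar>" by metis
  \<comment> \<open>The identity outside the index range is required by
    \<open>permutes\<close>.\<close>
  define \<pi> where "\<pi> j = (if j < k then \<pi>' j else j)" for j
  have \<pi>: "\<pi> j < k" "\<theta> < \<bar>W $$ (\<pi> j,j)\<bar>" if "j < k" for j using \<pi>'[OF that] that by (auto simp: \<pi>_def)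
  have small_entry: "\<bar>W $$ (i,j)\<bar> \<le> \<theta>" if "i < k" "j < k" "i \<noteq> \<pi> j" for i j
    using pair[OF that(1) \<pi>(1)[OF that(2)] that(2,3)] \<pi>(2)[OF that(2)] by auto
  have big: "1 - real k * \<theta>\<^sup>2 \<le> (W $$ (\<pi> j,j))\<^sup>2" if j: "j < k" for j
  proof -
    have "1 = (W $$ (\<pi> j,j))\<^sup>2 + (\<Sum>i\<in>{..<k}-{\<pi> j}. (W $$ (i,j))\<^sup>2)"
      using col1[OF j] \<pi>(1)[OF j] by (subst (asm) sum.remove[of _ "\<pi> j"]) auto
    also have "(\<Sum>i\<in>{..<k}-{\<pi> j}. (W $$ (i,j))\<^sup>2) \<le> (\<Sum>i\<in>{..<k}-{\<pi> j}. \<theta>\<^sup>2)"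
    proof (intro sum_mono)
      fix i assume "i \<in> {..<k} - {\<pi> j}"
      then show "(W $$ (i,j))\<^sup>2 \<le> \<theta>\<^sup>2"
        using power_mono[OF small_entry[of i j] abs_ge_zero, of 2] j by simp
    qed
    also have "\<dots> = real (k - 1) * \<theta>\<^sup>2" using \<pi>(1)[OF j] by simp
    also have "\<dots> \<le> real k * \<theta>\<^sup>2" by (intro mult_right_mono) auto
    finally show ?thesis by simp
  qed
  \<comment> \<open>Two large entries in one row would contribute at least 3/4 each to a sum of
    squares equal to 1.\<close>
  have inj: "inj_on \<pi> {..<k}"
  proof (rule inj_onI, rule ccontr)
    fix j j' assume j: "j \<in> {..<k}" "j' \<in> {..<k}" "\<pi> j = \<pi> j'" "j \<noteq> j'"
    have "(\<Sum>l\<in>{j,j'}. (W $$ (\<pi> j,l))\<^sup>2) \<le> (\<Sum>l<k. (W $$ (\<pi> j,l))\<^sup>2)"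
      using j by (intro sum_mono2) auto
    then have "(W $$ (\<pi> j,j))\<^sup>2 + (W $$ (\<pi> j',j'))\<^sup>2 \<le> 1"
      using j row1[of "\<pi> j"] \<pi>(1)[of j] by simp
    then show False using big[of j] big[of j'] j k\<theta>4 by simp
  qed
  have perm: "\<pi> permutes {..<k}"
  proof (rule bij_imp_permutes)
    show "bij_betw \<pi> {..<k} {..<k}"
      unfolding bij_betw_def using inj \<pi>(1) by (intro conjI endo_inj_surj) auto
  qed (simp add: \<pi>_def)
  define s where "s j = sgn (W $$ (\<pi> j,j))" for j
  define J where "J = mat k k (\<lambda>(i,j). if i = \<pi> j then s j else 0)"
  have nz: "W $$ (\<pi> j,j) \<noteq> 0" if "j < k" for j using \<pi>(2)[OF that] \<theta>0 by auto
  have "signed_perm_mat k J"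
    by (rule signed_perm_matI[OF perm _ J_def]) (use nz in \<open>auto simp: s_def sgn_if\<close>)
  moreover have "frob_norm (W - J) \<le> real k * \<theta>"
  proof (rule frob_norm_le_entries)
    fix i j assume "i < dim_row (W - J)" "j < dim_col (W - J)"
    then have ij: "i < k" "j < k" by (auto simp: J_def)
    have "\<bar>W $$ (i,j) - s j\<bar> \<le> \<theta>" if "i = \<pi> j"
    proof -
      have w: "\<bar>W $$ (i,j)\<bar> \<le> 1" using W1 ij by auto
      \<comment> \<open>As the entry has modulus at most 1, its distance to its sign is bounded by
        one minus its square, which \<open>big\<close> controls without a square root.\<close>
      have "\<bar>W $$ (i,j) - s j\<bar> = 1 - \<bar>W $$ (i,j)\<bar>"
        using nz[OF ij(2)] w that by (auto simp: s_def sgn_if abs_if split: if_splits)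
      also have "\<dots> \<le> 1 - (W $$ (i,j))\<^sup>2"
        using mult_right_mono[OF w, of "\<bar>W $$ (i,j)\<bar>"] by (simp add: power2_eq_square)
      also have "\<dots> \<le> real k * \<theta>\<^sup>2" using big[OF ij(2)] that by simp
      finally show ?thesis using k\<theta>2 \<theta>0 by linarith
    qed
    then show "\<bar>(W - J) $$ (i,j)\<bar> \<le> \<theta>"
      using small_entry[OF ij] ij by (auto simp: J_def dW)
  qed (auto simp: J_def \<theta>0)
  ultimately show ?thesis by (auto simp: \<theta>_def power2_eq_square algebra_simps)
qed

text \<open>\<open>S n\<close> is \<open>T n\<close> seen through \<open>Q\<close>, so
  \<open>transpose_mat Q\<close> is an admissible competitor; it brings back \<open>T n\<close>,
  whose objective is at most \<open>M \<eta>^2\<close>. The minimizer \<open>D\<close> does no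
  worse, and each single off-diagonal entry is bounded by the root of the objective.\<close>

lemma joint_diagonalizer_near_signed_perm:
  fixes \<sigma> :: "nat \<Rightarrow> nat \<Rightarrow> real"
  assumes D: "joint_diagonalizer M k S D" and Q: "orth_mat k Q"
    and S: "\<And>n. n < M \<Longrightarrow> S n = transpose_mat Q * T n * Q"
    and \<sigma>: "\<And>n i. n < M \<Longrightarrow> i < k \<Longrightarrow> \<sigma> n i \<in> {0,1}"
    and sep: "\<And>i i'. i < k \<Longrightarrow> i' < k \<Longrightarrow> i \<noteq> i' \<Longrightarrow> \<exists>n<M. \<sigma> n i \<noteq> \<sigma> n i'"
    and T: "\<And>n. n < M \<Longrightarrow> T n \<in> carrier_mat k k"
    and near: "\<And>n. n < M \<Longrightarrow> frob_norm (T n - mat_diag k (\<sigma> n)) \<le> \<eta>"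
    and \<eta>: "0 \<le> \<eta>" and small: "8 * (real k)\<^sup>2 * ((real M + 1) * \<eta>) \<le> 1"
  shows "\<exists>J. signed_perm_mat k J \<and> frob_norm (Q * D - J) \<le> 4 * (real k)\<^sup>2 * ((real M + 1) * \<eta>)"
proof -
  let ?off = "{(i,j). i < k \<and> j < k \<and> i \<noteq> j}"
  have fin: "finite ?off" by (rule finite_subset[of _ "{..<k} \<times> {..<k}"]) auto
  have Do: "orth_mat k D" using D by (simp add: joint_diagonalizer_def)
  note QD = orth_matD[OF Q] and DD = orth_matD[OF Do]
  have d: "dim_row Q = k" "dim_col Q = k" "dim_row D = k" "dim_col D = k" using QD(1) DD(1) by auto
  \<comment> \<open>\<open>near_signed_perm\<close> takes a single bound for the distance to the
    diagonal model and for the off-diagonal entries; the larger of the two serves for both.\<close>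
  have \<eta>M: "\<eta> \<le> (real M + 1) * \<eta>" using \<eta> by (simp add: algebra_simps)
  have T_conj: "transpose_mat (transpose_mat Q) * S n * transpose_mat Q = T n" if n: "n < M" for n
  proof -
    have dT: "dim_row (T n) = k" "dim_col (T n) = k" using T[OF n] by auto
    have 1: "Q * (transpose_mat Q * A) = A" if "dim_row A = k" for A
      using that by (intro mult_inv_cancel) (simp_all add: QD(3) d)
    show ?thesis
      using T[OF n] by (simp add: S[OF n] mult_assoc_dim d dT 1 QD(3))
  qed
  have obj: "jd_objective M k S (transpose_mat Q) \<le> real M * \<eta>\<^sup>2"
  proof -
    have "(\<Sum>(i,j)\<in>?off. \<bar>T n $$ (i,j)\<bar>\<^sup>2) \<le> \<eta>\<^sup>2" if n: "n < M" for n
    proof -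
      let ?X = "T n - mat_diag k (\<sigma> n)"
      have dX: "dim_row ?X = k" "dim_col ?X = k" by (auto simp: mat_diag_def)
      have "(\<Sum>(i,j)\<in>?off. \<bar>T n $$ (i,j)\<bar>\<^sup>2) = (\<Sum>(i,j)\<in>?off. (?X $$ (i,j))\<^sup>2)"
        using T[OF n] by (intro sum.cong) (auto simp: mat_diag_def)
      also have "\<dots> \<le> (\<Sum>(i,j)\<in>{..<k} \<times> {..<k}. (?X $$ (i,j))\<^sup>2)"
        by (intro sum_mono2) auto
      also have "\<dots> = (frob_norm ?X)\<^sup>2"
        unfolding frob_norm_sq dX by (simp only: sum.cartesian_product)
      also have "\<dots> \<le> \<eta>\<^sup>2" using near[OF n] by (intro power_mono) auto
      finally show ?thesis .
    qed
    then have "(\<Sum>n<M. \<Sum>(i,j)\<in>?off. \<bar>T n $$ (i,j)\<bar>\<^sup>2) \<le> (\<Sum>n<M. \<eta>\<^sup>2)" by (intro sum_mono) auto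
    moreover have "jd_objective M k S (transpose_mat Q) = (\<Sum>n<M. \<Sum>(i,j)\<in>?off. \<bar>T n $$ (i,j)\<bar>\<^sup>2)"
      unfolding jd_objective_def by (intro sum.cong refl) (simp_all only: lessThan_iff T_conj)
    ultimately show ?thesis by simp
  qed
  have D_off: "\<bar>(transpose_mat (Q * D) * T n * (Q * D)) $$ (i,j)\<bar> \<le> (real M + 1) * \<eta>"
    if n: "n < M" and ij: "i < k" "j < k" "i \<noteq> j" for n i j
  proof -
    have dT: "dim_row (T n) = k" "dim_col (T n) = k" using T[OF n] by auto
    have eq: "transpose_mat (Q * D) * T n * (Q * D) = transpose_mat D * S n * D"
      by (simp add: S[OF n] transpose_mult_dim mult_assoc_dim d dT)
    have "\<bar>(transpose_mat D * S n * D) $$ (i,j)\<bar>\<^sup>2 \<le> (\<Sum>(i,j)\<in>?off. \<bar>(transpose_mat D * S n * D) $$ (i,j)\<bar>\<^sup>2)"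
      using member_le_sum[of "(i,j)" ?off "\<lambda>p. \<bar>(transpose_mat D * S n * D) $$ p\<bar>\<^sup>2"] fin ij
      by (simp add: case_prod_beta)
    also have "\<dots> \<le> jd_objective M k S D"
      unfolding jd_objective_def using n
      by (intro member_le_sum[where f = "\<lambda>n. \<Sum>(i,j)\<in>?off. \<bar>(transpose_mat D * S n * D) $$ (i,j)\<bar>\<^sup>2"])
         (auto intro!: sum_nonneg)
    also have "\<dots> \<le> jd_objective M k S (transpose_mat Q)"
      using D orth_mat_transpose[OF Q] by (simp add: joint_diagonalizer_def)
    also have "\<dots> \<le> real M * \<eta>\<^sup>2" by (rule obj)
    \<comment> \<open>A perfect square above \<open>M\<close>, so that the root can be taken inside
      the reals without \<open>sqrt M\<close>.\<close>
    also have "\<dots> \<le> (real M + 1)\<^sup>2 * \<eta>\<^sup>2"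
      by (intro mult_right_mono) (auto simp: power2_eq_square algebra_simps)
    also have "\<dots> = ((real M + 1) * \<eta>)\<^sup>2" by (simp only: power_mult_distrib)
    finally have "\<bar>(transpose_mat D * S n * D) $$ (i,j)\<bar> \<le> (real M + 1) * \<eta>"
      by (rule power2_le_imp_le) (use \<eta> in simp)
    then show ?thesis unfolding eq .
  qed
  show ?thesis
    by (rule near_signed_perm[OF orth_mat_mult[OF Q Do] \<sigma> sep T order_trans[OF near \<eta>M] D_off])
       (use \<eta> small in auto)
qed

subsection \<open>Perturbation of the pseudo-inverse\<close>

text \<open>Like \<open>mult_assoc_dim\<close>, these distributive laws have equations between
  dimensions as premises instead of carrier memberships. No unknown size is left to instantiate, so
  they work as conditional rewrite rules once the dimensions are known to the simplifier.\<close>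

lemma add_mult_dim:
  "dim_row A = dim_row B \<Longrightarrow> dim_col A = dim_col B \<Longrightarrow> dim_col B = dim_row C \<Longrightarrow>
    (A + B) * C = A * C + B * (C :: real mat)"
  by (intro add_mult_distrib_mat[of _ "dim_row B" "dim_col B"]) auto

lemma mult_add_dim:
  "dim_row B = dim_row C \<Longrightarrow> dim_col B = dim_col C \<Longrightarrow> dim_col A = dim_row C \<Longrightarrow>
    A * (B + C) = A * B + A * (C :: real mat)"
  by (intro mult_add_distrib_mat[of _ "dim_row A" "dim_row C" _ "dim_col C"]) auto

lemma minus_mult_dim:
  "dim_row A = dim_row B \<Longrightarrow> dim_col A = dim_col B \<Longrightarrow> dim_col B = dim_row C \<Longrightarrow>
    (A - B) * C = A * C - B * (C :: real mat)"
  by (intro minus_mult_distrib_mat[of _ "dim_row B" "dim_col B"]) auto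

lemma mult_minus_dim:
  "dim_row B = dim_row C \<Longrightarrow> dim_col B = dim_col C \<Longrightarrow> dim_col A = dim_row C \<Longrightarrow>
    A * (B - C) = A * B - A * (C :: real mat)"
  by (intro mult_minus_distrib_mat[of _ "dim_row A" "dim_row C" _ "dim_col C"]) auto

lemma transpose_minus_dim:
  "dim_row A = dim_row B \<Longrightarrow> dim_col A = dim_col B \<Longrightarrow>
    transpose_mat (A - B) = transpose_mat A - transpose_mat (B :: real mat)"
  by (intro eq_matI) auto

text \<open>Both matrices are orthogonal projections, so these bounds do not involve the
  conditioning of \<open>H\<close>. This keeps the powers of \<open>s\<close> low in the
  perturbation bounds.\<close>

lemma pinv_projection:
  assumes H: "H \<in> carrier_mat n k" and fcr: "full_col_rank H"
  shows "frob_norm (H * pinv H) \<le> real n" "frob_norm (1\<^sub>m n - H * pinv H) \<le> real n"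
proof -
  note P = pinv_full_col_rank[OF assms]
  have d: "dim_row H = n" "dim_col H = k" "dim_row (pinv H) = k" "dim_col (pinv H) = n"
    using H P(1) by auto
  have "pinv H * (H * pinv H) = pinv H" by (intro mult_inv_cancel) (simp_all add: P(2) d)
  then have idem: "H * pinv H * (H * pinv H) = H * pinv H" by (simp add: mult_assoc_dim d)
  show "frob_norm (H * pinv H) \<le> real n"
    by (rule frob_norm_projection(1)[OF _ P(3) idem]) (use H P(1) in auto)
  let ?Q = "H * pinv H"
  have Q: "?Q \<in> carrier_mat n n" using H P(1) by auto
  show "frob_norm (1\<^sub>m n - ?Q) \<le> real n"
  proof (rule frob_norm_projection(1))
    show "1\<^sub>m n - ?Q \<in> carrier_mat n n" using Q by (intro minus_carrier_mat)
    show "transpose_mat (1\<^sub>m n - ?Q) = 1\<^sub>m n - ?Q"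
      by (subst transpose_minus_dim) (simp_all only: d index_mult_mat index_one_mat transpose_one P(3))
    have "(1\<^sub>m n - ?Q) * (1\<^sub>m n - ?Q) = 1\<^sub>m n * (1\<^sub>m n - ?Q) - ?Q * (1\<^sub>m n - ?Q)"
      by (intro minus_mult_dim) (auto simp: d)
    also have "?Q * (1\<^sub>m n - ?Q) = ?Q * 1\<^sub>m n - ?Q * ?Q"
      by (intro mult_minus_dim) (auto simp: d)
    also have "\<dots> = 0\<^sub>m n n" unfolding idem right_mult_one_mat[OF Q] by (rule minus_r_inv_mat[OF Q])
    also have "1\<^sub>m n * (1\<^sub>m n - ?Q) = 1\<^sub>m n - ?Q"
      by (rule left_mult_one_mat[OF minus_carrier_mat[OF Q]])
    also have "1\<^sub>m n - ?Q - 0\<^sub>m n n = 1\<^sub>m n - ?Q"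
      by (intro eq_matI) (auto simp: d simp del: index_mult_mat(1))
    finally show "(1\<^sub>m n - ?Q) * (1\<^sub>m n - ?Q) = 1\<^sub>m n - ?Q" .
  qed
qed

text \<open>The coefficients of the two terms of Wedin's identity in the next proof:
  \<open>2 N\<close> from \<open>pinv G' * \<Delta> * pinv G\<close>, and \<open>4 N^3\<close> from
  the term with the complementary projection, in which the bound \<open>2 N s\<close> occurs twice
  and the projection costs a further \<open>N\<close>.\<close>

definition pinv_const :: "nat \<Rightarrow> real" where
  "pinv_const N = 2 * real N + 4 * real N ^ 3"

text \<open>Since \<open>s * d \<le> 1/2\<close>, the matrix \<open>pinv G * G'\<close> differs from
  the identity by a contraction with factor 1/2. This gives the trivial kernel of \<open>G'\<close>,
  and it also bounds \<open>pinv G'\<close> in terms of \<open>s\<close>, which the estimate of the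
  difference needs.\<close>

lemma pinv_perturbation:
  assumes G: "G \<in> carrier_mat n k" and G': "G' \<in> carrier_mat n k" and fcr: "full_col_rank G"
    and s: "frob_norm (pinv G) \<le> s" and d: "frob_norm (G' - G) \<le> d" and sd: "s * d \<le> 1/2"
    and nN: "n \<le> N" and kN: "k \<le> N"
  shows "full_col_rank G'" "frob_norm (pinv G') \<le> 2 * real N * s"
    "frob_norm (pinv G' - pinv G) \<le> pinv_const N * s\<^sup>2 * d"
proof -
  define \<Delta> where "\<Delta> = G' - G"
  note P = pinv_full_col_rank[OF G fcr]
  have \<Delta>: "\<Delta> \<in> carrier_mat n k" unfolding \<Delta>_def using G by (intro minus_carrier_mat)
  have s0: "0 \<le> s" using s frob_norm_nonneg[of "pinv G"] by linarith
  have d0: "0 \<le> d" using d frob_norm_nonneg[of "G' - G"] by linarith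
  have dm: "dim_row G = n" "dim_col G = k" "dim_row G' = n" "dim_col G' = k"
    "dim_row (pinv G) = k" "dim_col (pinv G) = n" "dim_row \<Delta> = n" "dim_col \<Delta> = k"
    using G G' P(1) \<Delta> by auto
  have G'_eq: "G' = G + \<Delta>" using G G' by (intro eq_matI) (auto simp: \<Delta>_def)
  have P\<Delta>: "frob_norm (pinv G * \<Delta>) \<le> 1/2"
    using frob_norm_mult_le[OF P(1) \<Delta> s d[folded \<Delta>_def]] sd by linarith
  have P\<Delta>C: "pinv G * \<Delta> \<in> carrier_mat k k" using P(1) \<Delta> by auto
  have PG': "pinv G * G' = 1\<^sub>m k + pinv G * \<Delta>"
    unfolding G'_eq by (subst mult_add_dim) (simp_all add: dm P(2))
  show fcr': "full_col_rank G'"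
    unfolding full_col_rank_def
  proof (intro ballI impI)
    fix x assume "x \<in> carrier_vec (dim_col G')" and 0: "G' *\<^sub>v x = 0\<^sub>v (dim_row G')"
    then have x: "x \<in> carrier_vec k" by (simp add: dm)
    let ?y = "(pinv G * \<Delta>) *\<^sub>v x"
    have y: "?y \<in> carrier_vec k" using P\<Delta>C x by auto
    have "(pinv G * G') *\<^sub>v x = pinv G *\<^sub>v (G' *\<^sub>v x)"
      using P(1) G' x by (intro assoc_mult_mat_vec) auto
    also have "\<dots> = 0\<^sub>v k" unfolding 0 by (intro eq_vecI) (auto simp: dm intro!: scalar_prod_right_zero carrier_vecI)
    finally have "(1\<^sub>m k + pinv G * \<Delta>) *\<^sub>v x = 0\<^sub>v k" unfolding PG' .
    moreover have "(1\<^sub>m k + pinv G * \<Delta>) *\<^sub>v x = 1\<^sub>m k *\<^sub>v x + ?y"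
      using P\<Delta>C x by (intro add_mult_distrib_mat_vec) auto
    \<comment> \<open>So \<open>x\<close> and its image \<open>?y\<close> have equal length, while
      the contraction shortens every nonzero vector.\<close>
    ultimately have xy: "x + ?y = 0\<^sub>v k" by (metis one_mult_mat_vec[OF x])
    have comp: "?y $ i = - x $ i" if "i < k" for i
    proof -
      have "x $ i + ?y $ i = 0"
        using arg_cong[OF xy, of "\<lambda>v. v $ i"] that carrier_vecD[OF y]
        by (simp only: index_add_vec(1) index_zero_vec(1))
      then show ?thesis by linarith
    qed
    have "?y \<bullet> ?y = x \<bullet> x"
      unfolding scalar_prod_def carrier_vecD[OF x] carrier_vecD[OF y]
      by (intro sum.cong refl) (simp only: atLeastLessThan_iff comp minus_mult_minus)
    moreover have "?y \<bullet> ?y \<le> (frob_norm (pinv G * \<Delta>))\<^sup>2 * (x \<bullet> x)"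
      using P\<Delta>C x by (intro mult_mat_vec_sq_le)
    moreover have "(frob_norm (pinv G * \<Delta>))\<^sup>2 * (x \<bullet> x) \<le> (1/2)\<^sup>2 * (x \<bullet> x)"
      using P\<Delta> by (intro mult_right_mono power_mono) (auto simp: scalar_prod_self_nonneg)
    ultimately have "x \<bullet> x = 0" using scalar_prod_self_nonneg[of x] by (simp add: power2_eq_square)
    then show "x = 0\<^sub>v (dim_col G')" using scalar_prod_self_eq_0[OF x] by (simp add: dm)
  qed
  note P' = pinv_full_col_rank[OF G' fcr'] and proj' = pinv_projection[OF G' fcr']
    and proj = pinv_projection[OF G fcr]
  have dm': "dim_row (pinv G') = k" "dim_col (pinv G') = n" using P'(1) by auto
  have "pinv G * (G' * pinv G') = (1\<^sub>m k + pinv G * \<Delta>) * pinv G'"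
    by (simp add: PG'[symmetric] mult_assoc_dim dm dm')
  also have "\<dots> = pinv G' + pinv G * \<Delta> * pinv G'"
    using P'(1) by (subst add_mult_dim) (simp_all add: dm dm')
  finally have eq: "pinv G * (G' * pinv G') = pinv G' + pinv G * \<Delta> * pinv G'" .
  \<comment> \<open>The first term is \<open>pinv G\<close> times a projection. The second is at
    most half the quantity to be bounded and is moved to the left, whence the factor 2.\<close>
  have "pinv G' = pinv G * (G' * pinv G') - pinv G * \<Delta> * pinv G'"
    unfolding eq using P'(1) by (intro eq_matI) (auto simp: dm dm' simp del: index_mult_mat(1))
  then have "frob_norm (pinv G') \<le> frob_norm (pinv G * (G' * pinv G')) + frob_norm (pinv G * \<Delta> * pinv G')"
    using P(1) P'(1) G' \<Delta> frob_norm_triangle_minus[of "pinv G * (G' * pinv G')" k n "pinv G * \<Delta> * pinv G'"]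
    by (metis carrier_matI dm(5) dm'(2) index_mult_mat(2,3))
  also have "frob_norm (pinv G * (G' * pinv G')) \<le> s * real N"
    using frob_norm_mult_le[OF P(1) _ s, of "G' * pinv G'" n "real N"] G' P'(1) proj'(1) nN by auto
  also have "frob_norm (pinv G * \<Delta> * pinv G') \<le> 1/2 * frob_norm (pinv G')"
    using frob_norm_mult_le[OF P\<Delta>C P'(1) P\<Delta> order_refl] .
  finally show P'_bound: "frob_norm (pinv G') \<le> 2 * real N * s" by (simp add: mult_ac)
  \<comment> \<open>Wedin's identity: \<open>pinv G' - pinv G = pinv G' pinv G'\<^sup>T \<Delta>\<^sup>T (I - G pinv G) - pinv G' \<Delta> pinv G\<close>.\<close>
  let ?Q = "1\<^sub>m n - G * pinv G"
  have QC: "?Q \<in> carrier_mat n n" using G P(1) by (intro minus_carrier_mat) auto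
  have Qt: "transpose_mat ?Q = ?Q"
    by (subst transpose_minus_dim) (simp_all only: dm index_mult_mat index_one_mat transpose_one P(3))
  have "?Q * G = 0\<^sub>m n k"
    using G by (subst minus_mult_dim) (simp_all add: dm mult_assoc_dim P(2))
  from arg_cong[OF this, of transpose_mat] have GQ: "transpose_mat G * ?Q = 0\<^sub>m k n"
    by (subst (asm) transpose_mult_dim) (simp_all only: Qt dm index_mult_mat index_minus_mat transpose_carrier_mat transpose_mat_eq zero_transpose_mat refl)
  have G'Q: "transpose_mat G' * ?Q = transpose_mat \<Delta> * ?Q"
  proof -
    have "transpose_mat G' = transpose_mat G + transpose_mat \<Delta>"
      unfolding G'_eq using G \<Delta> by (intro transpose_add)
    then have "transpose_mat G' * ?Q = transpose_mat G * ?Q + transpose_mat \<Delta> * ?Q"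
      by (simp add: add_mult_dim dm)
    then show ?thesis unfolding GQ using \<Delta> QC by simp
  qed
  have "pinv G' * (G' * pinv G') = pinv G'" by (intro mult_inv_cancel) (simp_all add: P'(2) dm dm')
  then have "pinv G' = pinv G' * transpose_mat (G' * pinv G')" unfolding P'(3) ..
  also have "\<dots> = pinv G' * transpose_mat (pinv G') * transpose_mat G'"
    by (simp add: transpose_mult_dim mult_assoc_dim dm dm')
  finally have P'_eq: "pinv G' * transpose_mat (pinv G') * transpose_mat G' = pinv G'" ..
  have t1: "pinv G' * ?Q = pinv G' * transpose_mat (pinv G') * (transpose_mat \<Delta> * ?Q)"
  proof -
    have "pinv G' * ?Q = pinv G' * transpose_mat (pinv G') * transpose_mat G' * ?Q" unfolding P'_eq ..
    also have "\<dots> = pinv G' * transpose_mat (pinv G') * (transpose_mat G' * ?Q)"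
      by (rule mult_assoc_dim) (simp_all add: dm dm')
    finally show ?thesis unfolding G'Q .
  qed
  have t2: "pinv G' * ?Q = pinv G' - pinv G' * G * pinv G"
    using P'(1) by (subst mult_minus_dim) (simp_all add: dm dm' mult_assoc_dim)
  have G_eq: "G = G' - \<Delta>" using G G' by (intro eq_matI) (auto simp: \<Delta>_def)
  have "pinv G' * G = 1\<^sub>m k - pinv G' * \<Delta>"
    by (subst G_eq, subst mult_minus_dim) (simp_all add: dm dm' P'(2))
  then have t3: "pinv G' * G * pinv G = pinv G - pinv G' * \<Delta> * pinv G"
    using P(1) by (simp add: minus_mult_dim dm dm')
  have "pinv G' - pinv G = pinv G' * ?Q - pinv G' * \<Delta> * pinv G"
    unfolding t2 t3 using P(1) P'(1)
    by (intro eq_matI) (auto simp: dm dm' simp del: index_mult_mat(1))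
  then have "frob_norm (pinv G' - pinv G) \<le> frob_norm (pinv G' * ?Q) + frob_norm (pinv G' * \<Delta> * pinv G)"
    using frob_norm_triangle_minus[of "pinv G' * ?Q" k n "pinv G' * \<Delta> * pinv G"] P'(1) QC P(1) \<Delta>
    by auto
  also have "frob_norm (pinv G' * ?Q) \<le> (2 * real N * s) * (2 * real N * s) * (d * real N)"
    unfolding t1
  proof (rule frob_norm_mult_le)
    show "frob_norm (pinv G' * transpose_mat (pinv G')) \<le> (2 * real N * s) * (2 * real N * s)"
      using P'(1) P'_bound by (intro frob_norm_mult_le[of _ k n]) auto
    show "frob_norm (transpose_mat \<Delta> * ?Q) \<le> d * real N"
      using \<Delta> QC d proj(2) nN by (intro frob_norm_mult_le[of _ k n]) (auto simp: \<Delta>_def)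
  qed (use P'(1) \<Delta> QC in auto)
  also have "frob_norm (pinv G' * \<Delta> * pinv G) \<le> (2 * real N * s) * d * s"
    using P'(1) \<Delta> P(1) P'_bound d s
    by (intro frob_norm_mult_le[of _ k k] frob_norm_mult_le[of _ k n]) (auto simp: \<Delta>_def)
  finally show "frob_norm (pinv G' - pinv G) \<le> pinv_const N * s\<^sup>2 * d"
    by (simp add: pinv_const_def algebra_simps power2_eq_square power3_eq_cube)
qed

text \<open>The three factors of \<open>pinv G * C * transpose_mat (pinv H)\<close> are exchanged
  one at a time, and each summand is the price of one exchange. The factors have distance
  \<open>\<epsilon> * pinv_const N * s^2 * d\<close>, \<open>\<epsilon> * N\<close> and again the
  first; the common \<open>\<epsilon>\<close> is split off.\<close>

definition block_const :: "nat \<Rightarrow> real \<Rightarrow> real \<Rightarrow> real \<Rightarrow> real" where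
  "block_const N s d a =
     pinv_const N * s\<^sup>2 * d * ((a + real N) * (2 * real N * s)) + s * (real N * (2 * real N * s)) +
     s * a * (pinv_const N * s\<^sup>2 * d)"

lemma block_perturbation:
  assumes G: "G \<in> carrier_mat n k" "G' \<in> carrier_mat n k" "full_col_rank G"
      "frob_norm (pinv G) \<le> s" "frob_norm (G' - G) \<le> \<epsilon> * d" "n \<le> N" "k \<le> N"
    and H: "H \<in> carrier_mat m l" "H' \<in> carrier_mat m l" "full_col_rank H"
      "frob_norm (pinv H) \<le> s" "frob_norm (H' - H) \<le> \<epsilon> * d" "m \<le> N" "l \<le> N"
    and C: "C \<in> carrier_mat n m" "C' \<in> carrier_mat n m"
      "frob_norm C \<le> a" "frob_norm (C' - C) \<le> \<epsilon> * real N"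
    and \<epsilon>: "0 \<le> \<epsilon>" "\<epsilon> \<le> 1" "s * (\<epsilon> * d) \<le> 1/2"
  shows "frob_norm (pinv G' * C' * transpose_mat (pinv H') - pinv G * C * transpose_mat (pinv H))
    \<le> \<epsilon> * block_const N s d a"
proof -
  note pG = pinv_perturbation[OF G(1-5) \<epsilon>(3) G(6,7)] and pH = pinv_perturbation[OF H(1-5) \<epsilon>(3) H(6,7)]
  note PG = pinv_full_col_rank(1)[OF G(1,3)] and PG' = pinv_full_col_rank(1)[OF G(2) pG(1)]
    and PH = pinv_full_col_rank(1)[OF H(1,3)] and PH' = pinv_full_col_rank(1)[OF H(2) pH(1)]
  let ?P = "pinv G" and ?P' = "pinv G'" and ?R = "transpose_mat (pinv H)" and ?R' = "transpose_mat (pinv H')"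
  have dm: "dim_row ?P = k" "dim_col ?P = n" "dim_row ?P' = k" "dim_col ?P' = n"
    "dim_row (pinv H) = l" "dim_col (pinv H) = m" "dim_row (pinv H') = l" "dim_col (pinv H') = m"
    "dim_row C = n" "dim_col C = m" "dim_row C' = n" "dim_col C' = m"
    using PG PG' PH PH' C by auto
  let ?t = "pinv_const N * s\<^sup>2 * (\<epsilon> * d)"
  have RC: "?R \<in> carrier_mat m l" and R'C: "?R' \<in> carrier_mat m l" using PH PH' by auto
  have PD: "?P' - ?P \<in> carrier_mat k n" and CD: "C' - C \<in> carrier_mat n m" and RD: "?R' - ?R \<in> carrier_mat m l"
    using PG C RC by (auto intro!: minus_carrier_mat)
  have RDn: "frob_norm (?R' - ?R) \<le> ?t"
    using pH(3) frob_norm_transpose[of "pinv H' - pinv H"] by (simp add: transpose_minus_dim dm)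
  have a0: "0 \<le> a" using C(3) frob_norm_nonneg[of C] by linarith
  have C'n: "frob_norm C' \<le> a + real N"
  proof -
    have "C' = C + (C' - C)" using C by (intro eq_matI) auto
    then have "frob_norm C' \<le> frob_norm C + frob_norm (C' - C)"
      using frob_norm_triangle[OF C(1) CD] by simp
    then show ?thesis using C(3,4) mult_right_mono[OF \<epsilon>(2), of "real N"] by simp
  qed
  have "?P' * C' * ?R' - ?P * C * ?R =
      (?P' - ?P) * (C' * ?R') + ?P * ((C' - C) * ?R') + ?P * C * (?R' - ?R)"
    by (simp add: minus_mult_dim mult_minus_dim mult_assoc_dim dm)
       (intro eq_matI, simp_all add: dm del: index_mult_mat(1))
  then have "frob_norm (?P' * C' * ?R' - ?P * C * ?R) \<le>
      frob_norm ((?P' - ?P) * (C' * ?R')) + frob_norm (?P * ((C' - C) * ?R')) + frob_norm (?P * C * (?R' - ?R))"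
    using PG PD CD RD R'C C
      frob_norm_triangle[of "(?P' - ?P) * (C' * ?R')" k l "?P * ((C' - C) * ?R')"]
      frob_norm_triangle[of "(?P' - ?P) * (C' * ?R') + ?P * ((C' - C) * ?R')" k l "?P * C * (?R' - ?R)"]
    by (smt (verit) add_carrier_mat mult_carrier_mat)
  also have "frob_norm ((?P' - ?P) * (C' * ?R')) \<le> ?t * ((a + real N) * (2 * real N * s))"
    using PD C R'C C'n pG(3) pH(2)
    by (intro frob_norm_mult_le[of _ k n _ l] frob_norm_mult_le[of _ n m]) auto
  also have "frob_norm (?P * ((C' - C) * ?R')) \<le> s * (\<epsilon> * real N * (2 * real N * s))"
    using PG CD R'C C(4) G(4) pH(2)
    by (intro frob_norm_mult_le[of _ k n _ l] frob_norm_mult_le[of _ n m]) auto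
  also have "frob_norm (?P * C * (?R' - ?R)) \<le> s * a * ?t"
    using PG C RD G(4) RDn
    by (intro frob_norm_mult_le[of _ k m _ l] frob_norm_mult_le[of _ k n]) auto
  finally show ?thesis
    by (simp add: block_const_def algebra_simps)
qed

lemma two_sided_perturbation:
  assumes E: "E \<in> carrier_mat n n" "frob_norm E \<le> e" and G: "G \<in> carrier_mat n k" "frob_norm G \<le> g"
    and F: "F \<in> carrier_mat k k" "frob_norm F \<le> f" and R: "R \<in> carrier_mat k k" "frob_norm R \<le> r"
    and \<epsilon>: "0 \<le> \<epsilon>"
  shows "frob_norm ((1\<^sub>m n + \<epsilon> \<cdot>\<^sub>m E) * G * (1\<^sub>m k + \<epsilon> \<cdot>\<^sub>m F + R) - G)
    \<le> \<epsilon> * e * g * (real k + \<epsilon> * f + r) + g * (\<epsilon> * f + r)"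
proof -
  let ?Y = "1\<^sub>m k + \<epsilon> \<cdot>\<^sub>m F + R" and ?X = "\<epsilon> \<cdot>\<^sub>m E"
  have dm: "dim_row E = n" "dim_col E = n" "dim_row G = n" "dim_col G = k" "dim_row F = k" "dim_col F = k"
    "dim_row R = k" "dim_col R = k" using E G F R by auto
  have YC: "?Y \<in> carrier_mat k k" and FRC: "\<epsilon> \<cdot>\<^sub>m F + R \<in> carrier_mat k k" using F R by auto
  have Fn: "frob_norm (\<epsilon> \<cdot>\<^sub>m F) \<le> \<epsilon> * f" and Xn: "frob_norm ?X \<le> \<epsilon> * e"
    using F(2) E(2) \<epsilon> by (auto simp: frob_norm_smult intro!: mult_left_mono)
  have FRn: "frob_norm (\<epsilon> \<cdot>\<^sub>m F + R) \<le> \<epsilon> * f + r"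
    using frob_norm_triangle[of "\<epsilon> \<cdot>\<^sub>m F" k k R] F(1) R Fn by auto
  have Y_eq: "?Y = 1\<^sub>m k + (\<epsilon> \<cdot>\<^sub>m F + R)" using F(1) R(1) by (intro eq_matI) auto
  have Yn: "frob_norm ?Y \<le> real k + (\<epsilon> * f + r)"
    using frob_norm_triangle[of "1\<^sub>m k" k k "\<epsilon> \<cdot>\<^sub>m F + R"] FRC FRn frob_norm_one_le[of k]
    unfolding Y_eq by auto
  have GY: "G * ?Y = G + G * (\<epsilon> \<cdot>\<^sub>m F + R)"
    unfolding Y_eq using G(1) by (simp add: mult_add_dim dm)
  have "(1\<^sub>m n + ?X) * G = G + ?X * G" using G(1) by (simp add: add_mult_dim dm)
  then have "(1\<^sub>m n + ?X) * G * ?Y = G * ?Y + ?X * G * ?Y" by (simp add: add_mult_dim dm)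
  then have "(1\<^sub>m n + ?X) * G * ?Y - G = ?X * G * ?Y + G * (\<epsilon> \<cdot>\<^sub>m F + R)"
    unfolding GY by (intro eq_matI) (auto simp: dm simp del: index_mult_mat(1))
  then have "frob_norm ((1\<^sub>m n + ?X) * G * ?Y - G) \<le> frob_norm (?X * G * ?Y) + frob_norm (G * (\<epsilon> \<cdot>\<^sub>m F + R))"
    by (simp only:) (rule frob_norm_triangle[of _ n k]; rule carrier_matI; simp add: dm)
  also have "frob_norm (?X * G * ?Y) \<le> \<epsilon> * e * g * (real k + (\<epsilon> * f + r))"
    using E(1) G YC Xn Yn
    by (intro frob_norm_mult_le[of _ n k _ k] frob_norm_mult_le[of _ n n]) auto
  also have "frob_norm (G * (\<epsilon> \<cdot>\<^sub>m F + R)) \<le> g * (\<epsilon> * f + r)"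
    using G FRC FRn by (intro frob_norm_mult_le[of _ n k]) auto
  finally show ?thesis by (simp add: algebra_simps)
qed

subsection \<open>Block matrices\<close>

lemma blk_offset_mono: "m \<le> n \<Longrightarrow> blk_offset ks m \<le> blk_offset ks n"
  unfolding blk_offset_def by (intro sum_mono2) auto

lemma blk_offset_Suc: "blk_offset ks (Suc m) = blk_offset ks m + ks m"
  by (simp add: blk_offset_def)

lemma blk_index_less:
  assumes "m < M" "p < ks m"
  shows "blk_offset ks m + p < blk_offset ks M"
  using blk_offset_mono[of "Suc m" M ks] assms by (simp add: blk_offset_Suc)

text \<open>Blocks of size 0 repeat an offset. The least block whose end lies beyond the index skips
  them, since \<open>p < ks m\<close> shows that block \<open>m\<close> itself is not empty.\<close>

lemma blk_of_index [simp]: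
  assumes "p < ks m"
  shows "blk_of ks (blk_offset ks m + p) = m" "blk_pos ks (blk_offset ks m + p) = p"
proof -
  show of: "blk_of ks (blk_offset ks m + p) = m"
    unfolding blk_of_def
  proof (rule Least_equality)
    fix l assume l: "blk_offset ks m + p < blk_offset ks (Suc l)"
    show "m \<le> l"
    proof (rule ccontr)
      assume "\<not> m \<le> l"
      then show False using blk_offset_mono[of "Suc l" m ks] l by simp
    qed
  qed (use assms in \<open>simp add: blk_offset_Suc\<close>)
  show "blk_pos ks (blk_offset ks m + p) = p" by (simp add: blk_pos_def of)
qed

lemma blk_index_cases:
  assumes "i < blk_offset ks M"
  obtains m p where "m < M" "p < ks m" "i = blk_offset ks m + p"
  using assms
proof (induction M arbitrary: thesis)
  case 0
  then show ?case by (simp add: blk_offset_def)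
next
  case (Suc M)
  show ?case
  proof (cases "i < blk_offset ks M")
    case True
    then show ?thesis using Suc.IH[of thesis] Suc.prems(1) less_SucI by blast
  next
    case False
    then show ?thesis
      using Suc.prems(1)[of M "i - blk_offset ks M"] Suc.prems(2) by (simp add: blk_offset_Suc)
  qed
qed

lemma sum_blk_offset:
  "(\<Sum>i<blk_offset ks M. f i) = (\<Sum>m<M. \<Sum>p<ks m. f (blk_offset ks m + p))"
proof (induction M)
  case (Suc M)
  have "(\<Sum>i<blk_offset ks (Suc M). f i) = (\<Sum>i<blk_offset ks M. f i) + (\<Sum>i\<in>{blk_offset ks M..<blk_offset ks M + ks M}. f i)"
    unfolding blk_offset_Suc lessThan_atLeast0 by (rule sum.atLeastLessThan_concat[symmetric]) auto
  also have "(\<Sum>i\<in>{blk_offset ks M..<blk_offset ks M + ks M}. f i) = (\<Sum>p<ks M. f (blk_offset ks M + p))"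
    unfolding lessThan_atLeast0 using sum.shift_bounds_nat_ivl[of f 0 "blk_offset ks M" "ks M"]
    by (simp add: add.commute)
  finally show ?case using Suc by simp
qed (simp add: blk_offset_def)

lemma block_mat_carrier [simp]: "block_mat ks M B \<in> carrier_mat (blk_offset ks M) (blk_offset ks M)"
  and block_mat_dims [simp]: "dim_row (block_mat ks M B) = blk_offset ks M" "dim_col (block_mat ks M B) = blk_offset ks M"
  by (simp_all add: block_mat_def)

lemma index_block_mat:
  assumes "m < M" "p < ks m" "n < M" "q < ks n"
  shows "block_mat ks M B $$ (blk_offset ks m + p, blk_offset ks n + q) = B m n $$ (p,q)"
  using assms by (simp add: block_mat_def blk_index_less)

lemma block_mat_eqI:
  assumes "A \<in> carrier_mat (blk_offset ks M) (blk_offset ks M)"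
    and "\<And>m p n q. m < M \<Longrightarrow> p < ks m \<Longrightarrow> n < M \<Longrightarrow> q < ks n \<Longrightarrow>
      A $$ (blk_offset ks m + p, blk_offset ks n + q) = B m n $$ (p,q)"
  shows "A = block_mat ks M B"
proof (rule eq_matI)
  fix i j assume "i < dim_row (block_mat ks M B)" "j < dim_col (block_mat ks M B)"
  then have "i < blk_offset ks M" "j < blk_offset ks M" by auto
  then obtain m p n q where "m < M" "p < ks m" "i = blk_offset ks m + p"
      "n < M" "q < ks n" "j = blk_offset ks n + q" by (metis blk_index_cases)
  then show "A $$ (i,j) = block_mat ks M B $$ (i,j)" using assms(2) by (simp add: index_block_mat)
qed (use assms in auto)

lemma diag_block_mat_blocks:
  assumes "\<And>m. m < M \<Longrightarrow> D m \<in> carrier_mat (ks m) (ks m)"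
  shows "diag_block_mat (map D [0..<M]) =
    block_mat ks M (\<lambda>m n. if m = n then D m else 0\<^sub>m (ks m) (ks n))"
  using assms
proof (induction M)
  case 0
  show ?case by (intro eq_matI) (auto simp: blk_offset_def)
next
  case (Suc M)
  let ?B = "\<lambda>m n. if m = n then D m else 0\<^sub>m (ks m) (ks n)"
  let ?A = "block_mat ks M ?B"
  have DM: "D M \<in> carrier_mat (ks M) (ks M)" using Suc.prems by simp
  have "diag_block_mat (map D [0..<Suc M]) =
      four_block_mat ?A (0\<^sub>m (blk_offset ks M) (ks M)) (0\<^sub>m (ks M) (blk_offset ks M)) (D M)"
    using Suc.IH Suc.prems carrier_matD[OF DM] by (simp add: diag_block_mat_last Let_def)
  also have "\<dots> = block_mat ks (Suc M) ?B"
  proof (rule block_mat_eqI)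
    fix m p n q assume *: "m < Suc M" "p < ks m" "n < Suc M" "q < ks n"
    have l: "blk_offset ks m + p < blk_offset ks M \<longleftrightarrow> m < M" "blk_offset ks n + q < blk_offset ks M \<longleftrightarrow> n < M"
      using * blk_index_less[of m M p ks] blk_index_less[of n M q ks] by (auto simp: less_Suc_eq)
    have r: "blk_offset ks m + p < blk_offset ks M + ks M" "blk_offset ks n + q < blk_offset ks M + ks M"
      using blk_index_less[of m "Suc M" p ks] blk_index_less[of n "Suc M" q ks] * by (auto simp: blk_offset_Suc)
    show "four_block_mat ?A (0\<^sub>m (blk_offset ks M) (ks M)) (0\<^sub>m (ks M) (blk_offset ks M)) (D M)
        $$ (blk_offset ks m + p, blk_offset ks n + q) = ?B m n $$ (p,q)"
      using * l r DM by (subst index_mat_four_block) (auto simp: index_block_mat less_Suc_eq)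
  qed (use DM in \<open>auto simp: blk_offset_Suc\<close>)
  finally show ?case .
qed

lemma transpose_block_mat:
  assumes "\<And>m n. m < M \<Longrightarrow> n < M \<Longrightarrow> B m n \<in> carrier_mat (ks m) (ks n)"
  shows "transpose_mat (block_mat ks M B) = block_mat ks M (\<lambda>m n. transpose_mat (B n m))"
proof (rule block_mat_eqI)
  fix m p n q assume *: "m < M" "p < ks m" "n < M" "q < ks n"
  then show "transpose_mat (block_mat ks M B) $$ (blk_offset ks m + p, blk_offset ks n + q) =
      transpose_mat (B n m) $$ (p,q)"
    using assms[of n m] by (auto simp: index_block_mat blk_index_less)
qed simp

lemma block_mat_mult_diag:
  fixes B :: "nat \<Rightarrow> nat \<Rightarrow> real mat"
  assumes B: "\<And>m n. m < M \<Longrightarrow> n < M \<Longrightarrow> B m n \<in> carrier_mat (ks m) (ks n)"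
    and D: "\<And>m. m < M \<Longrightarrow> D m \<in> carrier_mat (ks m) (ks m)"
  shows "block_mat ks M B * diag_block_mat (map D [0..<M]) = block_mat ks M (\<lambda>m n. B m n * D n)"
proof (rule block_mat_eqI)
  let ?E = "\<lambda>m n. if m = n then D m else 0\<^sub>m (ks m) (ks n)"
  have DD: "diag_block_mat (map D [0..<M]) = block_mat ks M ?E" by (rule diag_block_mat_blocks[OF D])
  show "block_mat ks M B * diag_block_mat (map D [0..<M]) \<in> carrier_mat (blk_offset ks M) (blk_offset ks M)"
    unfolding DD by auto
  fix m p n q assume *: "m < M" "p < ks m" "n < M" "q < ks n"
  have "(block_mat ks M B * block_mat ks M ?E) $$ (blk_offset ks m + p, blk_offset ks n + q) =
      (\<Sum>l<blk_offset ks M. block_mat ks M B $$ (blk_offset ks m + p, l) * block_mat ks M ?E $$ (l, blk_offset ks n + q))"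
    using * by (simp add: scalar_prod_def blk_index_less lessThan_atLeast0)
  also have "\<dots> = (\<Sum>l<M. \<Sum>r<ks l. B m l $$ (p,r) * ?E l n $$ (r,q))"
    unfolding sum_blk_offset using * by (intro sum.cong refl) (simp add: index_block_mat)
  also have "\<dots> = (\<Sum>l<M. if l = n then \<Sum>r<ks l. B m l $$ (p,r) * D l $$ (r,q) else 0)"
    using * by (intro sum.cong refl) auto
  also have "\<dots> = (\<Sum>r<ks n. B m n $$ (p,r) * D n $$ (r,q))" using * by (simp add: sum.delta)
  also have "\<dots> = (B m n * D n) $$ (p,q)"
    using * B[of m n] D[of n] by (simp add: scalar_prod_def lessThan_atLeast0)
  finally show "(block_mat ks M B * diag_block_mat (map D [0..<M])) $$ (blk_offset ks m + p, blk_offset ks n + q)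
      = (B m n * D n) $$ (p,q)"
    unfolding DD .
qed

lemma block_mat_conj_diag:
  fixes B :: "nat \<Rightarrow> nat \<Rightarrow> real mat"
  assumes B: "\<And>m n. m < M \<Longrightarrow> n < M \<Longrightarrow> B m n \<in> carrier_mat (ks m) (ks n)"
    and D: "\<And>m. m < M \<Longrightarrow> D m \<in> carrier_mat (ks m) (ks m)"
  defines "DD \<equiv> diag_block_mat (map D [0..<M])"
  shows "transpose_mat DD * block_mat ks M B * DD = block_mat ks M (\<lambda>m n. transpose_mat (D m) * B m n * D n)"
proof -
  have DDC: "DD \<in> carrier_mat (blk_offset ks M) (blk_offset ks M)"
    unfolding DD_def by (subst diag_block_mat_blocks[OF D]) simp_all
  have Bt: "transpose_mat (B n m) \<in> carrier_mat (ks m) (ks n)" if "m < M" "n < M" for m n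
    using B that by simp
  have DB: "transpose_mat (D m) * B m n \<in> carrier_mat (ks m) (ks n)" if "m < M" "n < M" for m n
    using B[of m n] D[of m] that by auto
  \<comment> \<open>Multiplication from the left is reduced by transposition to the case of
    \<open>block_mat_mult_diag\<close>.\<close>
  have "transpose_mat DD * block_mat ks M B = transpose_mat (transpose_mat (block_mat ks M B) * DD)"
    using DDC by (simp add: transpose_mult_dim)
  also have "\<dots> = transpose_mat (block_mat ks M (\<lambda>m n. transpose_mat (B n m) * D n))"
  proof -
    have "transpose_mat (block_mat ks M B) = block_mat ks M (\<lambda>m n. transpose_mat (B n m))"
      by (rule transpose_block_mat) (rule B)
    moreover have "block_mat ks M (\<lambda>m n. transpose_mat (B n m)) * DD =
        block_mat ks M (\<lambda>m n. transpose_mat (B n m) * D n)"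
      unfolding DD_def by (rule block_mat_mult_diag) (fact Bt, fact D)
    ultimately show ?thesis by (simp only:)
  qed
  also have "\<dots> = block_mat ks M (\<lambda>m n. transpose_mat (transpose_mat (B m n) * D m))"
    by (rule transpose_block_mat) (auto intro!: mult_carrier_mat[OF Bt D])
  also have "\<dots> = block_mat ks M (\<lambda>m n. transpose_mat (D m) * B m n)"
  proof (rule block_mat_eqI)
    fix m p n q assume *: "m < M" "p < ks m" "n < M" "q < ks n"
    have "transpose_mat (transpose_mat (B m n) * D m) = transpose_mat (D m) * B m n"
      using B[of m n] D[of m] * by (simp add: transpose_mult_dim)
    then show "block_mat ks M (\<lambda>m n. transpose_mat (transpose_mat (B m n) * D m))
        $$ (blk_offset ks m + p, blk_offset ks n + q) = (transpose_mat (D m) * B m n) $$ (p,q)"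
      using * by (simp only: index_block_mat)
  qed simp
  finally have "transpose_mat DD * block_mat ks M B * DD = block_mat ks M (\<lambda>m n. transpose_mat (D m) * B m n) * DD"
    by simp
  also have "\<dots> = block_mat ks M (\<lambda>m n. transpose_mat (D m) * B m n * D n)"
    unfolding DD_def by (rule block_mat_mult_diag) (fact DB, fact D)
  finally show ?thesis .
qed

lemma block_mat_cong:
  assumes "\<And>m n. m < M \<Longrightarrow> n < M \<Longrightarrow> B m n = B' m n"
  shows "block_mat ks M B = block_mat ks M B'"
  by (rule block_mat_eqI) (simp_all add: assms index_block_mat)

subsection \<open>Patches\<close>

locale patches =
  fixes N :: nat and Ps :: "nat set list"
  assumes partition: "patch_partition N Ps"
begin

abbreviation M :: nat where "M \<equiv> length Ps"

lemma patch_subset: "m < M \<Longrightarrow> Ps ! m \<subseteq> {..<N}"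
  using partition nth_mem[of m Ps] unfolding patch_partition_def partition_on_def by blast

lemma finite_patch: "m < M \<Longrightarrow> finite (Ps ! m)"
  using patch_subset finite_subset by blast

lemma patches_disjoint:
  assumes "m < M" "n < M" "r \<in> Ps ! m" "r \<in> Ps ! n"
  shows "m = n"
proof -
  have "disjoint (set Ps)" "distinct Ps"
    using partition by (auto simp: patch_partition_def partition_on_def)
  then have "Ps ! m = Ps ! n"
    using assms nth_mem[OF assms(1)] nth_mem[OF assms(2)] unfolding disjoint_def by blast
  then show ?thesis using \<open>distinct Ps\<close> assms by (simp add: nth_eq_iff_index_eq)
qed

lemma sum_patches: "(\<Sum>P\<in>set Ps. f P) = (\<Sum>m<M. f (Ps ! m))"
  using partition sum.reindex_bij_betw[OF bij_betw_nth[of Ps "{..<M}" "set Ps"], of f]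
  by (simp add: patch_partition_def)

lemma sum_card_patches: "(\<Sum>m<M. card (Ps ! m)) = N"
proof -
  have "(\<Sum>m<M. card (Ps ! m)) = (\<Sum>P\<in>set Ps. card P)" by (rule sum_patches[symmetric])
  also have "\<dots> = card (\<Union> (set Ps))"
    using partition finite_patch
    by (intro card_Union_disjoint[symmetric])
       (auto simp: patch_partition_def partition_on_def disjoint_def pairwise_def disjnt_def in_set_conv_nth)
  also have "\<Union> (set Ps) = {..<N}" using partition by (auto simp: patch_partition_def partition_on_def)
  finally show ?thesis by simp
qed

lemma card_patch_le: "m < M \<Longrightarrow> card (Ps ! m) \<le> N"
  using sum_card_patches member_le_sum[of m "{..<M}" "\<lambda>m. card (Ps ! m)"] by simp

lemma blk_offset_le:
  assumes "\<And>m. m < M \<Longrightarrow> ks m \<le> card (Ps ! m)"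
  shows "blk_offset ks M \<le> N"
  using sum_mono[of "{..<M}" ks "\<lambda>m. card (Ps ! m)"] assms sum_card_patches by (simp add: blk_offset_def)

lemma pick_patch:
  assumes "m < M" "a < card (Ps ! m)"
  shows "pick (Ps ! m) a \<in> Ps ! m" "pick (Ps ! m) a < N" "card {x \<in> Ps ! m. x < pick (Ps ! m) a} = a"
  using pick_in_set[of a "Ps ! m"] card_pick[of a "Ps ! m"] patch_subset[OF assms(1)] assms by auto

lemma card_less_patch:
  assumes "m < M" "r \<in> Ps ! m"
  shows "card {x \<in> Ps ! m. x < r} < card (Ps ! m)"
  using assms finite_patch by (intro psubset_card_mono) auto

lemma blk_carrier:
  assumes "m < M" "n < M" "A \<in> carrier_mat N N"
  shows "blk A Ps m n \<in> carrier_mat (card (Ps ! m)) (card (Ps ! n))"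
proof -
  have "{i. i < N \<and> i \<in> Ps ! m} = Ps ! m" if "m < M" for m using patch_subset[OF that] by auto
  then show ?thesis using assms by (auto simp: blk_def dim_submatrix)
qed

lemma index_blk:
  assumes "m < M" "n < M" "A \<in> carrier_mat N N" "a < card (Ps ! m)" "b < card (Ps ! n)"
  shows "blk A Ps m n $$ (a,b) = A $$ (pick (Ps ! m) a, pick (Ps ! n) b)"
  using blk_carrier[OF assms(1-3)] assms(4,5) unfolding blk_def
  by (intro submatrix_index) (auto simp: dim_submatrix)

lemma frob_norm_blk_le:
  assumes "m < M" "n < M" "A \<in> carrier_mat N N"
  shows "frob_norm (blk A Ps m n) \<le> real N * spec_norm A"
proof (rule frob_norm_le_entries)
  note C = blk_carrier[OF assms]
  fix i j assume "i < dim_row (blk A Ps m n)" "j < dim_col (blk A Ps m n)"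
  then show "\<bar>blk A Ps m n $$ (i,j)\<bar> \<le> spec_norm A"
    using C assms pick_patch by (auto simp: index_blk intro!: entry_le_spec_norm)
qed (use blk_carrier[OF assms] card_patch_le assms in auto)

lemma g_ext_carrier [simp]: "g_ext N Ps ks G \<in> carrier_mat N (blk_offset ks M)"
  by (simp add: g_ext_def)

lemma index_g_ext:
  assumes "r < N" "m < M" "p < ks m"
  shows "g_ext N Ps ks G $$ (r, blk_offset ks m + p) =
    (if r \<in> Ps ! m then G m $$ (card {x \<in> Ps ! m. x < r}, p) else 0)"
  using assms by (simp add: g_ext_def blk_index_less Let_def)

text \<open>A row of patch \<open>m\<close> belongs to no other patch, so only block
  \<open>m\<close> of the coefficients survives, and its local row number is the position from which
  it was picked.\<close>

lemma restr_g_ext_col: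
  assumes m: "m < M" and G: "G m \<in> carrier_mat (card (Ps ! m)) (ks m)"
    and X: "X \<in> carrier_mat (blk_offset ks M) K" and k: "k < K"
  shows "restr (Ps ! m) (col (g_ext N Ps ks G * X) k) =
    G m *\<^sub>v vec (ks m) (\<lambda>p. X $$ (blk_offset ks m + p, k))"
proof (rule eq_vecI)
  fix a assume "a < dim_vec (G m *\<^sub>v vec (ks m) (\<lambda>p. X $$ (blk_offset ks m + p, k)))"
  then have a: "a < card (Ps ! m)" using G by simp
  note r = pick_patch[OF m a]
  let ?r = "pick (Ps ! m) a"
  have "restr (Ps ! m) (col (g_ext N Ps ks G * X) k) $ a = (g_ext N Ps ks G * X) $$ (?r,k)"
    using a r X k carrier_matD[OF g_ext_carrier[of ks G]] by (simp add: restr_def)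
  also have "\<dots> = (\<Sum>j<blk_offset ks M. g_ext N Ps ks G $$ (?r,j) * X $$ (j,k))"
    using r X k carrier_matD[OF g_ext_carrier[of ks G]] by (simp add: scalar_prod_def lessThan_atLeast0)
  also have "\<dots> = (\<Sum>l<M. \<Sum>p<ks l. (if ?r \<in> Ps ! l then G l $$ (card {x \<in> Ps ! l. x < ?r}, p) else 0) * X $$ (blk_offset ks l + p,k))"
    unfolding sum_blk_offset using r by (intro sum.cong refl) (simp add: index_g_ext)
  also have "\<dots> = (\<Sum>l<M. if l = m then \<Sum>p<ks m. G m $$ (a,p) * X $$ (blk_offset ks m + p,k) else 0)"
  proof (intro sum.cong refl)
    fix l assume "l \<in> {..<M}"
    then have "?r \<in> Ps ! l \<longleftrightarrow> l = m" using r(1) m patches_disjoint[of l m ?r] by auto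
    then show "(\<Sum>p<ks l. (if ?r \<in> Ps ! l then G l $$ (card {x \<in> Ps ! l. x < ?r}, p) else 0) * X $$ (blk_offset ks l + p,k))
        = (if l = m then \<Sum>p<ks m. G m $$ (a,p) * X $$ (blk_offset ks m + p,k) else 0)"
      using r(3) by simp
  qed
  also have "\<dots> = (\<Sum>p<ks m. G m $$ (a,p) * X $$ (blk_offset ks m + p,k))" using m by (simp add: sum.delta)
  also have "\<dots> = (G m *\<^sub>v vec (ks m) (\<lambda>p. X $$ (blk_offset ks m + p, k))) $ a"
    using G a by (simp add: scalar_prod_def lessThan_atLeast0)
  finally show "restr (Ps ! m) (col (g_ext N Ps ks G * X) k) $ a =
    (G m *\<^sub>v vec (ks m) (\<lambda>p. X $$ (blk_offset ks m + p, k))) $ a" .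
qed (use G in \<open>auto simp: restr_def\<close>)

text \<open>Local pieces with trivial kernel cannot hide nonzero coefficients, so the patch support
  of a column is determined by \<open>X\<close> alone. This is why two outputs built with the same
  factor \<open>P * L\<close> have the same patch-wise sparse structure, however different their
  local pieces are.\<close>

lemma patch_support_g_ext_col:
  assumes G: "\<And>m. m < M \<Longrightarrow> G m \<in> carrier_mat (card (Ps ! m)) (ks m)" "\<And>m. m < M \<Longrightarrow> full_col_rank (G m)"
    and X: "X \<in> carrier_mat (blk_offset ks M) K" and k: "k < K"
  shows "patch_support Ps (col (g_ext N Ps ks G * X) k) =
    {P. \<exists>m<M. P = Ps ! m \<and> vec (ks m) (\<lambda>p. X $$ (blk_offset ks m + p, k)) \<noteq> 0\<^sub>v (ks m)}"
proof -
  have "restr (Ps ! m) (col (g_ext N Ps ks G * X) k) = 0\<^sub>v (card (Ps ! m)) \<longleftrightarrow>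
      vec (ks m) (\<lambda>p. X $$ (blk_offset ks m + p, k)) = 0\<^sub>v (ks m)" (is "_ \<longleftrightarrow> ?x = _") if m: "m < M" for m
  proof -
    note C = G(1)[OF m]
    have "G m *\<^sub>v ?x = 0\<^sub>v (card (Ps ! m)) \<Longrightarrow> ?x = 0\<^sub>v (ks m)"
      using G(2)[OF m] C by (auto simp: full_col_rank_def)
    moreover have "G m *\<^sub>v 0\<^sub>v (ks m) = 0\<^sub>v (card (Ps ! m))"
      using C by (intro eq_vecI) auto
    ultimately show ?thesis unfolding restr_g_ext_col[where G = G, OF m C X k] by auto
  qed
  then show ?thesis unfolding patch_support_def by (auto simp: in_set_conv_nth)
qed

lemma frob_norm_g_ext_diff:
  assumes G: "\<And>m. m < M \<Longrightarrow> G m \<in> carrier_mat (card (Ps ! m)) (ks m)"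
    and G': "\<And>m. m < M \<Longrightarrow> G' m \<in> carrier_mat (card (Ps ! m)) (ks m)"
    and ks: "\<And>m. m < M \<Longrightarrow> ks m \<le> card (Ps ! m)"
    and diff: "\<And>m. m < M \<Longrightarrow> frob_norm (G' m - G m) \<le> c" and c: "0 \<le> c"
  shows "frob_norm (g_ext N Ps ks G' - g_ext N Ps ks G) \<le> real N * c"
proof (rule frob_norm_le_entries)
  let ?D = "g_ext N Ps ks G' - g_ext N Ps ks G"
  have dims: "dim_row ?D = N" "dim_col ?D = blk_offset ks M"
    using carrier_matD[OF g_ext_carrier[of ks G]] by auto
  then show "dim_row ?D \<le> N" "dim_col ?D \<le> N" using blk_offset_le[OF ks] by auto
  fix r j assume r: "r < dim_row ?D" and j: "j < dim_col ?D"
  from r have r: "r < N" using dims by simp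
  obtain m p where mp: "m < M" "p < ks m" "j = blk_offset ks m + p"
    using j unfolding dims by (rule blk_index_cases)
  have e: "?D $$ (r,j) = g_ext N Ps ks G' $$ (r,j) - g_ext N Ps ks G $$ (r,j)"
    using r j dims carrier_matD[OF g_ext_carrier[of ks G]] by simp
  show "\<bar>?D $$ (r,j)\<bar> \<le> c"
  proof (cases "r \<in> Ps ! m")
    case True
    let ?a = "card {x \<in> Ps ! m. x < r}"
    have a: "?a < card (Ps ! m)" by (rule card_less_patch[OF mp(1) True])
    have "?D $$ (r,j) = (G' m - G m) $$ (?a,p)"
      unfolding e unfolding mp(3) using True r mp a G[OF mp(1)] by (simp add: index_g_ext)
    also have "\<bar>\<dots>\<bar> \<le> frob_norm (G' m - G m)"
      using a mp G[OF mp(1)] by (intro entry_le_frob_norm) auto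
    finally show ?thesis using diff[OF mp(1)] by linarith
  next
    case False
    then show ?thesis unfolding e unfolding mp(3) using r mp c by (simp add: index_g_ext)
  qed
qed fact

end

section \<open>Enumerations of finite sets and signed permutation matrices\<close>

lemma pick_bij:
  assumes "finite S"
  shows "bij_betw (pick S) {..<card S} S"
proof -
  have "inj_on (pick S) {..<card S}"
  proof (rule inj_onI)
    fix i j assume "i \<in> {..<card S}" "j \<in> {..<card S}" "pick S i = pick S j"
    then show "i = j" using card_pick[of i S] card_pick[of j S] by (metis lessThan_iff)
  qed
  moreover have "pick S ` {..<card S} = S"
    using calculation pick_in_set[of _ S] assms by (intro card_subset_eq) (auto simp: card_image)
  ultimately show ?thesis
    unfolding bij_betw_def by (rule conjI)
qed

lemma sum_pick: "finite S \<Longrightarrow> (\<Sum>i<card S. f (pick S i)) = (\<Sum>k\<in>S. f k)"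
  by (rule sum.reindex_bij_betw[OF pick_bij])

lemma index_signed_perm_transpose_mult:
  fixes B :: "real mat"
  assumes \<pi>: "\<pi> permutes {..<k}" and B: "B \<in> carrier_mat k l" and ij: "i < k" "j < l"
  shows "(transpose_mat (mat k k (\<lambda>(i,j). if i = \<pi> j then s j else 0)) * B) $$ (i,j) = s i * B $$ (\<pi> i,j)"
    (is "(transpose_mat ?J * B) $$ _ = _")
proof -
  have "(transpose_mat ?J * B) $$ (i,j) = (\<Sum>a<k. ?J $$ (a,i) * B $$ (a,j))"
    using ij B by (simp add: scalar_prod_def lessThan_atLeast0)
  also have "\<dots> = (\<Sum>a<k. if a = \<pi> i then s i * B $$ (\<pi> i,j) else 0)"
    using ij by (intro sum.cong refl) simp
  also have "\<dots> = s i * B $$ (\<pi> i,j)"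
    using permutes_in_image[OF \<pi>, of i] ij by (simp add: sum.delta)
  finally show ?thesis .
qed

lemma orth_mat_signed_perm:
  assumes "signed_perm_mat k J"
  shows "orth_mat k J"
proof -
  obtain \<pi> s where \<pi>: "\<pi> permutes {..<k}" and s: "\<And>i. i < k \<Longrightarrow> s i = 1 \<or> s i = -1"
    and J: "J = mat k k (\<lambda>(i,j). if i = \<pi> j then s j else 0)"
    using assms by (rule signed_perm_matE) blast
  show ?thesis
  proof (rule orth_matI)
    show "transpose_mat J * J = 1\<^sub>m k"
    proof (rule eq_matI)
      fix i j assume ij: "i < dim_row (1\<^sub>m k :: real mat)" "j < dim_col (1\<^sub>m k :: real mat)"
      have "(transpose_mat J * J) $$ (i,j) = s i * (if \<pi> i = \<pi> j then s j else 0)"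
        unfolding J using permutes_in_image[OF \<pi>, of i] ij
        by (subst index_signed_perm_transpose_mult[OF \<pi>, of _ k]) auto
      also have "\<dots> = 1\<^sub>m k $$ (i,j)"
        using ij s[of i] permutes_inj[OF \<pi>] by (auto simp: inj_eq)
      finally show "(transpose_mat J * J) $$ (i,j) = 1\<^sub>m k $$ (i,j)" .
    qed (auto simp: J)
  qed (simp add: J)
qed

text \<open>The transpose of a signed permutation matrix inverts its permutation. An entry of the
  product is nonzero only for \<open>\<pi> i = \<rho> j\<close>, that is, on the graph of the
  composed permutation.\<close>

lemma signed_perm_transpose_mult:
  assumes "signed_perm_mat k J" "signed_perm_mat k J'"
  shows "signed_perm_mat k (transpose_mat J * J')"
proof -
  obtain \<pi> s where \<pi>: "\<pi> permutes {..<k}" and s: "\<And>i. i < k \<Longrightarrow> s i = 1 \<or> s i = -1"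
    and J: "J = mat k k (\<lambda>(i,j). if i = \<pi> j then s j else 0)"
    using assms(1) by (rule signed_perm_matE) blast
  obtain \<rho> t where \<rho>: "\<rho> permutes {..<k}" and t: "\<And>i. i < k \<Longrightarrow> t i = 1 \<or> t i = -1"
    and J': "J' = mat k k (\<lambda>(i,j). if i = \<rho> j then t j else 0)"
    using assms(2) by (rule signed_perm_matE) blast
  let ?\<tau> = "inv_into UNIV \<pi> \<circ> \<rho>"
  have \<tau>: "?\<tau> permutes {..<k}" using \<rho> permutes_inv[OF \<pi>] by (rule permutes_compose)
  have eq: "\<pi> i = \<rho> j \<longleftrightarrow> i = ?\<tau> j" for i j
    using permutes_inverses[OF \<pi>] by (metis comp_apply)
  show ?thesis
  proof (rule signed_perm_matI[OF \<tau>, of "\<lambda>j. s (?\<tau> j) * t j"])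
    show "s (?\<tau> i) * t i = 1 \<or> s (?\<tau> i) * t i = -1" if "i < k" for i
      using s[of "?\<tau> i"] t[of i] permutes_in_image[OF \<tau>, of i] that by auto
    show "transpose_mat J * J' = mat k k (\<lambda>(i,j). if i = ?\<tau> j then s (?\<tau> j) * t j else 0)" (is "_ = ?R")
    proof (rule eq_matI)
      fix i j assume "i < dim_row ?R" "j < dim_col ?R"
      then have ij: "i < k" "j < k" by auto
      have "(transpose_mat J * J') $$ (i,j) = s i * (if \<pi> i = \<rho> j then t j else 0)"
        unfolding J J' using permutes_in_image[OF \<pi>, of i] ij
        by (subst index_signed_perm_transpose_mult[OF \<pi>, of _ k]) auto
      also have "\<dots> = ?R $$ (i,j)"
        using ij by (auto simp: eq)
      finally show "(transpose_mat J * J') $$ (i,j) = ?R $$ (i,j)" .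
    qed (auto simp: J J')
  qed
qed

lemma signed_perm_transpose_mult_entries:
  assumes J: "signed_perm_mat k J" and B: "B \<in> carrier_mat k l"
    and entries: "\<And>i j. i < k \<Longrightarrow> j < l \<Longrightarrow> B $$ (i,j) \<in> {-1,0,1}"
    and ij: "i < k" "j < l"
  shows "(transpose_mat J * B) $$ (i,j) \<in> {-1,0,1}"
proof -
  obtain \<pi> s where \<pi>: "\<pi> permutes {..<k}" and s: "\<And>i. i < k \<Longrightarrow> s i = 1 \<or> s i = -1"
    and J: "J = mat k k (\<lambda>(i,j). if i = \<pi> j then s j else 0)"
    using J by (rule signed_perm_matE) blast
  have "(transpose_mat J * B) $$ (i,j) = s i * B $$ (\<pi> i,j)"
    unfolding J by (rule index_signed_perm_transpose_mult[OF \<pi> B ij])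
  then show ?thesis
    using s[OF ij(1)] entries[of "\<pi> i" j] permutes_in_image[OF \<pi>, of i] ij by auto
qed

subsection \<open>Modes and their restrictions\<close>

context patches
begin

definition active :: "nat \<Rightarrow> (nat \<Rightarrow> real vec) \<Rightarrow> nat \<Rightarrow> nat set" where
  "active K \<phi> m = {k. k < K \<and> restr (Ps ! m) (\<phi> k) \<noteq> 0\<^sub>v (card (Ps ! m))}"

definition local_modes :: "nat \<Rightarrow> (nat \<Rightarrow> real vec) \<Rightarrow> nat \<Rightarrow> real mat" where
  "local_modes K \<phi> m = mat (card (Ps ! m)) (card (active K \<phi> m))
     (\<lambda>(a,i). \<phi> (pick (active K \<phi> m) i) $ pick (Ps ! m) a)"

definition matching :: "nat \<Rightarrow> (nat \<Rightarrow> real vec) \<Rightarrow> nat \<Rightarrow> nat \<Rightarrow> real mat" where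
  "matching K \<phi> m n = mat (card (active K \<phi> m)) (card (active K \<phi> n))
     (\<lambda>(i,j). if pick (active K \<phi> m) i = pick (active K \<phi> n) j then 1 else 0)"

lemma finite_active [simp]: "finite (active K \<phi> m)"
  by (simp add: active_def)

lemma local_modes_carrier: "local_modes K \<phi> m \<in> carrier_mat (card (Ps ! m)) (card (active K \<phi> m))"
  by (simp add: local_modes_def)

lemma matching_carrier: "matching K \<phi> m n \<in> carrier_mat (card (active K \<phi> m)) (card (active K \<phi> n))"
  by (simp add: matching_def)

text \<open>A mode inactive on one of the two patches contributes nothing to the block. The matching
  therefore only has to pair up the modes active on both, and the sum over them is the sum over all
  modes.\<close>

lemma blk_local_modes:
  assumes A: "A \<in> carrier_mat N N" and dec: "decomposes A K \<phi>" and m: "m < M" "n < M"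
  shows "blk A Ps m n = local_modes K \<phi> m * matching K \<phi> m n * transpose_mat (local_modes K \<phi> n)"
    (is "_ = ?R")
proof (rule eq_matI)
  fix a b assume "a < dim_row ?R" "b < dim_col ?R"
  then have a: "a < card (Ps ! m)" and b: "b < card (Ps ! n)" by (auto simp: local_modes_def)
  let ?Sm = "active K \<phi> m" and ?Sn = "active K \<phi> n"
  define x where "x k = \<phi> k $ pick (Ps ! m) a" for k
  define y where "y k = \<phi> k $ pick (Ps ! n) b" for k
  have x0: "x k = 0" if "k < K" "k \<notin> ?Sm" for k
  proof -
    have "restr (Ps ! m) (\<phi> k) = 0\<^sub>v (card (Ps ! m))" using that by (simp add: active_def)
    then have "restr (Ps ! m) (\<phi> k) $ a = 0" using a by simp
    then show ?thesis using a by (simp add: restr_def x_def)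
  qed
  have y0: "y k = 0" if "k < K" "k \<notin> ?Sn" for k
  proof -
    have "restr (Ps ! n) (\<phi> k) = 0\<^sub>v (card (Ps ! n))" using that by (simp add: active_def)
    then have "restr (Ps ! n) (\<phi> k) $ b = 0" using b by simp
    then show ?thesis using b by (simp add: restr_def y_def)
  qed
  have BC: "local_modes K \<phi> m \<in> carrier_mat (card (Ps ! m)) (card ?Sm)"
    "matching K \<phi> m n \<in> carrier_mat (card ?Sm) (card ?Sn)"
    "local_modes K \<phi> n \<in> carrier_mat (card (Ps ! n)) (card ?Sn)"
    by (auto simp: local_modes_carrier matching_carrier)
  have "?R $$ (a,b) = (\<Sum>j<card ?Sn. (\<Sum>i<card ?Sm. x (pick ?Sm i) *
      (if pick ?Sm i = pick ?Sn j then 1 else 0)) * y (pick ?Sn j))"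
    using a b BC by (auto simp: scalar_prod_def lessThan_atLeast0 local_modes_def matching_def x_def y_def
        intro!: sum.cong arg_cong2[where f = "(*)"])
  also have "\<dots> = (\<Sum>l\<in>?Sn. (\<Sum>k\<in>?Sm. x k * (if k = l then 1 else 0)) * y l)"
    by (simp only: sum_pick[of ?Sm "\<lambda>k. x k * (if k = _ then 1 else 0)"]
        sum_pick[of ?Sn "\<lambda>l. (\<Sum>k\<in>?Sm. x k * (if k = l then 1 else 0)) * y l"] finite_active)
  also have "\<dots> = (\<Sum>l\<in>?Sn. (if l \<in> ?Sm then x l else 0) * y l)"
    by (intro sum.cong refl) (simp add: if_distrib[where f = "\<lambda>z. x _ * z"] sum.delta cong: if_cong)
  also have "\<dots> = (\<Sum>l<K. x l * y l)"
    by (rule sum.mono_neutral_cong_left) (use x0 y0 in \<open>auto simp: active_def\<close>)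
  also have "\<dots> = A $$ (pick (Ps ! m) a, pick (Ps ! n) b)"
  proof -
    have "dim_row A = N" using A by simp
    then have "A = mat N N (\<lambda>(i,j). \<Sum>k<K. \<phi> k $ i * \<phi> k $ j)"
      using dec by (simp add: decomposes_def)
    then have "A $$ (r,r') = (\<Sum>k<K. \<phi> k $ r * \<phi> k $ r')" if "r < N" "r' < N" for r r'
      using that by (metis (no_types, lifting) index_mat(1) split_conv)
    then show ?thesis using pick_patch[OF m(1) a] pick_patch[OF m(2) b] by (simp add: x_def y_def)
  qed
  also have "\<dots> = blk A Ps m n $$ (a,b)"
    using index_blk[OF m A a b] by simp
  finally show "blk A Ps m n $$ (a,b) = ?R $$ (a,b)" ..
qed (use blk_carrier[OF m A] in \<open>auto simp: local_modes_def\<close>)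

lemma matching_self: "matching K \<phi> m m = 1\<^sub>m (card (active K \<phi> m))"
  using pick_bij[OF finite_active, of K \<phi> m]
  by (intro eq_matI) (auto simp: matching_def bij_betw_def inj_on_def)

lemma blk_local_modes_self:
  assumes "A \<in> carrier_mat N N" "decomposes A K \<phi>" "m < M"
  shows "blk A Ps m m = local_modes K \<phi> m * transpose_mat (local_modes K \<phi> m)"
  unfolding blk_local_modes[OF assms assms(3)] matching_self
  using local_modes_carrier[of K \<phi> m] by simp

lemma matching_gram:
  "matching K \<phi> m n * transpose_mat (matching K \<phi> m n) =
    mat_diag (card (active K \<phi> m)) (\<lambda>i. if pick (active K \<phi> m) i \<in> active K \<phi> n then 1 else 0)"
    (is "?L = ?R")
proof (rule eq_matI)
  let ?Sm = "active K \<phi> m" and ?Sn = "active K \<phi> n"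
  fix i j assume "i < dim_row ?R" "j < dim_col ?R"
  then have ij: "i < card ?Sm" "j < card ?Sm" by auto
  have "?L $$ (i,j) = (\<Sum>l<card ?Sn. (if pick ?Sm i = pick ?Sn l then 1 else 0) * (if pick ?Sm j = pick ?Sn l then 1 else 0))"
    using ij by (simp add: matching_def scalar_prod_def lessThan_atLeast0)
  also have "\<dots> = (\<Sum>k\<in>?Sn. (if pick ?Sm i = k then 1 else 0) * (if pick ?Sm j = k then 1 else 0))"
    by (rule sum_pick) simp
  also have "\<dots> = (\<Sum>k\<in>?Sn. if pick ?Sm i = k then (if pick ?Sm j = pick ?Sm i then 1 else 0) else 0)"
    by (intro sum.cong) auto
  also have "\<dots> = (if pick ?Sm i \<in> ?Sn then (if pick ?Sm j = pick ?Sm i then 1 else 0) else 0)"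
    by (simp add: sum.delta)
  also have "\<dots> = ?R $$ (i,j)"
    using ij pick_bij[OF finite_active, of K \<phi> m] by (auto simp: mat_diag_def bij_betw_def inj_on_def)
  finally show "?L $$ (i,j) = ?R $$ (i,j)" .
qed (auto simp: matching_def)

text \<open>Double counting of pairs of a mode and a patch. It turns the sparsity objective into a
  sum of patch-wise counts, each of which can be compared with a local rank.\<close>

lemma sum_patch_support:
  "(\<Sum>k<K. card (patch_support Ps (\<phi> k))) = (\<Sum>m<M. card (active K \<phi> m))"
proof -
  let ?z = "\<lambda>P k. restr P (\<phi> k) \<noteq> 0\<^sub>v (card P)"
  have "(\<Sum>k<K. card (patch_support Ps (\<phi> k))) = (\<Sum>k<K. \<Sum>P\<in>set Ps. if ?z P k then 1 else 0)"
    by (intro sum.cong refl) (simp add: patch_support_def sum.If_cases Int_def)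
  also have "\<dots> = (\<Sum>P\<in>set Ps. \<Sum>k<K. if ?z P k then 1 else 0)" by (rule sum.swap)
  also have "\<dots> = (\<Sum>m<M. \<Sum>k<K. if ?z (Ps ! m) k then 1 else 0)" by (rule sum_patches)
  also have "\<dots> = (\<Sum>m<M. card (active K \<phi> m))"
    by (intro sum.cong refl) (simp add: active_def sum.If_cases Int_def)
  finally show ?thesis .
qed

lemma full_col_rank_local_modes:
  assumes "lin_indep_family (card (Ps ! m)) (active K \<phi> m) (\<lambda>k. restr (Ps ! m) (\<phi> k))"
  shows "full_col_rank (local_modes K \<phi> m)"
  unfolding full_col_rank_def
proof (intro ballI impI)
  let ?S = "active K \<phi> m" and ?B = "local_modes K \<phi> m"
  have dB: "dim_row ?B = card (Ps ! m)" "dim_col ?B = card ?S" using local_modes_carrier[of K \<phi> m] by auto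
  fix x assume x: "x \<in> carrier_vec (dim_col ?B)" and 0: "?B *\<^sub>v x = 0\<^sub>v (dim_row ?B)"
  \<comment> \<open>Counting the smaller elements inverts \<open>pick ?S\<close>, so
    \<open>c\<close> indexes by modes what \<open>x\<close> indexes by local columns.\<close>
  define c where "c k = x $ card {l \<in> ?S. l < k}" for k
  have c: "c (pick ?S i) = x $ i" if "i < card ?S" for i
    using card_pick[of i ?S] that by (simp add: c_def)
  have "(\<Sum>k\<in>?S. c k * restr (Ps ! m) (\<phi> k) $ a) = 0" if a: "a < card (Ps ! m)" for a
  proof -
    have "(\<Sum>k\<in>?S. c k * restr (Ps ! m) (\<phi> k) $ a) = (\<Sum>i<card ?S. c (pick ?S i) * restr (Ps ! m) (\<phi> (pick ?S i)) $ a)"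
      by (rule sum_pick[symmetric]) simp
    also have "\<dots> = (?B *\<^sub>v x) $ a"
      using a x dB c by (auto simp: scalar_prod_def lessThan_atLeast0 local_modes_def restr_def mult.commute intro!: sum.cong)
    also have "\<dots> = 0" unfolding 0 using a dB by simp
    finally show ?thesis .
  qed
  then have c0: "\<forall>k\<in>?S. c k = 0" using assms unfolding lin_indep_family_def by blast
  have "x $ i = 0" if "i < card ?S" for i
    using c[OF that] c0 pick_in_set[of i ?S] that by auto
  then show "x = 0\<^sub>v (dim_col ?B)" using x dB by (intro eq_vecI) auto
qed

end

lemma eig_factor_props:
  assumes red: "reduced_eigen_decomp B \<gamma> h" and B: "B \<in> carrier_mat n n"
  defines "k \<equiv> mrank B"
  defines "H \<equiv> eig_factor k \<gamma> h"
  shows "H \<in> carrier_mat n k" "full_col_rank H" "H * transpose_mat H = B"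
    "transpose_mat H * H = mat_diag k (\<lambda>i. \<gamma> $ i)"
    "pinv H = mat_diag k (\<lambda>i. 1 / \<gamma> $ i) * transpose_mat H"
proof -
  have h: "h \<in> carrier_mat n k" and hh: "transpose_mat h * h = 1\<^sub>m k"
    and \<gamma>: "\<And>i. i < k \<Longrightarrow> \<gamma> $ i > 0" and B_eq: "B = h * mat_diag k (\<lambda>i. \<gamma> $ i) * transpose_mat h"
    using red B by (auto simp: reduced_eigen_decomp_def orthonormal_cols_def k_def)
  have H_eq: "H = h * mat_diag k (\<lambda>i. sqrt (\<gamma> $ i))"
    by (subst mat_diag_mult_right[of _ n]) (use h in \<open>auto simp: H_def eig_factor_def intro!: eq_matI\<close>)
  have d: "dim_row h = n" "dim_col h = k" using h by auto
  show HC: "H \<in> carrier_mat n k" using h by (simp add: H_def eig_factor_def)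
  have dH: "dim_row H = n" "dim_col H = k" using HC by auto
  have diag_t: "transpose_mat (mat_diag k f) = mat_diag k f" for f :: "nat \<Rightarrow> real"
    by (intro eq_matI) (auto simp: mat_diag_def)
  have sq: "mat_diag k (\<lambda>i. sqrt (\<gamma> $ i)) * mat_diag k (\<lambda>i. sqrt (\<gamma> $ i)) = mat_diag k (\<lambda>i. \<gamma> $ i)"
    unfolding mat_diag_diag using \<gamma> by (auto simp: mat_diag_def less_imp_le intro!: eq_matI)
  have "H * transpose_mat H = h * (mat_diag k (\<lambda>i. sqrt (\<gamma> $ i)) * mat_diag k (\<lambda>i. sqrt (\<gamma> $ i))) * transpose_mat h"
    by (simp add: H_eq transpose_mult_dim mult_assoc_dim d diag_t del: mat_diag_diag)
  then show "H * transpose_mat H = B" unfolding sq B_eq .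
  have "transpose_mat h * (h * mat_diag k (\<lambda>i. sqrt (\<gamma> $ i))) = mat_diag k (\<lambda>i. sqrt (\<gamma> $ i))"
    by (intro mult_inv_cancel) (simp_all add: hh d)
  then show HH: "transpose_mat H * H = mat_diag k (\<lambda>i. \<gamma> $ i)"
    by (simp add: H_eq transpose_mult_dim mult_assoc_dim d diag_t sq del: mat_diag_diag)
  let ?P = "mat_diag k (\<lambda>i. 1 / \<gamma> $ i) * transpose_mat H"
  have PC: "?P \<in> carrier_mat k n" using dH by (intro carrier_matI) simp_all
  have "?P * H = mat_diag k (\<lambda>i. 1 / \<gamma> $ i) * mat_diag k (\<lambda>i. \<gamma> $ i)"
    by (simp add: mult_assoc_dim dH HH del: mat_diag_diag)
  also have "\<dots> = 1\<^sub>m k" unfolding mat_diag_diag using less_imp_neq[OF \<gamma>, symmetric] by (auto simp: mat_diag_def intro!: eq_matI)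
  finally have PH: "?P * H = 1\<^sub>m k" .
  show "full_col_rank H" by (rule full_col_rankI_left_inverse[OF HC PC PH])
  show "pinv H = ?P"
    by (rule pinv_eqI[OF HC PC PH]) (simp add: transpose_mult_dim mult_assoc_dim dH diag_t)
qed

subsection \<open>Exact runs\<close>

text \<open>The consequences of regular sparsity and minimality through which the modes are used
  from here on. No run is among the parameters, so bounds built from these modes hold uniformly over
  all runs.\<close>

locale identifiable_modes = patches +
  fixes A :: "real mat" and \<psi> :: "nat \<Rightarrow> real vec"
  assumes A: "A \<in> carrier_mat N N"
    and dec: "decomposes A (mrank A) \<psi>"
    and ident: "pairwise_identifiable Ps (mrank A) \<psi>"
    and card_active: "\<And>m. m < M \<Longrightarrow> card (active (mrank A) \<psi> m) = loc_rank A Ps m"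
    and fcr_local_modes: "\<And>m. m < M \<Longrightarrow> full_col_rank (local_modes (mrank A) \<psi> m)"

lemma (in patches) ismd_H_props:
  assumes A: "A \<in> carrier_mat N N" and run: "ismd_run A Ps \<gamma> h D" and m: "m < M"
  shows "ismd_H A Ps \<gamma> h m \<in> carrier_mat (card (Ps ! m)) (loc_rank A Ps m)"
    "full_col_rank (ismd_H A Ps \<gamma> h m)"
    "ismd_H A Ps \<gamma> h m * transpose_mat (ismd_H A Ps \<gamma> h m) = blk A Ps m m"
    "transpose_mat (ismd_H A Ps \<gamma> h m) * ismd_H A Ps \<gamma> h m = mat_diag (loc_rank A Ps m) (\<lambda>i. \<gamma> m $ i)"
    "pinv (ismd_H A Ps \<gamma> h m) =
      mat_diag (loc_rank A Ps m) (\<lambda>i. 1 / \<gamma> m $ i) * transpose_mat (ismd_H A Ps \<gamma> h m)"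
    "\<And>i. i < loc_rank A Ps m \<Longrightarrow> \<gamma> m $ i > 0"
proof -
  have red: "reduced_eigen_decomp (blk A Ps m m) (\<gamma> m) (h m)" using run m by (simp add: ismd_run_def)
  note * = eig_factor_props[OF red blk_carrier[OF m m A], folded loc_rank_def, folded ismd_H_def]
  show "ismd_H A Ps \<gamma> h m \<in> carrier_mat (card (Ps ! m)) (loc_rank A Ps m)" by (fact *(1))
  show "full_col_rank (ismd_H A Ps \<gamma> h m)" by (fact *(2))
  show "ismd_H A Ps \<gamma> h m * transpose_mat (ismd_H A Ps \<gamma> h m) = blk A Ps m m" by (fact *(3))
  show "transpose_mat (ismd_H A Ps \<gamma> h m) * ismd_H A Ps \<gamma> h m = mat_diag (loc_rank A Ps m) (\<lambda>i. \<gamma> m $ i)"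
    by (fact *(4))
  show "pinv (ismd_H A Ps \<gamma> h m) =
      mat_diag (loc_rank A Ps m) (\<lambda>i. 1 / \<gamma> m $ i) * transpose_mat (ismd_H A Ps \<gamma> h m)"
    by (fact *(5))
  show "\<gamma> m $ i > 0" if "i < loc_rank A Ps m" for i
    using red that by (simp add: reduced_eigen_decomp_def loc_rank_def)
qed

text \<open>
  Any decomposition has at least \<open>loc_rank A Ps m\<close> active modes on patch \<open>m\<close>, and a regular-sparse
  one has exactly that many. Hence the intrinsic sparse modes, being minimizers of the total number
  of active modes, attain the bound on every patch.
\<close>

lemma (in patches) identifiable_modesI:
  assumes A: "A \<in> carrier_mat N N" and reg: "regular_sparse A Ps"
    and ism: "intrinsic_sparse_modes A Ps \<psi>" and ident: "pairwise_identifiable Ps (mrank A) \<psi>"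
    and run: "ismd_run A Ps \<gamma> h D"
  shows "identifiable_modes N Ps A \<psi>"
proof -
  let ?K = "mrank A"
  have dec: "decomposes A ?K \<psi>" using ism by (simp add: intrinsic_sparse_modes_def)
  obtain g where g: "decomposes A ?K g" and indep: "\<And>P. P \<in> set Ps \<Longrightarrow> lin_indep_family (card P)
      {k. k < ?K \<and> restr P (g k) \<noteq> 0\<^sub>v (card P)} (\<lambda>k. restr P (g k))"
    using reg by (auto simp: regular_sparse_def)
  note H = ismd_H_props[OF A run]
  have lower: "loc_rank A Ps m \<le> card (active ?K \<psi> m)" if m: "m < M" for m
    using gram_factor(4)[OF H(1,2)[OF m] local_modes_carrier]
      H(3)[OF m] blk_local_modes_self[OF A dec m] by metis
  \<comment> \<open>The factorization lemma with the roles exchanged: here the local modes have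
    trivial kernel and the factor \<open>ismd_H\<close> is the one compared with them.\<close>
  have upper: "card (active ?K g m) \<le> loc_rank A Ps m" if m: "m < M" for m
  proof -
    have "lin_indep_family (card (Ps ! m)) (active ?K g m) (\<lambda>k. restr (Ps ! m) (g k))"
      using indep[of "Ps ! m"] m by (simp add: active_def)
    then have "full_col_rank (local_modes ?K g m)" by (rule full_col_rank_local_modes)
    then show ?thesis
      using gram_factor(4)[OF local_modes_carrier _ H(1)[OF m]] H(3)[OF m] blk_local_modes_self[OF A g m] by metis
  qed
  have "(\<Sum>m<M. card (active ?K \<psi> m)) \<le> (\<Sum>m<M. card (active ?K g m))"
    using ism g unfolding intrinsic_sparse_modes_def sum_patch_support by blast
  also have "\<dots> \<le> (\<Sum>m<M. loc_rank A Ps m)" using upper by (intro sum_mono) simp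
  finally have "(\<Sum>m<M. loc_rank A Ps m) = (\<Sum>m<M. card (active ?K \<psi> m))"
    using sum_mono[of "{..<M}" "loc_rank A Ps" "\<lambda>m. card (active ?K \<psi> m)"] lower by simp
  then have card_eq: "loc_rank A Ps m = card (active ?K \<psi> m)" if "m < M" for m
    using sum_mono_inv[of "loc_rank A Ps" "{..<M}" "\<lambda>m. card (active ?K \<psi> m)" m] lower that by simp
  \<comment> \<open>With equal numbers of columns, the modes are the eigenvector factor times an
    orthogonal matrix, and so inherit its trivial kernel.\<close>
  have "full_col_rank (local_modes ?K \<psi> m)" if m: "m < M" for m
  proof -
    have eq: "ismd_H A Ps \<gamma> h m * transpose_mat (ismd_H A Ps \<gamma> h m) =
        local_modes ?K \<psi> m * transpose_mat (local_modes ?K \<psi> m)"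
      using H(3)[OF m] blk_local_modes_self[OF A dec m] by simp
    note gf = gram_factor[OF H(1,2)[OF m] local_modes_carrier eq]
    show ?thesis
      using pinv_mult_orth(1)[OF H(1,2)[OF m] gf(5)[OF card_eq[OF m]]] unfolding gf(3) .
  qed
  then show ?thesis by unfold_locales (auto simp: A dec ident card_eq)
qed

context identifiable_modes
begin

abbreviation ks :: "nat \<Rightarrow> nat" where "ks \<equiv> loc_rank A Ps"
abbreviation B :: "nat \<Rightarrow> real mat" where "B \<equiv> local_modes (mrank A) \<psi>"
abbreviation Pi :: "nat \<Rightarrow> nat \<Rightarrow> real mat" where "Pi \<equiv> matching (mrank A) \<psi>"

definition \<sigma> :: "nat \<Rightarrow> nat \<Rightarrow> nat \<Rightarrow> real" where
  "\<sigma> m n i = (if pick (active (mrank A) \<psi> m) i \<in> active (mrank A) \<psi> n then 1 else 0)"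

lemma B_carrier: "m < M \<Longrightarrow> B m \<in> carrier_mat (card (Ps ! m)) (ks m)"
  using local_modes_carrier[of "mrank A" \<psi> m] card_active by simp

lemma pinv_B_carrier: "m < M \<Longrightarrow> pinv (B m) \<in> carrier_mat (ks m) (card (Ps ! m))"
  by (rule pinv_full_col_rank(1)[OF B_carrier fcr_local_modes])

lemma Pi_carrier: "m < M \<Longrightarrow> n < M \<Longrightarrow> Pi m n \<in> carrier_mat (ks m) (ks n)"
  using matching_carrier[of "mrank A" \<psi> m n] card_active by simp

lemma Pi_entries: "i < ks m \<Longrightarrow> j < ks n \<Longrightarrow> m < M \<Longrightarrow> n < M \<Longrightarrow> Pi m n $$ (i,j) \<in> {-1,0,1}"
  by (simp add: matching_def card_active)

lemma ks_le_card: "m < M \<Longrightarrow> ks m \<le> card (Ps ! m)"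
  by (rule full_col_rank_dim_le[OF B_carrier fcr_local_modes])

lemma ks_le: "m < M \<Longrightarrow> ks m \<le> N"
  using ks_le_card[of m] card_patch_le[of m] by linarith

lemma frob_norm_Pi_le:
  assumes "m < M" "n < M"
  shows "frob_norm (Pi m n) \<le> real N"
  using frob_norm_le_entries[of "Pi m n" 1 N] Pi_carrier[OF assms] ks_le assms
  by (force simp: matching_def card_active)

lemma Pi_gram:
  assumes "m < M" "n < M"
  shows "Pi m n * transpose_mat (Pi m n) = mat_diag (ks m) (\<sigma> m n)"
  unfolding matching_gram \<sigma>_def[abs_def] card_active[OF assms(1)] ..

text \<open>This is where identifiability enters: modes with different patch supports differ in
  activity on some patch.\<close>

lemma \<sigma>_separates:
  assumes m: "m < M" and ij: "i < ks m" "j < ks m" "i \<noteq> j"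
  shows "\<exists>n<M. \<sigma> m n i \<noteq> \<sigma> m n j"
proof -
  let ?S = "active (mrank A) \<psi>"
  let ?k = "pick (?S m) i" and ?l = "pick (?S m) j"
  have k: "?k \<in> ?S m" "?l \<in> ?S m"
    using pick_in_set[of i "?S m"] pick_in_set[of j "?S m"] ij card_active[OF m] by auto
  have "?k \<noteq> ?l"
    using pick_bij[of "?S m"] ij card_active[OF m] by (auto simp: bij_betw_def inj_on_def)
  then have "patch_support Ps (\<psi> ?k) \<noteq> patch_support Ps (\<psi> ?l)"
    using ident k by (auto simp: pairwise_identifiable_def active_def)
  then obtain n where n: "n < M" "(restr (Ps ! n) (\<psi> ?k) \<noteq> 0\<^sub>v (card (Ps ! n))) \<noteq> (restr (Ps ! n) (\<psi> ?l) \<noteq> 0\<^sub>v (card (Ps ! n)))"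
    by (auto simp: patch_support_def in_set_conv_nth)
  have "?k < mrank A" "?l < mrank A" using k by (auto simp: active_def)
  then have "(?k \<in> ?S n) \<noteq> (?l \<in> ?S n)" using n(2) by (simp add: active_def)
  then show ?thesis using n(1) by (auto simp: \<sigma>_def)
qed

lemma pinv_B_blk:
  assumes m: "m < M" "n < M"
  shows "pinv (B m) * blk A Ps m n * transpose_mat (pinv (B n)) = Pi m n"
proof -
  note P = pinv_full_col_rank[OF B_carrier fcr_local_modes]
  have d: "dim_row (B m) = card (Ps ! m)" "dim_col (B m) = ks m" "dim_row (B n) = card (Ps ! n)" "dim_col (B n) = ks n"
    "dim_row (Pi m n) = ks m" "dim_col (Pi m n) = ks n"
    "dim_row (pinv (B m)) = ks m" "dim_col (pinv (B m)) = card (Ps ! m)"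
    "dim_row (pinv (B n)) = ks n" "dim_col (pinv (B n)) = card (Ps ! n)"
    using B_carrier[OF m(1)] B_carrier[OF m(2)] Pi_carrier[OF m] P(1)[OF m(1)] P(1)[OF m(2)] m by auto
  have 1: "transpose_mat (B n) * transpose_mat (pinv (B n)) = 1\<^sub>m (ks n)"
    using arg_cong[OF P(2)[OF m(2) m(2)], of transpose_mat] by (simp add: transpose_mult_dim d)
  have 2: "pinv (B m) * (B m * Pi m n) = Pi m n"
    by (intro mult_inv_cancel) (simp_all add: P(2)[OF m(1) m(1)] d)
  show ?thesis
    unfolding blk_local_modes[OF A dec m]
    using Pi_carrier[OF m] by (simp add: mult_assoc_dim d 1 2)
qed

text \<open>Common core of both kinds of runs. For an exact run \<open>X\<close> is
  \<open>B\<close>, \<open>C\<close> is \<open>A\<close> and \<open>\<eta>\<close> is 0; for a noisy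
  run \<open>X\<close> is \<open>(I + \<epsilon> E) * B\<close> and \<open>C\<close> the noisy
  matrix. Since \<open>H n = X n * Q n\<close> with \<open>Q n\<close> orthogonal,
  \<open>Q n\<close> cancels in \<open>Sig C Ps H m n\<close>, and only a conjugation by
  \<open>Q m\<close> remains.\<close>

lemma joint_diagonalizer_local:
  assumes m: "m < M"
    and X: "\<And>n. n < M \<Longrightarrow> X n \<in> carrier_mat (card (Ps ! n)) (ks n)" "\<And>n. n < M \<Longrightarrow> full_col_rank (X n)"
    and H: "\<And>n. n < M \<Longrightarrow> H n \<in> carrier_mat (card (Ps ! n)) (ks n)"
      "\<And>n. n < M \<Longrightarrow> H n * transpose_mat (H n) = X n * transpose_mat (X n)"
    and C: "C \<in> carrier_mat N N"
    and near: "\<And>n. n < M \<Longrightarrow>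
      frob_norm (pinv (X m) * blk C Ps m n * transpose_mat (pinv (X n)) - Pi m n) \<le> \<eta>"
    and D: "joint_diagonalizer M (ks m) (Sig C Ps H m) D"
    and \<eta>: "0 \<le> \<eta>" "\<eta> \<le> 1" "8 * (real N)\<^sup>2 * ((real M + 1) * ((2 * real N + 1) * \<eta>)) \<le> 1"
  shows "\<exists>W J. orth_mat (ks m) W \<and> signed_perm_mat (ks m) J \<and> H m * D = X m * W \<and>
    frob_norm (W - J) \<le> 4 * (real N)\<^sup>2 * ((real M + 1) * ((2 * real N + 1) * \<eta>))"
proof -
  define Q where "Q n = pinv (X n) * H n" for n
  have XQ: "X n * Q n = H n" and Q: "orth_mat (ks n) (Q n)" if "n < M" for n
    using gram_factor[OF X[OF that] H(1)[OF that] H(2)[OF that, symmetric]] by (simp_all add: Q_def)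
  note PX = pinv_full_col_rank[OF X]
  have Do: "orth_mat (ks m) D" using D by (simp add: joint_diagonalizer_def)
  define Y where "Y n = pinv (X m) * blk C Ps m n * transpose_mat (pinv (X n))" for n
  have YC: "Y n \<in> carrier_mat (ks m) (ks n)" if n: "n < M" for n
    using PX(1)[OF m m] PX(1)[OF n n] blk_carrier[OF m n C] by (auto simp: Y_def)
  have pinvH: "pinv (H n) = transpose_mat (Q n) * pinv (X n)" if n: "n < M" for n
    using pinv_mult_orth(2)[OF X[OF n] Q[OF n]] XQ[OF n] by simp
  have S_eq: "Sig C Ps H m n = transpose_mat (Q m) * (Y n * transpose_mat (Y n)) * Q m" if n: "n < M" for n
  proof -
    note Qm = orth_matD[OF Q[OF m]] and Qn = orth_matD[OF Q[OF n]]
    have d: "dim_row (Q m) = ks m" "dim_col (Q m) = ks m" "dim_row (Q n) = ks n" "dim_col (Q n) = ks n"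
      "dim_row (pinv (X m)) = ks m" "dim_col (pinv (X m)) = card (Ps ! m)"
      "dim_row (pinv (X n)) = ks n" "dim_col (pinv (X n)) = card (Ps ! n)"
      "dim_row (blk C Ps m n) = card (Ps ! m)" "dim_col (blk C Ps m n) = card (Ps ! n)"
      "dim_row (Y n) = ks m" "dim_col (Y n) = ks n"
      using Qm(1) Qn(1) PX(1)[OF m m] PX(1)[OF n n] blk_carrier[OF m n C] YC[OF n] by auto
    have L: "Lam C Ps H m n = transpose_mat (Q m) * Y n * Q n"
      by (simp add: Lam_def pinvH[OF m] pinvH[OF n] Y_def transpose_mult_dim mult_assoc_dim d)
    have "Q n * (transpose_mat (Q n) * Z) = Z" if "dim_row Z = ks n" for Z
      using that by (intro mult_inv_cancel) (simp_all add: Qn(3) d)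
    then show ?thesis
      unfolding Sig_def L by (simp add: transpose_mult_dim mult_assoc_dim d)
  qed
  have T_near: "frob_norm (Y n * transpose_mat (Y n) - mat_diag (ks m) (\<sigma> m n)) \<le> (2 * real N + 1) * \<eta>"
    if n: "n < M" for n
  proof -
    let ?E = "Y n - Pi m n"
    note Pi = Pi_carrier[OF m n]
    have E: "?E \<in> carrier_mat (ks m) (ks n)" using Pi by (intro minus_carrier_mat)
    have En: "frob_norm ?E \<le> \<eta>" using near[OF n] by (simp add: Y_def)
    \<comment> \<open>Here \<open>\<eta> \<le> 1\<close> is used. Splitting the difference of the
      two products then costs \<open>\<eta> (N + 1)\<close> and \<open>N \<eta>\<close>, the origin
      of \<open>2 N + 1\<close>.\<close>
    have Yn: "frob_norm (Y n) \<le> real N + 1"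
    proof -
      have "Y n = Pi m n + ?E" using Pi YC[OF n] by (intro eq_matI) auto
      then have "frob_norm (Y n) \<le> frob_norm (Pi m n) + frob_norm ?E"
        using frob_norm_triangle[OF Pi E] by simp
      then show ?thesis using frob_norm_Pi_le[OF m n] En \<eta>(2) by linarith
    qed
    have d: "dim_row (Y n) = ks m" "dim_col (Y n) = ks n" "dim_row (Pi m n) = ks m" "dim_col (Pi m n) = ks n"
      using YC[OF n] Pi by auto
    have "Y n * transpose_mat (Y n) - Pi m n * transpose_mat (Pi m n) =
        ?E * transpose_mat (Y n) + Pi m n * transpose_mat ?E"
      by (simp add: minus_mult_dim mult_minus_dim transpose_minus_dim d)
         (intro eq_matI, simp_all add: d del: index_mult_mat(1))
    then have "frob_norm (Y n * transpose_mat (Y n) - Pi m n * transpose_mat (Pi m n)) \<le>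
        frob_norm (?E * transpose_mat (Y n)) + frob_norm (Pi m n * transpose_mat ?E)"
      using frob_norm_triangle[of "?E * transpose_mat (Y n)" "ks m" "ks m" "Pi m n * transpose_mat ?E"] E YC[OF n] Pi
      by auto
    also have "frob_norm (?E * transpose_mat (Y n)) \<le> \<eta> * (real N + 1)"
      using E YC[OF n] En Yn by (intro frob_norm_mult_le[of _ "ks m" "ks n"]) auto
    also have "frob_norm (Pi m n * transpose_mat ?E) \<le> real N * \<eta>"
      using E Pi En frob_norm_Pi_le[OF m n] by (intro frob_norm_mult_le[of _ "ks m" "ks n"]) auto
    finally show ?thesis unfolding Pi_gram[OF m n] by (simp add: algebra_simps)
  qed
  let ?\<eta> = "(real M + 1) * ((2 * real N + 1) * \<eta>)"
  have \<eta>0: "0 \<le> ?\<eta>" using \<eta>(1) by simp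
  \<comment> \<open>Passing from the local rank to \<open>N\<close> makes the final bound
    independent of the patch.\<close>
  have ksN: "(real (ks m))\<^sup>2 \<le> (real N)\<^sup>2" using ks_le[OF m] by (intro power_mono) auto
  have sm: "8 * (real (ks m))\<^sup>2 * ?\<eta> \<le> 1"
    using \<eta>(3) mult_right_mono[OF ksN \<eta>0] by linarith
  have "\<exists>J. signed_perm_mat (ks m) J \<and> frob_norm (Q m * D - J) \<le> 4 * (real (ks m))\<^sup>2 * ?\<eta>"
  proof (rule joint_diagonalizer_near_signed_perm[OF D Q[OF m] S_eq _ _ _ T_near])
    show "Y n * transpose_mat (Y n) \<in> carrier_mat (ks m) (ks m)" if "n < M" for n
      using YC[OF that] by auto
    show "\<sigma> m n i \<in> {0,1}" for n i by (simp add: \<sigma>_def)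
  qed (use \<sigma>_separates[OF m] \<eta>(1) sm in auto)
  then obtain J where J: "signed_perm_mat (ks m) J" "frob_norm (Q m * D - J) \<le> 4 * (real (ks m))\<^sup>2 * ?\<eta>"
    by blast
  have "H m * D = X m * (Q m * D)"
    using X(1)[OF m] orth_matD(1)[OF Q[OF m]] orth_matD(1)[OF Do]
    by (simp add: XQ[OF m, symmetric] mult_assoc_dim)
  moreover have "frob_norm (Q m * D - J) \<le> 4 * (real N)\<^sup>2 * ?\<eta>"
    using J(2) mult_right_mono[OF ksN \<eta>0] by linarith
  ultimately show ?thesis using J(1) orth_mat_mult[OF Q[OF m] Do] by blast
qed

end

lemma frob_norm_zero_imp_eq:
  assumes "A \<in> carrier_mat n m" "C \<in> carrier_mat n m" "frob_norm (A - C) \<le> 0"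
  shows "A = C"
proof (rule eq_matI)
  fix i j assume ij: "i < dim_row C" "j < dim_col C"
  have "\<bar>(A - C) $$ (i,j)\<bar> \<le> frob_norm (A - C)"
    using ij by (intro entry_le_frob_norm) auto
  then show "A $$ (i,j) = C $$ (i,j)" using assms(3) ij by simp
qed (use assms in auto)

section \<open>Positive semidefinite blocks and truncated eigendecompositions\<close>

context patches
begin

text \<open>Extending \<open>w\<close> by zero outside the patch turns the quadratic form of the
  block into that of the whole matrix.\<close>

lemma blk_psd:
  assumes psd: "sym_psd N C" and m: "m < M" and w: "w \<in> carrier_vec (card (Ps ! m))"
  shows "0 \<le> w \<bullet> (blk C Ps m m *\<^sub>v w)"
proof -
  have C: "C \<in> carrier_mat N N" using psd by (simp add: sym_psd_def)
  let ?P = "Ps ! m"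
  have fin: "finite ?P" by (rule finite_patch[OF m])
  define v where "v = vec N (\<lambda>r. if r \<in> ?P then w $ card {x \<in> ?P. x < r} else 0)"
  have v: "v \<in> carrier_vec N" by (simp add: v_def)
  have sumP: "(\<Sum>r<N. v $ r * f r) = (\<Sum>a<card ?P. w $ a * f (pick ?P a))" for f
  proof -
    have "(\<Sum>r<N. v $ r * f r) = (\<Sum>r\<in>?P. w $ card {x \<in> ?P. x < r} * f r)"
      by (rule sum.mono_neutral_cong_right) (use patch_subset[OF m] in \<open>auto simp: v_def\<close>)
    also have "\<dots> = (\<Sum>a<card ?P. w $ card {x \<in> ?P. x < pick ?P a} * f (pick ?P a))"
      by (rule sum_pick[symmetric, OF fin])
    also have "\<dots> = (\<Sum>a<card ?P. w $ a * f (pick ?P a))"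
      using pick_patch(3)[OF m] by (intro sum.cong refl) simp
    finally show ?thesis .
  qed
  have "0 \<le> v \<bullet> (C *\<^sub>v v)" using psd v by (simp add: sym_psd_def)
  also have "v \<bullet> (C *\<^sub>v v) = (\<Sum>r<N. v $ r * (\<Sum>r'<N. v $ r' * C $$ (r,r')))"
    using C v by (auto simp: scalar_prod_def lessThan_atLeast0 mult.commute intro!: sum.cong)
  also have "\<dots> = (\<Sum>a<card ?P. w $ a * (\<Sum>b<card ?P. w $ b * C $$ (pick ?P a, pick ?P b)))"
    unfolding sumP ..
  also have "\<dots> = (\<Sum>a<card ?P. w $ a * (\<Sum>b<card ?P. w $ b * blk C Ps m m $$ (a,b)))"
    by (intro sum.cong refl) (simp add: index_blk[OF m m C])
  also have "\<dots> = w \<bullet> (blk C Ps m m *\<^sub>v w)"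
    using w blk_carrier[OF m m C] by (auto simp: scalar_prod_def lessThan_atLeast0 mult.commute intro!: sum.cong)
  finally show ?thesis .
qed

end

lemma sorted_eigen_decomp_nonneg:
  assumes dec: "sorted_eigen_decomp B \<gamma> h" and B: "B \<in> carrier_mat n n"
    and psd: "\<And>w. w \<in> carrier_vec n \<Longrightarrow> 0 \<le> w \<bullet> (B *\<^sub>v w)" and l: "l < n"
  shows "0 \<le> \<gamma> $ l"
proof -
  have h: "orth_mat n h" and B_eq: "B = h * mat_diag n (\<lambda>i. \<gamma> $ i) * transpose_mat h"
    using dec B by (auto simp: sorted_eigen_decomp_def)
  note hD = orth_matD[OF h]
  have d: "dim_row h = n" "dim_col h = n" using hD(1) by auto
  have "transpose_mat h * (h * (mat_diag n (\<lambda>i. \<gamma> $ i) * transpose_mat h * h)) =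
      mat_diag n (\<lambda>i. \<gamma> $ i) * (transpose_mat h * h)"
    by (subst mult_inv_cancel) (simp_all add: hD(2) d mult_assoc_dim)
  then have "transpose_mat h * (B * h) = mat_diag n (\<lambda>i. \<gamma> $ i)"
    using hD(2) by (simp add: B_eq mult_assoc_dim d)
  then have "\<gamma> $ l = (transpose_mat h * (B * h)) $$ (l,l)" using l by (simp add: mat_diag_def)
  also have "\<dots> = col h l \<bullet> (B *\<^sub>v col h l)"
  proof -
    have "col (B * h) l = B *\<^sub>v col h l" using B d l by (intro eq_vecI) auto
    then show ?thesis using B d l by simp
  qed
  also have "\<dots> \<ge> 0" using psd[of "col h l"] d by (simp add: carrier_vecI)
  finally show ?thesis .
qed

text \<open>Nonnegativity matters because \<open>sqrt x * sqrt x\<close> is the absolute value of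
  \<open>x\<close> for every real \<open>x\<close>. It is supplied by the semidefiniteness of the
  noisy matrix.\<close>

lemma truncated_eig_factor:
  assumes "\<And>l. l < k \<Longrightarrow> 0 \<le> \<gamma> $ l"
  shows "truncated k \<gamma> h = eig_factor k \<gamma> h * transpose_mat (eig_factor k \<gamma> h)"
proof (rule eq_matI)
  fix i j assume "i < dim_row (eig_factor k \<gamma> h * transpose_mat (eig_factor k \<gamma> h))"
    "j < dim_col (eig_factor k \<gamma> h * transpose_mat (eig_factor k \<gamma> h))"
  then have ij: "i < dim_row h" "j < dim_row h" by (auto simp: eig_factor_def)
  have "(eig_factor k \<gamma> h * transpose_mat (eig_factor k \<gamma> h)) $$ (i,j) =
      (\<Sum>l<k. (sqrt (\<gamma> $ l) * h $$ (i,l)) * (sqrt (\<gamma> $ l) * h $$ (j,l)))"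
    using ij by (simp add: eig_factor_def scalar_prod_def lessThan_atLeast0)
  also have "\<dots> = (\<Sum>l<k. (sqrt (\<gamma> $ l) * sqrt (\<gamma> $ l)) * h $$ (i,l) * h $$ (j,l))"
    by (intro sum.cong refl) (simp only: mult_ac)
  also have "\<dots> = truncated k \<gamma> h $$ (i,j)"
    using ij assms by (simp add: truncated_def)
  finally show "truncated k \<gamma> h $$ (i,j) = (eig_factor k \<gamma> h * transpose_mat (eig_factor k \<gamma> h)) $$ (i,j)" ..
qed (auto simp: truncated_def eig_factor_def)

section \<open>Local pieces and \<open>Omega\<close> of an exact run\<close>

context identifiable_modes
begin

lemma ismd_G_eq:
  assumes run: "ismd_run A Ps \<gamma> h D" and m: "m < M"
  shows "\<exists>J. signed_perm_mat (ks m) J \<and> ismd_G A Ps \<gamma> h D m = B m * J"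
proof -
  note H = ismd_H_props[OF A run]
  have "joint_diagonalizer M (ks m) (Sig A Ps (ismd_H A Ps \<gamma> h) m) (D m)"
    using run m by (simp add: ismd_run_def)
  moreover have "ismd_H A Ps \<gamma> h n * transpose_mat (ismd_H A Ps \<gamma> h n) = B n * transpose_mat (B n)" if "n < M" for n
    using H(3)[OF that] blk_local_modes_self[OF A dec that] by simp
  moreover have "frob_norm (pinv (B m) * blk A Ps m n * transpose_mat (pinv (B n)) - Pi m n) \<le> 0" if "n < M" for n
    unfolding pinv_B_blk[OF m that] by (simp add: frob_norm_def)
  ultimately obtain W J where WJ: "orth_mat (ks m) W" "signed_perm_mat (ks m) J"
      "ismd_H A Ps \<gamma> h m * D m = B m * W" "frob_norm (W - J) \<le> 0"
    using joint_diagonalizer_local[OF m B_carrier fcr_local_modes H(1) _ A, where \<eta> = 0] by fastforce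
  have "W = J"
    using frob_norm_zero_imp_eq[OF orth_matD(1)[OF WJ(1)] orth_matD(1)[OF orth_mat_signed_perm[OF WJ(2)]] WJ(4)] .
  then show ?thesis using WJ by (auto simp: ismd_G_def)
qed

text \<open>All four facts come from \<open>ismd_G_eq\<close>. The third replaces a quantity that
  depends on the run by one that depends only on the modes, which makes smallness conditions
  uniform.\<close>

lemma ismd_G_props:
  assumes run: "ismd_run A Ps \<gamma> h D" and m: "m < M"
  shows "ismd_G A Ps \<gamma> h D m \<in> carrier_mat (card (Ps ! m)) (ks m)"
    "full_col_rank (ismd_G A Ps \<gamma> h D m)"
    "frob_norm (pinv (ismd_G A Ps \<gamma> h D m)) = frob_norm (pinv (B m))"
    "ismd_G A Ps \<gamma> h D m * transpose_mat (ismd_G A Ps \<gamma> h D m) = blk A Ps m m"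
proof -
  obtain J where J: "signed_perm_mat (ks m) J" "ismd_G A Ps \<gamma> h D m = B m * J"
    using ismd_G_eq[OF run m] by blast
  note Jo = orth_mat_signed_perm[OF J(1)]
  note JD = orth_matD[OF Jo]
  show "ismd_G A Ps \<gamma> h D m \<in> carrier_mat (card (Ps ! m)) (ks m)"
    unfolding J(2) using B_carrier[OF m] JD(1) by auto
  show "full_col_rank (ismd_G A Ps \<gamma> h D m)"
    unfolding J(2) by (rule pinv_mult_orth(1)[OF B_carrier[OF m] fcr_local_modes[OF m] Jo])
  show "frob_norm (pinv (ismd_G A Ps \<gamma> h D m)) = frob_norm (pinv (B m))"
    unfolding J(2) by (rule frob_norm_pinv_mult_orth[OF B_carrier[OF m] fcr_local_modes[OF m] Jo])
  have d: "dim_row J = ks m" "dim_col J = ks m" "dim_col (B m) = ks m" using JD(1) B_carrier[OF m] by auto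
  have "J * (transpose_mat J * transpose_mat (B m)) = transpose_mat (B m)"
    by (intro mult_inv_cancel) (simp_all add: JD(3) d)
  then show "ismd_G A Ps \<gamma> h D m * transpose_mat (ismd_G A Ps \<gamma> h D m) = blk A Ps m m"
    unfolding J(2) blk_local_modes_self[OF A dec m] by (simp add: transpose_mult_dim mult_assoc_dim d)
qed

text \<open>The squared norm is the trace of the diagonal block of \<open>A\<close>, at most
  \<open>N\<close> times the spectral norm of \<open>A\<close>. The bound
  \<open>1 + spec_norm A\<close> stands in for a square root.\<close>

lemma frob_norm_ismd_G_le:
  assumes run: "ismd_run A Ps \<gamma> h D" and m: "m < M"
  shows "frob_norm (ismd_G A Ps \<gamma> h D m) \<le> real N * (1 + spec_norm A)"
proof (rule power2_le_imp_le)
  let ?G = "ismd_G A Ps \<gamma> h D m"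
  note G = ismd_G_props[OF run m]
  have d: "dim_row ?G = card (Ps ! m)" using G(1) by auto
  have "(frob_norm ?G)\<^sup>2 = (frob_norm (transpose_mat ?G))\<^sup>2" by simp
  also have "\<dots> = (\<Sum>a<card (Ps ! m). blk A Ps m m $$ (a,a))"
    unfolding frob_norm_sq_gram using G(4) d by simp
  also have "\<dots> \<le> (\<Sum>a<card (Ps ! m). spec_norm A)"
  proof (intro sum_mono)
    fix a assume a: "a \<in> {..<card (Ps ! m)}"
    then have "\<bar>A $$ (pick (Ps ! m) a, pick (Ps ! m) a)\<bar> \<le> spec_norm A"
      using pick_patch[OF m] A by (intro entry_le_spec_norm) auto
    then show "blk A Ps m m $$ (a,a) \<le> spec_norm A" using a by (simp add: index_blk[OF m m A])
  qed
  also have "\<dots> \<le> real N * spec_norm A"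
    using card_patch_le[OF m] by (simp add: mult_right_mono)
  also have "\<dots> \<le> (real N * real N) * (1 + spec_norm A)"
    by (intro mult_mono) (auto simp: le_square of_nat_mult[symmetric] simp del: of_nat_mult)
  also have "\<dots> \<le> (real N * real N) * ((1 + spec_norm A) * (1 + spec_norm A))"
    by (intro mult_left_mono) (auto simp: mult_le_cancel_left1 add_nonneg_nonneg)
  finally show "(frob_norm ?G)\<^sup>2 \<le> (real N * (1 + spec_norm A))\<^sup>2"
    by (simp add: power2_eq_square mult_ac)
qed (simp add: add_nonneg_nonneg)

text \<open>The orthogonal factors \<open>D m\<close> can be moved into the pseudo-inverses. This
  brings \<open>Omega\<close> into the block form by which the noisy version is defined, so that the
  two can be compared block by block.\<close>

lemma ismd_Omega_eq:
  assumes run: "ismd_run A Ps \<gamma> h D"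
  shows "ismd_Omega A Ps \<gamma> h D = block_mat ks M (Lam A Ps (ismd_G A Ps \<gamma> h D))"
proof -
  let ?H = "ismd_H A Ps \<gamma> h" and ?G = "ismd_G A Ps \<gamma> h D"
  note H = ismd_H_props[OF A run]
  have D: "orth_mat (ks m) (D m)" if "m < M" for m
    using run that by (simp add: ismd_run_def joint_diagonalizer_def)
  have LC: "Lam A Ps ?H m n \<in> carrier_mat (ks m) (ks n)" if m: "m < M" "n < M" for m n
    using pinv_full_col_rank(1)[OF H(1,2)[OF m(1)]] pinv_full_col_rank(1)[OF H(1,2)[OF m(2)]] blk_carrier[OF m A]
    by (auto simp: Lam_def)
  have "ismd_Omega A Ps \<gamma> h D = block_mat ks M (\<lambda>m n. transpose_mat (D m) * Lam A Ps ?H m n * D n)"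
    unfolding ismd_Omega_def Let_def by (rule block_mat_conj_diag) (fact LC, fact orth_matD(1)[OF D])
  also have "\<dots> = block_mat ks M (Lam A Ps ?G)"
  proof (rule block_mat_cong)
    fix m n assume m: "m < M" "n < M"
    note Pm = pinv_full_col_rank(1)[OF H(1,2)[OF m(1)]] and Pn = pinv_full_col_rank(1)[OF H(1,2)[OF m(2)]]
    have "pinv (?G m) = transpose_mat (D m) * pinv (?H m)" "pinv (?G n) = transpose_mat (D n) * pinv (?H n)"
      unfolding ismd_G_def using pinv_mult_orth(2)[OF H(1,2) D] m by auto
    then show "transpose_mat (D m) * Lam A Ps ?H m n * D n = Lam A Ps ?G m n"
      using Pm Pn blk_carrier[OF m A] orth_matD(1)[OF D[OF m(1)]] orth_matD(1)[OF D[OF m(2)]]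
      by (simp add: Lam_def transpose_mult_dim mult_assoc_dim)
  qed
  finally show ?thesis .
qed

text \<open>The block is \<open>transpose_mat J * Pi m n * J'\<close> with signed permutations
  \<open>J\<close> and \<open>J'\<close>, which only move entries and change their signs. The right
  factor is treated like the left one after transposition.\<close>

lemma Lam_ismd_G_entries:
  assumes run: "ismd_run A Ps \<gamma> h D" and m: "m < M" "n < M" and ij: "i < ks m" "j < ks n"
  shows "Lam A Ps (ismd_G A Ps \<gamma> h D) m n $$ (i,j) \<in> {-1,0,1}"
proof -
  let ?G = "ismd_G A Ps \<gamma> h D"
  obtain J where J: "signed_perm_mat (ks m) J" "?G m = B m * J" using ismd_G_eq[OF run m(1)] by blast
  obtain J' where J': "signed_perm_mat (ks n) J'" "?G n = B n * J'" using ismd_G_eq[OF run m(2)] by blast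
  note Jo = orth_mat_signed_perm[OF J(1)] and Jo' = orth_mat_signed_perm[OF J'(1)]
  note JC = orth_matD(1)[OF Jo] and JC' = orth_matD(1)[OF Jo']
  note P = pinv_B_carrier[OF m(1)] pinv_B_carrier[OF m(2)] and Pi = Pi_carrier[OF m]
  have "pinv (?G m) = transpose_mat J * pinv (B m)" "pinv (?G n) = transpose_mat J' * pinv (B n)"
    unfolding J(2) J'(2)
    using pinv_mult_orth(2)[OF B_carrier fcr_local_modes] Jo Jo' m by auto
  then have "Lam A Ps ?G m n = transpose_mat J * (pinv (B m) * blk A Ps m n * transpose_mat (pinv (B n))) * J'"
    using P JC JC' blk_carrier[OF m A] by (simp add: Lam_def transpose_mult_dim mult_assoc_dim)
  also have "\<dots> = transpose_mat (transpose_mat J' * transpose_mat (transpose_mat J * Pi m n))"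
    unfolding pinv_B_blk[OF m] using JC JC' Pi by (simp add: transpose_mult_dim)
  finally have eq: "Lam A Ps ?G m n = \<dots>" .
  have 1: "(transpose_mat J * Pi m n) $$ (i,j) \<in> {-1,0,1}" if "i < ks m" "j < ks n" for i j
    by (rule signed_perm_transpose_mult_entries[OF J(1) Pi Pi_entries]) (use that m in auto)
  have JPi: "transpose_mat J * Pi m n \<in> carrier_mat (ks m) (ks n)" using JC Pi by auto
  have "(transpose_mat J' * transpose_mat (transpose_mat J * Pi m n)) $$ (j,i) \<in> {-1,0,1}"
  proof (rule signed_perm_transpose_mult_entries[OF J'(1)])
    show "transpose_mat (transpose_mat J * Pi m n) \<in> carrier_mat (ks n) (ks m)" using JPi by simp
    show "transpose_mat (transpose_mat J * Pi m n) $$ (a,b) \<in> {-1,0,1}" if "a < ks n" "b < ks m" for a b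
    proof -
      have "transpose_mat (transpose_mat J * Pi m n) $$ (a,b) = (transpose_mat J * Pi m n) $$ (b,a)"
        using that JPi by (intro index_transpose_mat(1)) auto
      then show ?thesis using 1[of b a] that by (simp only:)
    qed
  qed (use ij in auto)
  then show ?thesis unfolding eq using ij JC JC' Pi by (simp del: index_mult_mat(1))
qed

lemma elements_ismd_Omega:
  assumes run: "ismd_run A Ps \<gamma> h D"
  shows "elements_mat (ismd_Omega A Ps \<gamma> h D) \<subseteq> {-1,0,1}"
proof
  fix x assume "x \<in> elements_mat (ismd_Omega A Ps \<gamma> h D)"
  then obtain i j where ij: "i < blk_offset ks M" "j < blk_offset ks M"
      and x: "x = block_mat ks M (Lam A Ps (ismd_G A Ps \<gamma> h D)) $$ (i,j)"
    unfolding ismd_Omega_eq[OF run] by (auto simp: elements_mat_def)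
  obtain m p where mp: "m < M" "p < ks m" "i = blk_offset ks m + p" using ij(1) by (rule blk_index_cases)
  obtain n q where nq: "n < M" "q < ks n" "j = blk_offset ks n + q" using ij(2) by (rule blk_index_cases)
  show "x \<in> {-1,0,1}"
    using Lam_ismd_G_entries[OF run mp(1) nq(1) mp(2) nq(2)] mp nq x by (simp add: index_block_mat)
qed

text \<open>The Gram matrix of \<open>?G m\<close> is the diagonal matrix of the
  \<open>\<gamma> m $ i\<close> conjugated by \<open>D m\<close>, so their roots are singular
  values. The squared norm of the pseudo-inverse is the sum of the inverses of these
  \<open>\<gamma> m $ i\<close>. A positive local rank makes the set of singular values nonempty, so
  that \<open>Min\<close> is one of them.\<close>

lemma min_singular_value_bound:
  assumes run: "ismd_run A Ps \<gamma> h D" and m: "m < M" and pos: "0 < ks m"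
  shows "0 < min_singular_value Ps (ismd_G A Ps \<gamma> h D)"
    "frob_norm (pinv (ismd_G A Ps \<gamma> h D m)) \<le> real N / min_singular_value Ps (ismd_G A Ps \<gamma> h D)"
proof -
  let ?G = "ismd_G A Ps \<gamma> h D" and ?H = "ismd_H A Ps \<gamma> h"
  let ?\<sigma> = "min_singular_value Ps ?G"
  let ?U = "\<Union>n<M. singular_values (?G n)"
  note H = ismd_H_props[OF A run m]
  have D: "orth_mat (ks m) (D m)" using run m by (simp add: ismd_run_def joint_diagonalizer_def)
  note DD = orth_matD[OF D]
  have eig_pos: "0 < x" if n: "n < M" and x: "eigenvalue (transpose_mat (?G n) * ?G n) x" for n x
  proof -
    note G = ismd_G_props[OF run n]
    obtain v where v: "v \<in> carrier_vec (ks n)" "v \<noteq> 0\<^sub>v (ks n)" "(transpose_mat (?G n) * ?G n) *\<^sub>v v = x \<cdot>\<^sub>v v"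
      using x G(1) by (auto simp: eigenvalue_def eigenvector_def)
    have Gv: "?G n *\<^sub>v v \<in> carrier_vec (card (Ps ! n))" using G(1) v(1) by auto
    have "(?G n *\<^sub>v v) \<bullet> (?G n *\<^sub>v v) = (transpose_mat (?G n) *\<^sub>v (?G n *\<^sub>v v)) \<bullet> v"
      by (rule transpose_vec_mult_scalar[symmetric, OF G(1) v(1) Gv])
    also have "transpose_mat (?G n) *\<^sub>v (?G n *\<^sub>v v) = x \<cdot>\<^sub>v v"
      unfolding v(3)[symmetric] using G(1) v(1) by (intro assoc_mult_mat_vec[symmetric]) auto
    also have "(x \<cdot>\<^sub>v v) \<bullet> v = x * (v \<bullet> v)" using v(1) by simp
    finally have eq: "(?G n *\<^sub>v v) \<bullet> (?G n *\<^sub>v v) = x * (v \<bullet> v)" .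
    have "?G n *\<^sub>v v \<noteq> 0\<^sub>v (card (Ps ! n))" using G(1,2) v(1,2) by (auto simp: full_col_rank_def)
    then have "0 < (?G n *\<^sub>v v) \<bullet> (?G n *\<^sub>v v)"
      using scalar_prod_self_eq_0[OF Gv] scalar_prod_self_nonneg[of "?G n *\<^sub>v v"] by linarith
    then have "0 < x * (v \<bullet> v)" unfolding eq .
    then show "0 < x" using scalar_prod_self_nonneg[of v] by (simp add: zero_less_mult_iff)
  qed
  have fin: "finite ?U"
  proof (intro finite_UN_I)
    fix n assume "n \<in> {..<M}"
    then have C: "transpose_mat (?G n) * ?G n \<in> carrier_mat (ks n) (ks n)" using ismd_G_props(1)[OF run, of n] by auto
    have "finite {x. eigenvalue (transpose_mat (?G n) * ?G n) x}"
      unfolding eigenvalue_root_char_poly[OF C]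
      using degree_monic_char_poly[OF C] by (intro poly_roots_finite) auto
    then show "finite (singular_values (?G n))" by (simp add: singular_values_def setcompr_eq_image)
  qed simp
  have mem: "sqrt (\<gamma> m $ i) \<in> ?U" if i: "i < ks m" for i
  proof -
    have d: "dim_row (D m) = ks m" "dim_col (D m) = ks m" "dim_row (?H m) = card (Ps ! m)" "dim_col (?H m) = ks m"
      using DD(1) H(1) by auto
    \<comment> \<open>The eigenvector for \<open>\<gamma> m $ i\<close>: the \<open>i\<close>-th
      unit vector in the coordinates rotated by \<open>D m\<close>.\<close>
    let ?v = "transpose_mat (D m) *\<^sub>v unit_vec (ks m) i"
    have v: "?v \<in> carrier_vec (ks m)" using DD(1) by auto
    have Dv: "D m *\<^sub>v ?v = unit_vec (ks m) i"
      using DD(1) assoc_mult_mat_vec[of "D m" "ks m" "ks m" "transpose_mat (D m)" "ks m" "unit_vec (ks m) i"]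
      by (simp add: DD(3))
    have nz: "?v \<noteq> 0\<^sub>v (ks m)"
    proof
      assume "?v = 0\<^sub>v (ks m)"
      moreover have "D m *\<^sub>v 0\<^sub>v (ks m) = 0\<^sub>v (ks m)"
        by (intro eq_vecI) (auto simp: d intro!: scalar_prod_right_zero carrier_vecI)
      ultimately have "unit_vec (ks m) i = (0\<^sub>v (ks m) :: real vec)" using Dv by metis
      then show False using i by (simp add: unit_vec_nonzero)
    qed
    have gram: "transpose_mat (?G m) * ?G m = transpose_mat (D m) * (mat_diag (ks m) (\<lambda>i. \<gamma> m $ i) * D m)"
      unfolding ismd_G_def H(4)[symmetric] by (simp add: transpose_mult_dim mult_assoc_dim d)
    have diagDC: "mat_diag (ks m) (\<lambda>i. \<gamma> m $ i) * D m \<in> carrier_mat (ks m) (ks m)"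
      by (rule mult_carrier_mat[OF mat_diag_dim DD(1)])
    have "(transpose_mat (?G m) * ?G m) *\<^sub>v ?v = transpose_mat (D m) *\<^sub>v ((mat_diag (ks m) (\<lambda>i. \<gamma> m $ i) * D m) *\<^sub>v ?v)"
      unfolding gram using DD(1) diagDC v by (intro assoc_mult_mat_vec) auto
    also have "(mat_diag (ks m) (\<lambda>i. \<gamma> m $ i) * D m) *\<^sub>v ?v = mat_diag (ks m) (\<lambda>i. \<gamma> m $ i) *\<^sub>v unit_vec (ks m) i"
      using assoc_mult_mat_vec[OF mat_diag_dim DD(1) v] unfolding Dv .
    also have "\<dots> = \<gamma> m $ i \<cdot>\<^sub>v unit_vec (ks m) i"
      using i by (intro eq_vecI) (auto simp: mat_diag_def)
    also have "transpose_mat (D m) *\<^sub>v (\<gamma> m $ i \<cdot>\<^sub>v unit_vec (ks m) i) = \<gamma> m $ i \<cdot>\<^sub>v ?v"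
      using DD(1) by (intro mult_mat_vec) auto
    finally have "eigenvalue (transpose_mat (?G m) * ?G m) (\<gamma> m $ i)"
      using v nz ismd_G_props(1)[OF run m] unfolding eigenvalue_def eigenvector_def by auto
    then show ?thesis using m by (auto simp: singular_values_def)
  qed
  have "?\<sigma> \<in> ?U"
    unfolding min_singular_value_def using fin mem[OF pos] by (intro Min_in) auto
  then show \<sigma>_pos: "0 < ?\<sigma>" using eig_pos by (auto simp: singular_values_def)
  have \<sigma>_le: "?\<sigma> \<le> sqrt (\<gamma> m $ i)" if "i < ks m" for i
    unfolding min_singular_value_def using fin mem[OF that] by (rule Min_le)
  have "(frob_norm (pinv (?H m)))\<^sup>2 = (\<Sum>i<ks m. 1 / \<gamma> m $ i)"
  proof -
    have d: "dim_row (?H m) = card (Ps ! m)" "dim_col (?H m) = ks m" using H(1) by auto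
    have diag_t: "transpose_mat (mat_diag k f) = mat_diag k f" for k and f :: "nat \<Rightarrow> real"
      by (intro eq_matI) (auto simp: mat_diag_def)
    let ?E = "mat_diag (ks m) (\<lambda>i. 1 / \<gamma> m $ i)"
    have "(frob_norm (pinv (?H m)))\<^sup>2 = (frob_norm (transpose_mat (pinv (?H m))))\<^sup>2" by simp
    also have "\<dots> = (\<Sum>i<ks m. (pinv (?H m) * transpose_mat (pinv (?H m))) $$ (i,i))"
      unfolding frob_norm_sq_gram using H(5) d by simp
    also have "pinv (?H m) * transpose_mat (pinv (?H m)) = ?E * (transpose_mat (?H m) * ?H m * ?E)"
      unfolding H(5) by (simp add: transpose_mult_dim mult_assoc_dim d diag_t)
    also have "\<dots> = mat_diag (ks m) (\<lambda>i. 1 / \<gamma> m $ i)"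
      unfolding H(4) mat_diag_diag using less_imp_neq[OF H(6), symmetric] by (auto simp: mat_diag_def intro!: eq_matI)
    finally show ?thesis by (simp add: mat_diag_def)
  qed
  also have "\<dots> \<le> (\<Sum>i<ks m. 1 / ?\<sigma>\<^sup>2)"
  proof (intro sum_mono)
    fix i assume "i \<in> {..<ks m}"
    then have i: "i < ks m" by simp
    have "?\<sigma>\<^sup>2 \<le> \<gamma> m $ i"
      using power_mono[OF \<sigma>_le[OF i], of 2] \<sigma>_pos H(6)[OF i] by simp
    then show "1 / \<gamma> m $ i \<le> 1 / ?\<sigma>\<^sup>2" using \<sigma>_pos by (intro divide_left_mono) (auto intro!: mult_pos_pos H(6) i)
  qed
  also have "\<dots> = real (ks m) * (1 / ?\<sigma>\<^sup>2)" by simp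
  \<comment> \<open>Coarsened to a perfect square, so that the root is rational in
    \<open>N\<close>.\<close>
  also have "\<dots> \<le> (real N * real N) * (1 / ?\<sigma>\<^sup>2)"
  proof (rule mult_right_mono)
    have "ks m \<le> N * N" using ks_le[OF m] le_square[of N] by linarith
    then show "real (ks m) \<le> real N * real N" by (metis of_nat_le_iff of_nat_mult)
  qed simp
  also have "\<dots> = (real N / ?\<sigma>)\<^sup>2" by (simp add: power2_eq_square)
  finally have "frob_norm (pinv (?H m)) \<le> real N / ?\<sigma>"
    by (rule power2_le_imp_le) (use \<sigma>_pos in simp)
  moreover have "frob_norm (pinv (?G m)) = frob_norm (pinv (?H m))"
    unfolding ismd_G_def by (rule frob_norm_pinv_mult_orth[OF H(1,2) D])
  ultimately show "frob_norm (pinv (?G m)) \<le> real N / ?\<sigma>" by simp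
qed

end

subsection \<open>Noisy runs\<close>

lemma pinv_const_nonneg: "0 \<le> pinv_const N"
  by (simp add: pinv_const_def)

lemma block_const_nonneg: "0 \<le> s \<Longrightarrow> 0 \<le> d \<Longrightarrow> 0 \<le> a \<Longrightarrow> 0 \<le> block_const N s d a"
  by (simp add: block_const_def pinv_const_nonneg)

lemma block_const_mono:
  assumes "0 \<le> s" "s \<le> s'" "0 \<le> d" "0 \<le> a"
  shows "block_const N s d a \<le> block_const N s' d a"
proof -
  have s2: "s\<^sup>2 \<le> s'\<^sup>2" using assms by (intro power_mono) auto
  show ?thesis
    unfolding block_const_def using assms s2 pinv_const_nonneg[of N]
    by (intro add_mono mult_mono mult_nonneg_nonneg order_refl) auto
qed

text \<open>One threshold of the form \<open>1 / (1 + x + y + z)\<close> secures all smallness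
  conditions on \<open>\<epsilon>\<close> at once, without minima and without division by constants
  that may vanish.\<close>

lemma small_scaled_le_1:
  fixes \<epsilon> x y z :: real
  assumes "0 < \<epsilon>" "\<epsilon> < 1 / (1 + x + y + z)" "0 \<le> x" "0 \<le> y" "0 \<le> z"
  shows "\<epsilon> \<le> 1" "\<epsilon> * x \<le> 1" "\<epsilon> * y \<le> 1" "\<epsilon> * z \<le> 1"
proof -
  have "\<epsilon> * (1 + x + y + z) < 1" using assms by (simp add: pos_less_divide_eq)
  then have *: "\<epsilon> + \<epsilon> * x + \<epsilon> * y + \<epsilon> * z < 1" by (simp add: algebra_simps)
  have "0 \<le> \<epsilon> * x" "0 \<le> \<epsilon> * y" "0 \<le> \<epsilon> * z" using assms by auto
  then show "\<epsilon> \<le> 1" "\<epsilon> * x \<le> 1" "\<epsilon> * y \<le> 1" "\<epsilon> * z \<le> 1" using * assms(1) by linarith+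
qed

text \<open>The bound of \<open>two_sided_perturbation\<close> divided by \<open>\<epsilon>\<close>.
  The norm of \<open>E m\<close> is at most \<open>N \<bar>Ceig\<bar>\<close>, that of the local
  piece at most \<open>N (1 + a)\<close>, and the right factor contributes at most
  \<open>N + 2\<close> once \<open>\<epsilon> \<bar>Cjd\<bar>\<close> and the remainder are each
  below 1. The last \<open>+ 1\<close> is the remainder, bounded by
  \<open>\<epsilon>\<close>.\<close>

definition local_const :: "nat \<Rightarrow> real \<Rightarrow> real \<Rightarrow> real \<Rightarrow> real" where
  "local_const N a Ceig Cjd =
     real N * \<bar>Ceig\<bar> * (real N * (1 + a)) * (real N + 2) + real N * (1 + a) * (\<bar>Cjd\<bar> + 1)"

text \<open>
  The absolute value keeps the constant nonnegative when all local ranks are 0 and the minimum over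
  the empty set of singular values is unspecified.
\<close>

definition omega_const :: "nat \<Rightarrow> real \<Rightarrow> real \<Rightarrow> real \<Rightarrow> real \<Rightarrow> real" where
  "omega_const N a \<sigma> Ceig Cjd =
     real N * block_const N (real N / \<bar>\<sigma>\<bar>) (local_const N a Ceig Cjd) (real N * a)"

text \<open>The first \<open>N\<close> comes from assembling the local pieces, the last one is the
  bound for the norm of \<open>P * L\<close>.\<close>

definition output_const :: "nat \<Rightarrow> real \<Rightarrow> real \<Rightarrow> real \<Rightarrow> real" where
  "output_const N a Ceig Cjd = real N * local_const N a Ceig Cjd * real N"

lemma local_const_nonneg: "0 \<le> a \<Longrightarrow> 0 \<le> local_const N a Ceig Cjd"
  by (simp add: local_const_def)

context identifiable_modes
begin

text \<open>The fourth fact is the bridge to the modes: the truncated block factors both through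
  \<open>ismd_H\<close> and through the perturbed modes, so \<open>gram_factor\<close> can compare
  the two.\<close>

lemma noisy_run_props:
  assumes noisy: "noisy_run N A Ps Ceig \<epsilon> At E \<gamma> h D" and \<epsilon>: "0 < \<epsilon>" and m: "m < M"
  shows "E m \<in> carrier_mat (card (Ps ! m)) (card (Ps ! m))"
    "frob_norm (E m) \<le> real N * \<bar>Ceig\<bar>"
    "ismd_H A Ps \<gamma> h m \<in> carrier_mat (card (Ps ! m)) (ks m)"
    "ismd_H A Ps \<gamma> h m * transpose_mat (ismd_H A Ps \<gamma> h m) =
      ((1\<^sub>m (card (Ps ! m)) + \<epsilon> \<cdot>\<^sub>m E m) * B m) * transpose_mat ((1\<^sub>m (card (Ps ! m)) + \<epsilon> \<cdot>\<^sub>m E m) * B m)"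
    "A + \<epsilon> \<cdot>\<^sub>m At \<in> carrier_mat N N"
    "joint_diagonalizer M (ks m) (Sig (A + \<epsilon> \<cdot>\<^sub>m At) Ps (ismd_H A Ps \<gamma> h) m) (D m)"
    "\<And>n. n < M \<Longrightarrow> frob_norm (blk (A + \<epsilon> \<cdot>\<^sub>m At) Ps m n - blk A Ps m n) \<le> \<epsilon> * real N"
proof -
  let ?Ah = "A + \<epsilon> \<cdot>\<^sub>m At" and ?I = "1\<^sub>m (card (Ps ! m)) :: real mat"
  have At: "At \<in> carrier_mat N N" "spec_norm At \<le> 1" and psd: "sym_psd N ?Ah"
    using noisy by (auto simp: noisy_run_def)
  have eig: "eig_perturbation A Ps Ceig \<epsilon> \<gamma> h E" using noisy by (simp add: noisy_run_def)
  show E: "E m \<in> carrier_mat (card (Ps ! m)) (card (Ps ! m))"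
    using eig m by (simp add: eig_perturbation_def)
  have "spec_norm (E m) \<le> \<bar>Ceig\<bar>" using eig m unfolding eig_perturbation_def by fastforce
  then have "real N * spec_norm (E m) \<le> real N * \<bar>Ceig\<bar>" by (intro mult_left_mono) auto
  then show "frob_norm (E m) \<le> real N * \<bar>Ceig\<bar>"
    using frob_norm_le_spec_norm[of "E m" N] E card_patch_le[OF m] by auto
  show Ah: "?Ah \<in> carrier_mat N N" using A At by auto
  have run: "sorted_eigen_decomp (blk ?Ah Ps m m) (\<gamma> m) (h m)"
    and jd: "joint_diagonalizer M (ks m) (Sig ?Ah Ps (ismd_H A Ps \<gamma> h) m) (D m)"
    using noisy m by (auto simp: noisy_run_def thresholded_ismd_run_def)
  show "joint_diagonalizer M (ks m) (Sig ?Ah Ps (ismd_H A Ps \<gamma> h) m) (D m)" by (fact jd)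
  have "h m \<in> carrier_mat (card (Ps ! m)) (card (Ps ! m))"
    using run blk_carrier[OF m m Ah] by (auto simp: sorted_eigen_decomp_def orth_mat_def)
  then show "ismd_H A Ps \<gamma> h m \<in> carrier_mat (card (Ps ! m)) (ks m)"
    by (simp add: ismd_H_def eig_factor_def)
  have "0 \<le> \<gamma> m $ l" if "l < ks m" for l
    using sorted_eigen_decomp_nonneg[OF run blk_carrier[OF m m Ah] blk_psd[OF psd m]] ks_le_card[OF m] that by simp
  then have "ismd_H A Ps \<gamma> h m * transpose_mat (ismd_H A Ps \<gamma> h m) = truncated (ks m) (\<gamma> m) (h m)"
    unfolding ismd_H_def by (rule truncated_eig_factor[symmetric])
  also have "\<dots> = (?I + \<epsilon> \<cdot>\<^sub>m E m) * blk A Ps m m * (?I + \<epsilon> \<cdot>\<^sub>m transpose_mat (E m))"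
    using eig m unfolding eig_perturbation_def by blast
  also have "?I + \<epsilon> \<cdot>\<^sub>m transpose_mat (E m) = transpose_mat (?I + \<epsilon> \<cdot>\<^sub>m E m)"
    using E by (intro eq_matI) auto
  also have "(?I + \<epsilon> \<cdot>\<^sub>m E m) * blk A Ps m m * \<dots> =
      ((?I + \<epsilon> \<cdot>\<^sub>m E m) * B m) * transpose_mat ((?I + \<epsilon> \<cdot>\<^sub>m E m) * B m)"
    unfolding blk_local_modes_self[OF A dec m]
    using carrier_matD[OF E] carrier_matD[OF B_carrier[OF m]] by (simp add: transpose_mult_dim mult_assoc_dim)
  finally show "ismd_H A Ps \<gamma> h m * transpose_mat (ismd_H A Ps \<gamma> h m) =
      ((?I + \<epsilon> \<cdot>\<^sub>m E m) * B m) * transpose_mat ((?I + \<epsilon> \<cdot>\<^sub>m E m) * B m)" .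
  show "frob_norm (blk ?Ah Ps m n - blk A Ps m n) \<le> \<epsilon> * real N" if n: "n < M" for n
  proof -
    have "blk ?Ah Ps m n - blk A Ps m n = \<epsilon> \<cdot>\<^sub>m blk At Ps m n"
    proof (rule eq_matI)
      fix i j assume "i < dim_row (\<epsilon> \<cdot>\<^sub>m blk At Ps m n)" "j < dim_col (\<epsilon> \<cdot>\<^sub>m blk At Ps m n)"
      then have ij: "i < card (Ps ! m)" "j < card (Ps ! n)" using blk_carrier[OF m n At(1)] by auto
      show "(blk ?Ah Ps m n - blk A Ps m n) $$ (i,j) = (\<epsilon> \<cdot>\<^sub>m blk At Ps m n) $$ (i,j)"
        using ij carrier_matD[OF blk_carrier[OF m n A]] carrier_matD[OF blk_carrier[OF m n Ah]]
          carrier_matD[OF blk_carrier[OF m n At(1)]] carrier_matD[OF A] carrier_matD[OF At(1)]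
          pick_patch[OF m ij(1)] pick_patch[OF n ij(2)]
        by (simp add: index_blk[OF m n A] index_blk[OF m n Ah] index_blk[OF m n At(1)])
    qed (use blk_carrier[OF m n A] blk_carrier[OF m n Ah] blk_carrier[OF m n At(1)] in auto)
    then have "frob_norm (blk ?Ah Ps m n - blk A Ps m n) = \<epsilon> * frob_norm (blk At Ps m n)"
      using \<epsilon> by (simp add: frob_norm_smult)
    also have "frob_norm (blk At Ps m n) \<le> real N * 1"
      using frob_norm_blk_le[OF m n At(1)] mult_left_mono[OF At(2), of "real N"] by linarith
    finally show ?thesis using \<epsilon> by simp
  qed
qed

text \<open>The exact piece is \<open>B m * J0\<close> and the noisy one is
  \<open>(I + \<epsilon> E m) * B m * W\<close> with \<open>W\<close> within
  \<open>\<epsilon> c\<close> of a signed permutation \<open>J1\<close>. Inserting \<open>J0\<close>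
  and its transpose yields the claimed form with \<open>J\<close> the product of
  \<open>transpose_mat J0\<close> and \<open>J1\<close>. The whole deviation of \<open>W\<close> is
  put into the linear term, so the remainder is 0.\<close>

lemma jd_perturbation_exists:
  "\<exists>Cjd CR. \<exists>\<epsilon>0 > 0. \<forall>\<gamma> h D \<epsilon> At E \<gamma>' h' D'.
     0 < \<epsilon> \<and> \<epsilon> < \<epsilon>0 \<and> ismd_run A Ps \<gamma> h D \<and> noisy_run N A Ps Ceig \<epsilon> At E \<gamma>' h' D' \<longrightarrow>
     (\<forall>m<M. \<exists>J. signed_perm_mat (ks m) J \<and>
        jd_perturbation Cjd CR \<epsilon> (E m) (ismd_G A Ps \<gamma> h D m) (ismd_G A Ps \<gamma>' h' D' m) J)"
proof -
  \<comment> \<open>Sums over the patches dominate each single term and, unlike maxima, need no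
    separate treatment of an empty list of patches.\<close>
  define s where "s = (\<Sum>m<M. frob_norm (pinv (B m)))"
  define b where "b = (\<Sum>m<M. frob_norm (B m))"
  define d where "d = real N * \<bar>Ceig\<bar> * b"
  define bc where "bc = block_const N s d (real N * spec_norm A)"
  define c where "c = 4 * (real N)\<^sup>2 * ((real M + 1) * ((2 * real N + 1) * bc))"
  \<comment> \<open>The summands secure, in this order, the premise of
    \<open>pinv_perturbation\<close>, the bound \<open>\<eta> \<le> 1\<close> for
    \<open>\<eta> = \<epsilon> bc\<close>, and the last smallness premise of
    \<open>joint_diagonalizer_local\<close>.\<close>
  define \<epsilon>0 where "\<epsilon>0 = 1 / (1 + 2 * (s * d) + bc + 2 * c)"
  have s0: "0 \<le> s" and b0: "0 \<le> b" by (auto simp: s_def b_def intro!: sum_nonneg)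
  have d0: "0 \<le> d" using b0 by (simp add: d_def)
  have bc0: "0 \<le> bc" unfolding bc_def using s0 d0 by (intro block_const_nonneg) auto
  have c0: "0 \<le> c" unfolding c_def using bc0 by auto
  have sB: "frob_norm (pinv (B m)) \<le> s" and bB: "frob_norm (B m) \<le> b" if "m < M" for m
    unfolding s_def b_def using that by (auto intro!: member_le_sum[where f = "\<lambda>m. frob_norm (pinv (B m))"] member_le_sum[where f = "\<lambda>m. frob_norm (B m)"])
  have "\<exists>J. signed_perm_mat (ks m) J \<and>
      jd_perturbation c 0 \<epsilon> (E m) (ismd_G A Ps \<gamma> h D m) (ismd_G A Ps \<gamma>' h' D' m) J"
    if \<epsilon>: "0 < \<epsilon>" "\<epsilon> < \<epsilon>0" and run: "ismd_run A Ps \<gamma> h D"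
      and noisy: "noisy_run N A Ps Ceig \<epsilon> At E \<gamma>' h' D'" and m: "m < M"
    for \<gamma> h D \<epsilon> At E \<gamma>' h' D' m
  proof -
    have eps: "\<epsilon> \<le> 1" "\<epsilon> * (2 * (s * d)) \<le> 1" "\<epsilon> * bc \<le> 1" "\<epsilon> * (2 * c) \<le> 1"
      using small_scaled_le_1[of \<epsilon> "2 * (s * d)" bc "2 * c"] \<epsilon> s0 d0 bc0 c0 by (auto simp: \<epsilon>0_def)
    have sd: "s * (\<epsilon> * d) \<le> 1/2" using eps(2) by (simp add: mult_ac)
    let ?Ah = "A + \<epsilon> \<cdot>\<^sub>m At"
    note noise = noisy_run_props[OF noisy \<epsilon>(1)]
    define X where "X n = (1\<^sub>m (card (Ps ! n)) + \<epsilon> \<cdot>\<^sub>m E n) * B n" for n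
    have XC: "X n \<in> carrier_mat (card (Ps ! n)) (ks n)" if n: "n < M" for n
      unfolding X_def using noise(1)[OF n] B_carrier[OF n] by (intro mult_carrier_mat[of _ _ "card (Ps ! n)"]) auto
    have XB: "frob_norm (X n - B n) \<le> \<epsilon> * d" if n: "n < M" for n
    proof -
      have eq: "X n - B n = \<epsilon> \<cdot>\<^sub>m E n * B n"
        unfolding X_def using carrier_matD[OF noise(1)[OF n]] carrier_matD[OF B_carrier[OF n]]
        by (subst add_mult_dim) (auto intro!: eq_matI simp del: index_mult_mat(1) simp: left_mult_one_mat')
      have "frob_norm (\<epsilon> \<cdot>\<^sub>m E n * B n) \<le> (\<epsilon> * (real N * \<bar>Ceig\<bar>)) * b"
        using noise(1,2)[OF n] B_carrier[OF n] bB[OF n] \<epsilon>(1)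
        by (intro frob_norm_mult_le[of _ "card (Ps ! n)" "card (Ps ! n)"]) (auto simp: frob_norm_smult)
      then show ?thesis unfolding eq d_def by (simp add: mult_ac)
    qed
    have Xfcr: "full_col_rank (X n)" if n: "n < M" for n
      by (rule pinv_perturbation(1)[OF B_carrier[OF n] XC[OF n] fcr_local_modes[OF n] sB[OF n] XB[OF n] sd
            card_patch_le[OF n] ks_le[OF n]])
    have near: "frob_norm (pinv (X m) * blk ?Ah Ps m n * transpose_mat (pinv (X n)) - Pi m n) \<le> \<epsilon> * bc"
      if n: "n < M" for n
      unfolding pinv_B_blk[OF m n, symmetric] bc_def
      by (rule block_perturbation[OF B_carrier[OF m] XC[OF m] fcr_local_modes[OF m] sB[OF m] XB[OF m]
            card_patch_le[OF m] ks_le[OF m] B_carrier[OF n] XC[OF n] fcr_local_modes[OF n] sB[OF n] XB[OF n]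
            card_patch_le[OF n] ks_le[OF n] blk_carrier[OF m n A] blk_carrier[OF m n noise(5)[OF m]]
            frob_norm_blk_le[OF m n A] noise(7)[OF m n] _ eps(1) sd]) (use \<epsilon> in simp)
    have c_eq: "4 * (real N)\<^sup>2 * ((real M + 1) * ((2 * real N + 1) * (\<epsilon> * bc))) = \<epsilon> * c"
      by (simp add: c_def mult_ac)
    have small: "8 * (real N)\<^sup>2 * ((real M + 1) * ((2 * real N + 1) * (\<epsilon> * bc))) \<le> 1"
    proof -
      have "8 * (real N)\<^sup>2 * ((real M + 1) * ((2 * real N + 1) * (\<epsilon> * bc))) =
          2 * (4 * (real N)\<^sup>2 * ((real M + 1) * ((2 * real N + 1) * (\<epsilon> * bc))))" by simp
      also have "\<dots> = 2 * (\<epsilon> * c)" by (simp only: c_eq)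
      finally show ?thesis using eps(4) by linarith
    qed
    obtain W J1 where W: "orth_mat (ks m) W" and J1: "signed_perm_mat (ks m) J1"
        and HD: "ismd_H A Ps \<gamma>' h' m * D' m = X m * W" and WJ: "frob_norm (W - J1) \<le> \<epsilon> * c"
      using joint_diagonalizer_local[OF m XC Xfcr noise(3) noise(4)[folded X_def] noise(5)[OF m] near noise(6)[OF m] _ eps(3) small]
        \<epsilon>(1) bc0 unfolding c_eq by auto
    obtain J0 where J0: "signed_perm_mat (ks m) J0" and G: "ismd_G A Ps \<gamma> h D m = B m * J0"
      using ismd_G_eq[OF run m] by blast
    let ?J = "transpose_mat J0 * J1"
    have J: "signed_perm_mat (ks m) ?J" by (rule signed_perm_transpose_mult[OF J0 J1])
    note Jo = orth_matD[OF orth_mat_signed_perm[OF J]] and J0o = orth_matD[OF orth_mat_signed_perm[OF J0]]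
      and J1o = orth_matD[OF orth_mat_signed_perm[OF J1]] and Wo = orth_matD[OF W]
    have dm: "dim_row J0 = ks m" "dim_col J0 = ks m" "dim_row J1 = ks m" "dim_col J1 = ks m"
      "dim_row W = ks m" "dim_col W = ks m" "dim_row (B m) = card (Ps ! m)" "dim_col (B m) = ks m"
      "dim_row (E m) = card (Ps ! m)" "dim_col (E m) = card (Ps ! m)"
      using J0o(1) J1o(1) Wo(1) B_carrier[OF m] noise(1)[OF m] by auto
    \<comment> \<open>The factor between the exact and the noisy piece once \<open>?J\<close> is
      split off. For \<open>W = J1\<close> it would be the identity, and the orthogonal factors
      leave the norm of the deviation equal to that of \<open>W - J1\<close>.\<close>
    let ?V = "transpose_mat J0 * (W * transpose_mat ?J)"
    let ?F = "(1/\<epsilon>) \<cdot>\<^sub>m (?V - 1\<^sub>m (ks m))"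
    have VC: "?V \<in> carrier_mat (ks m) (ks m)" by (intro carrier_matI) (simp_all add: dm)
    have FC: "?F \<in> carrier_mat (ks m) (ks m)" by (intro carrier_matI) simp_all
    have "?V - 1\<^sub>m (ks m) = transpose_mat J0 * ((W - J1) * transpose_mat ?J)"
    proof -
      have "transpose_mat J0 * (J1 * transpose_mat ?J) = ?J * transpose_mat ?J"
        by (simp add: mult_assoc_dim dm)
      then show ?thesis unfolding Jo(3)
        by (subst minus_mult_dim, simp_all add: dm del: transpose_mult)
           (subst mult_minus_dim, simp_all add: dm del: transpose_mult)
    qed
    moreover have "frob_norm (transpose_mat J0 * ((W - J1) * transpose_mat ?J)) = frob_norm (W - J1)"
    proof -
      have WJC: "W - J1 \<in> carrier_mat (ks m) (ks m)" using J1o(1) by (intro minus_carrier_mat)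
      have "(W - J1) * transpose_mat ?J \<in> carrier_mat (ks m) (ks m)" by (intro carrier_matI) (simp_all add: dm)
      then have "frob_norm (transpose_mat J0 * ((W - J1) * transpose_mat ?J)) = frob_norm ((W - J1) * transpose_mat ?J)"
        by (rule frob_norm_orth_left[OF orth_mat_transpose[OF orth_mat_signed_perm[OF J0]]])
      also have "\<dots> = frob_norm (W - J1)"
        by (rule frob_norm_orth_right[OF orth_mat_transpose[OF orth_mat_signed_perm[OF J]] WJC])
      finally show ?thesis .
    qed
    ultimately have F: "frob_norm ?F \<le> c"
      using WJ \<epsilon>(1) by (simp only: frob_norm_smult) (simp add: field_simps)
    have V: "1\<^sub>m (ks m) + \<epsilon> \<cdot>\<^sub>m ?F + 0\<^sub>m (ks m) (ks m) = ?V"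
      using \<epsilon>(1) by (intro eq_matI) (auto simp: dm simp del: index_mult_mat(1))
    have GV: "(1\<^sub>m (card (Ps ! m)) + \<epsilon> \<cdot>\<^sub>m E m) * (B m * J0) * ?V * ?J = X m * W"
    proof -
      have 1: "J0 * (transpose_mat J0 * Z) = Z" if "dim_row Z = ks m" for Z
        using that by (intro mult_inv_cancel) (simp_all add: J0o(3) dm)
      have "?V * ?J = transpose_mat J0 * W * (transpose_mat ?J * ?J)"
        by (simp add: mult_assoc_dim dm del: transpose_mult)
      also have "\<dots> = transpose_mat J0 * W" unfolding Jo(2) using Wo(1) J0o(1) by simp
      finally have VJ: "?V * ?J = transpose_mat J0 * W" .
      have "(1\<^sub>m (card (Ps ! m)) + \<epsilon> \<cdot>\<^sub>m E m) * (B m * J0) * ?V * ?J =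
          (1\<^sub>m (card (Ps ! m)) + \<epsilon> \<cdot>\<^sub>m E m) * (B m * (J0 * (?V * ?J)))"
        by (simp add: mult_assoc_dim dm del: transpose_mult)
      also have "\<dots> = X m * W" unfolding VJ X_def by (simp add: 1 mult_assoc_dim dm)
      finally show ?thesis .
    qed
    have R: "spec_norm (0\<^sub>m (ks m) (ks m)) \<le> 0 * \<epsilon>\<^sup>2"
      using spec_norm_le_frob_norm[of "0\<^sub>m (ks m) (ks m)"] by (simp add: frob_norm_def)
    have "jd_perturbation c 0 \<epsilon> (E m) (ismd_G A Ps \<gamma> h D m) (ismd_G A Ps \<gamma>' h' D' m) ?J"
      unfolding jd_perturbation_def G ismd_G_def[of A Ps \<gamma>'] HD index_mult_mat(2,3) dm
    proof (rule bexI[of _ ?F], rule bexI[of _ "0\<^sub>m (ks m) (ks m)"], intro conjI)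
      show "X m * W = (1\<^sub>m (card (Ps ! m)) + \<epsilon> \<cdot>\<^sub>m E m) * (B m * J0) *
          (1\<^sub>m (ks m) + \<epsilon> \<cdot>\<^sub>m ?F + 0\<^sub>m (ks m) (ks m)) * ?J"
        unfolding V GV ..
    qed (use F R FC in auto)
    then show ?thesis using J by blast
  qed
  moreover have "0 < \<epsilon>0" using s0 d0 bc0 c0 by (auto simp: \<epsilon>0_def add_pos_nonneg)
  ultimately show ?thesis by blast
qed

end

section \<open>Consequences of the perturbation relation with \<open>J\<close> normalized to the
  identity\<close>

context identifiable_modes
begin

lemma local_piece_perturbation:
  assumes run: "ismd_run A Ps \<gamma> h D" and noisy: "noisy_run N A Ps Ceig \<epsilon> At E \<gamma>' h' D'"
    and jd: "jd_perturbation Cjd CR \<epsilon> (E m) (ismd_G A Ps \<gamma> h D m) (ismd_G A Ps \<gamma>' h' D' m) (1\<^sub>m (ks m))"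
    and \<epsilon>: "0 < \<epsilon>" "\<epsilon> \<le> 1" "\<epsilon> * \<bar>Cjd\<bar> \<le> 1" "\<epsilon> * (real N * \<bar>CR\<bar>) \<le> 1" and m: "m < M"
  shows "ismd_G A Ps \<gamma>' h' D' m \<in> carrier_mat (card (Ps ! m)) (ks m)"
    "frob_norm (ismd_G A Ps \<gamma>' h' D' m - ismd_G A Ps \<gamma> h D m) \<le> \<epsilon> * local_const N (spec_norm A) Ceig Cjd"
proof -
  let ?G = "ismd_G A Ps \<gamma> h D m" and ?a = "spec_norm A"
  let ?n = "card (Ps ! m)" and ?k = "ks m"
  note GC = ismd_G_props(1)[OF run m] and noise = noisy_run_props[OF noisy \<epsilon>(1) m]
  obtain F R where F: "F \<in> carrier_mat ?k ?k" "frob_norm F \<le> Cjd" and R: "R \<in> carrier_mat ?k ?k" "spec_norm R \<le> CR * \<epsilon>\<^sup>2"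
    and eq: "ismd_G A Ps \<gamma>' h' D' m = (1\<^sub>m ?n + \<epsilon> \<cdot>\<^sub>m E m) * ?G * (1\<^sub>m ?k + \<epsilon> \<cdot>\<^sub>m F + R) * 1\<^sub>m ?k"
    using jd carrier_matD[OF GC] unfolding jd_perturbation_def by auto
  let ?Gh = "(1\<^sub>m ?n + \<epsilon> \<cdot>\<^sub>m E m) * ?G * (1\<^sub>m ?k + \<epsilon> \<cdot>\<^sub>m F + R)"
  have GhC: "?Gh \<in> carrier_mat ?n ?k" using noise(1) GC F(1) R(1) by (intro carrier_matI) auto
  then have Gh_eq: "ismd_G A Ps \<gamma>' h' D' m = ?Gh" unfolding eq by (rule right_mult_one_mat)
  show "ismd_G A Ps \<gamma>' h' D' m \<in> carrier_mat ?n ?k" unfolding Gh_eq by (rule GhC)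
  have Fn: "frob_norm F \<le> \<bar>Cjd\<bar>" using F(2) by linarith
  \<comment> \<open>Smallness of \<open>\<epsilon>\<close> relative to \<open>CR\<close> turns the
    quadratic bound into a linear one with coefficient 1; this keeps \<open>CR\<close> out of
    \<open>local_const\<close>.\<close>
  have Rn: "frob_norm R \<le> \<epsilon>"
  proof -
    have "frob_norm R \<le> real N * spec_norm R"
      using R(1) ks_le[OF m] by (intro frob_norm_le_spec_norm) auto
    also have "\<dots> \<le> real N * (\<bar>CR\<bar> * \<epsilon>\<^sup>2)"
      using order_trans[OF R(2) mult_right_mono[OF abs_ge_self zero_le_power2]] by (intro mult_left_mono) auto
    also have "\<dots> = (\<epsilon> * (real N * \<bar>CR\<bar>)) * \<epsilon>" by (simp add: power2_eq_square)
    also have "\<dots> \<le> 1 * \<epsilon>" using \<epsilon>(1,4) by (intro mult_right_mono) auto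
    finally show ?thesis by simp
  qed
  let ?e = "real N * \<bar>Ceig\<bar>" and ?g = "real N * (1 + ?a)"
  have g0: "0 \<le> ?g" by (simp add: add_nonneg_nonneg)
  have "frob_norm (?Gh - ?G) \<le> \<epsilon> * ?e * ?g * (real ?k + \<epsilon> * \<bar>Cjd\<bar> + \<epsilon>) + ?g * (\<epsilon> * \<bar>Cjd\<bar> + \<epsilon>)"
    by (rule two_sided_perturbation[OF noise(1,2) GC frob_norm_ismd_G_le[OF run m] F(1) Fn R(1) Rn])
       (use \<epsilon>(1) in simp)
  also have "\<dots> \<le> \<epsilon> * ?e * ?g * (real N + 2) + ?g * (\<epsilon> * \<bar>Cjd\<bar> + \<epsilon>)"
  proof (intro add_right_mono mult_left_mono)
    show "real ?k + \<epsilon> * \<bar>Cjd\<bar> + \<epsilon> \<le> real N + 2" using ks_le[OF m] \<epsilon>(2,3) by linarith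
    show "0 \<le> \<epsilon> * ?e * ?g" using \<epsilon>(1) g0 by (intro mult_nonneg_nonneg) auto
  qed
  also have "\<dots> = \<epsilon> * local_const N ?a Ceig Cjd"
    by (simp add: local_const_def algebra_simps)
  finally show "frob_norm (ismd_G A Ps \<gamma>' h' D' m - ?G) \<le> \<epsilon> * local_const N ?a Ceig Cjd" unfolding Gh_eq .
qed

text \<open>Two bounds for the pseudo-inverses are at work. The one by \<open>s\<close> does not
  depend on the run and provides the smallness condition; the one by the smallest singular value is
  what may appear in the constant of (a).\<close>

lemma Omega_perturbation:
  assumes run: "ismd_run A Ps \<gamma> h D"
    and Gh: "\<And>m. m < M \<Longrightarrow> Gh m \<in> carrier_mat (card (Ps ! m)) (ks m)"
    and near: "\<And>m. m < M \<Longrightarrow> frob_norm (Gh m - ismd_G A Ps \<gamma> h D m) \<le> \<epsilon> * d"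
    and s: "\<And>m. m < M \<Longrightarrow> frob_norm (pinv (B m)) \<le> s" "s * (\<epsilon> * d) \<le> 1/2" and d: "0 \<le> d"
    and Ah: "Ah \<in> carrier_mat N N"
      "\<And>m n. m < M \<Longrightarrow> n < M \<Longrightarrow> frob_norm (blk Ah Ps m n - blk A Ps m n) \<le> \<epsilon> * real N"
    and \<epsilon>: "0 < \<epsilon>" "\<epsilon> \<le> 1"
  shows "spec_norm (block_mat ks M (Lam Ah Ps Gh) - ismd_Omega A Ps \<gamma> h D) \<le>
    real N * block_const N (real N / \<bar>min_singular_value Ps (ismd_G A Ps \<gamma> h D)\<bar>) d (real N * spec_norm A) * \<epsilon>"
proof -
  let ?G = "ismd_G A Ps \<gamma> h D" and ?a = "real N * spec_norm A"
  let ?\<sigma> = "min_singular_value Ps ?G"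
  let ?c = "block_const N (real N / \<bar>?\<sigma>\<bar>) d ?a"
  let ?X = "block_mat ks M (Lam Ah Ps Gh) - block_mat ks M (Lam A Ps ?G)"
  have c0: "0 \<le> ?c" using d by (intro block_const_nonneg) auto
  have "frob_norm ?X \<le> real N * (\<epsilon> * ?c)"
  proof (rule frob_norm_le_entries)
    show "dim_row ?X \<le> N" "dim_col ?X \<le> N" using blk_offset_le[OF ks_le_card] by auto
    show "0 \<le> \<epsilon> * ?c" using \<epsilon>(1) c0 by simp
    fix i j assume "i < dim_row ?X" "j < dim_col ?X"
    then have ij: "i < blk_offset ks M" "j < blk_offset ks M" by auto
    obtain m p where mp: "m < M" "p < ks m" "i = blk_offset ks m + p" using ij(1) by (rule blk_index_cases)
    obtain n q where nq: "n < M" "q < ks n" "j = blk_offset ks n + q" using ij(2) by (rule blk_index_cases)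
    note G = ismd_G_props[OF run]
    \<comment> \<open>The actual norms lie below both bounds, so the estimate is made with them and
      then enlarged by monotonicity. The blocks contain the indices \<open>p\<close> and
      \<open>q\<close>, so their ranks are positive and the singular value bound applies.\<close>
    let ?s = "max (frob_norm (pinv (?G m))) (frob_norm (pinv (?G n)))"
    have sv: "frob_norm (pinv (?G m)) \<le> real N / ?\<sigma>" "frob_norm (pinv (?G n)) \<le> real N / ?\<sigma>" "0 < ?\<sigma>"
      using min_singular_value_bound[OF run mp(1)] min_singular_value_bound[OF run nq(1)] mp(2) nq(2) by auto
    have "?s \<le> s" using G(3) s(1) mp(1) nq(1) by simp
    then have sd: "?s * (\<epsilon> * d) \<le> 1/2"
      using order_trans[OF mult_right_mono[of ?s s "\<epsilon> * d"] s(2)] d \<epsilon>(1) by simp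
    have Lm: "Lam Ah Ps Gh m n - Lam A Ps ?G m n =
        pinv (Gh m) * blk Ah Ps m n * transpose_mat (pinv (Gh n)) - pinv (?G m) * blk A Ps m n * transpose_mat (pinv (?G n))"
      by (simp add: Lam_def)
    have diff: "frob_norm (Lam Ah Ps Gh m n - Lam A Ps ?G m n) \<le> \<epsilon> * block_const N ?s d ?a"
      unfolding Lm
      by (rule block_perturbation[OF G(1)[OF mp(1)] Gh[OF mp(1)] G(2)[OF mp(1)] max.cobounded1 near[OF mp(1)]
            card_patch_le[OF mp(1)] ks_le[OF mp(1)] G(1)[OF nq(1)] Gh[OF nq(1)] G(2)[OF nq(1)] max.cobounded2 near[OF nq(1)]
            card_patch_le[OF nq(1)] ks_le[OF nq(1)] blk_carrier[OF mp(1) nq(1) A] blk_carrier[OF mp(1) nq(1) Ah(1)]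
            frob_norm_blk_le[OF mp(1) nq(1) A] Ah(2)[OF mp(1) nq(1)] _ \<epsilon>(2) sd]) (use \<epsilon> in simp)
    have mono: "block_const N ?s d ?a \<le> ?c"
      using sv d by (intro block_const_mono) (auto simp: le_max_iff_disj)
    have PG: "pinv (?G m) \<in> carrier_mat (ks m) (card (Ps ! m))" "pinv (?G n) \<in> carrier_mat (ks n) (card (Ps ! n))"
      using pinv_full_col_rank(1)[OF G(1,2)] mp(1) nq(1) by auto
    have LC: "Lam A Ps ?G m n \<in> carrier_mat (ks m) (ks n)"
      unfolding Lam_def using PG by (intro carrier_matI) auto
    have "?X $$ (i,j) = (Lam Ah Ps Gh m n - Lam A Ps ?G m n) $$ (p,q)"
      using ij mp nq LC by (simp add: index_block_mat)
    also have "\<bar>\<dots>\<bar> \<le> frob_norm (Lam Ah Ps Gh m n - Lam A Ps ?G m n)"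
      using LC mp nq by (intro entry_le_frob_norm) auto
    also have "\<dots> \<le> \<epsilon> * block_const N ?s d ?a" by (rule diff)
    also have "\<dots> \<le> \<epsilon> * ?c" using mono \<epsilon>(1) by (intro mult_left_mono) auto
    finally show "\<bar>?X $$ (i,j)\<bar> \<le> \<epsilon> * ?c" .
  qed
  then show ?thesis
    unfolding ismd_Omega_eq[OF run] using spec_norm_le_frob_norm[of ?X] by (simp add: mult_ac)
qed

end

section \<open>Recovery by thresholding, Cholesky factors and the output\<close>

lemma threshold_eqI:
  assumes \<Omega>: "\<Omega> \<in> carrier_mat n n" "elements_mat \<Omega> \<subseteq> {-1,0,1}" and \<Omega>h: "\<Omega>h \<in> carrier_mat n n"
    and near: "spec_norm (\<Omega>h - \<Omega>) < 1/2"
  shows "map_mat threshold \<Omega>h = \<Omega>"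
proof (rule eq_matI)
  fix i j assume "i < dim_row \<Omega>" "j < dim_col \<Omega>"
  then have ij: "i < n" "j < n" using \<Omega> by auto
  have "\<bar>(\<Omega>h - \<Omega>) $$ (i,j)\<bar> \<le> spec_norm (\<Omega>h - \<Omega>)"
    using ij \<Omega> by (intro entry_le_spec_norm) auto
  then have "\<bar>\<Omega>h $$ (i,j) - \<Omega> $$ (i,j)\<bar> < 1/2" using near ij \<Omega> \<Omega>h by simp
  moreover have "\<Omega> $$ (i,j) \<in> {-1,0,1}" using \<Omega> elements_matI[OF \<Omega>(1) ij refl] by blast
  ultimately show "map_mat threshold \<Omega>h $$ (i,j) = \<Omega> $$ (i,j)"
    using ij \<Omega>h by (auto simp: threshold_def abs_if split: if_splits)
qed (use \<Omega> \<Omega>h in auto)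

text \<open>The squared norm of \<open>P * L\<close> is the trace of \<Omega>, whose diagonal
  entries are at most 1. So the bound is the same for every choice of pivots.\<close>

lemma pivoted_cholesky_factor_bound:
  assumes \<Omega>: "\<Omega> \<in> carrier_mat n n" "elements_mat \<Omega> \<subseteq> {-1,0,1}" "n \<le> N"
    and chol: "pivoted_cholesky K \<Omega> P L"
  shows "P \<in> carrier_mat n n" "L \<in> carrier_mat n K" "frob_norm (P * L) \<le> real N"
proof -
  show P: "P \<in> carrier_mat n n" and L: "L \<in> carrier_mat n K"
    using chol \<Omega>(1) by (auto simp: pivoted_cholesky_def perm_mat_def)
  have d: "dim_row P = n" "dim_col P = n" "dim_row L = n" "dim_col L = K" using P L by auto
  have "\<Omega> = P * L * transpose_mat L * transpose_mat P" using chol by (simp add: pivoted_cholesky_def)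
  then have eq: "(P * L) * transpose_mat (P * L) = \<Omega>" by (simp add: transpose_mult_dim mult_assoc_dim d)
  show "frob_norm (P * L) \<le> real N"
  proof (rule power2_le_imp_le)
    have "(frob_norm (P * L))\<^sup>2 = (frob_norm (transpose_mat (P * L)))\<^sup>2" by (simp only: frob_norm_transpose)
    also have "\<dots> = (\<Sum>j<n. \<Omega> $$ (j,j))"
      unfolding frob_norm_sq_gram transpose_transpose eq by (simp add: d)
    also have "\<dots> \<le> (\<Sum>j<n. 1)"
      using \<Omega>(1,2) by (intro sum_mono) (force simp: elements_mat_def)
    also have "\<dots> \<le> real N * real N"
    proof -
      have "n \<le> N * N" using \<Omega>(3) le_square[of N] by linarith
      then show ?thesis by (simp add: of_nat_mult[symmetric] del: of_nat_mult)
    qed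
    finally show "(frob_norm (P * L))\<^sup>2 \<le> (real N)\<^sup>2" by (simp only: power2_eq_square)
  qed simp
qed

context identifiable_modes
begin

text \<open>Both outputs share \<open>P\<close> and \<open>L\<close>, so their difference is the
  difference of the block diagonal factors times \<open>P * L\<close>, and their supports agree by
  \<open>patch_support_g_ext_col\<close>.\<close>

lemma ismd_output_perturbation:
  assumes G: "\<And>m. m < M \<Longrightarrow> G m \<in> carrier_mat (card (Ps ! m)) (ks m)" "\<And>m. m < M \<Longrightarrow> full_col_rank (G m)"
    and Gh: "\<And>m. m < M \<Longrightarrow> Gh m \<in> carrier_mat (card (Ps ! m)) (ks m)" "\<And>m. m < M \<Longrightarrow> full_col_rank (Gh m)"
    and near: "\<And>m. m < M \<Longrightarrow> frob_norm (Gh m - G m) \<le> c" and c: "0 \<le> c"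
    and P: "P \<in> carrier_mat (blk_offset ks M) (blk_offset ks M)" and L: "L \<in> carrier_mat (blk_offset ks M) K"
    and PL: "frob_norm (P * L) \<le> l"
  shows "k < K \<Longrightarrow> patch_support Ps (col (ismd_output A Ps Gh P L) k) = patch_support Ps (col (ismd_output A Ps G P L) k)"
    "spec_norm (ismd_output A Ps Gh P L - ismd_output A Ps G P L) \<le> real N * c * l"
proof -
  have out: "ismd_output A Ps G' P L = g_ext N Ps ks G' * (P * L)" for G'
    using A P L carrier_matD[OF g_ext_carrier[of ks G']] by (simp add: ismd_output_def mult_assoc_dim)
  have PLC: "P * L \<in> carrier_mat (blk_offset ks M) K" using P L by auto
  show "k < K \<Longrightarrow> patch_support Ps (col (ismd_output A Ps Gh P L) k) = patch_support Ps (col (ismd_output A Ps G P L) k)"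
    unfolding out using patch_support_g_ext_col[OF G PLC] patch_support_g_ext_col[OF Gh PLC] by simp
  let ?D = "g_ext N Ps ks Gh - g_ext N Ps ks G"
  have DC: "?D \<in> carrier_mat N (blk_offset ks M)" by (intro minus_carrier_mat) simp
  have "ismd_output A Ps Gh P L - ismd_output A Ps G P L = ?D * (P * L)"
    unfolding out using P L carrier_matD[OF g_ext_carrier[of ks G]] carrier_matD[OF g_ext_carrier[of ks Gh]]
    by (intro minus_mult_dim[symmetric]) auto
  then have "spec_norm (ismd_output A Ps Gh P L - ismd_output A Ps G P L) \<le> frob_norm (?D * (P * L))"
    by (simp only: spec_norm_le_frob_norm)
  also have "\<dots> \<le> real N * c * l"
    by (rule frob_norm_mult_le[OF DC PLC frob_norm_g_ext_diff[OF G(1) Gh(1) ks_le_card near c] PL])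
  finally show "spec_norm (ismd_output A Ps Gh P L - ismd_output A Ps G P L) \<le> real N * c * l" .
qed

lemma thresholded_ismd_recovery:
  "\<exists>\<epsilon>0 > 0. \<forall>\<gamma> h D \<epsilon> At E \<gamma>' h' D'.
     0 < \<epsilon> \<and> \<epsilon> < \<epsilon>0 \<and> ismd_run A Ps \<gamma> h D \<and> noisy_run N A Ps Ceig \<epsilon> At E \<gamma>' h' D' \<and>
     (\<forall>m<M. jd_perturbation Cjd CR \<epsilon> (E m) (ismd_G A Ps \<gamma> h D m) (ismd_G A Ps \<gamma>' h' D' m) (1\<^sub>m (ks m))) \<longrightarrow>
     (let K = mrank A;
          G = ismd_G A Ps \<gamma> h D;
          Ghat = ismd_G A Ps \<gamma>' h' D';
          \<Omega> = ismd_Omega A Ps \<gamma> h D;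
          \<Omega>hat = thresholded_ismd_Omega A (A + \<epsilon> \<cdot>\<^sub>m At) Ps \<gamma>' h' D';
          cismd = omega_const N (spec_norm A) (min_singular_value Ps G) Ceig Cjd;
          cg = output_const N (spec_norm A) Ceig Cjd
      in spec_norm (\<Omega>hat - \<Omega>) \<le> cismd * \<epsilon> \<and>
         (cismd * \<epsilon> < 1/2 \<longrightarrow>
            map_mat threshold \<Omega>hat = \<Omega> \<and>
            (\<forall>P L. pivoted_cholesky K (map_mat threshold \<Omega>hat) P L \<longrightarrow>
               pivoted_cholesky K \<Omega> P L \<and>
               (\<forall>k<K. patch_support Ps (col (ismd_output A Ps Ghat P L) k) =
                       patch_support Ps (col (ismd_output A Ps G P L) k)) \<and>
               spec_norm (ismd_output A Ps Ghat P L - ismd_output A Ps G P L) \<le> cg * \<epsilon>)))"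
proof -
  define d where "d = local_const N (spec_norm A) Ceig Cjd"
  define s where "s = (\<Sum>m<M. frob_norm (pinv (B m)))"
  \<comment> \<open>The first two summands serve \<open>local_piece_perturbation\<close>, the third
    the perturbation of pseudo-inverses. The modes and \<open>CR\<close> enter only here, not in the
    constants of the conclusion.\<close>
  define \<epsilon>0 where "\<epsilon>0 = 1 / (1 + \<bar>Cjd\<bar> + real N * \<bar>CR\<bar> + 2 * (s * d))"
  have d0: "0 \<le> d" by (simp add: d_def local_const_nonneg)
  have s0: "0 \<le> s" by (auto simp: s_def intro!: sum_nonneg)
  have sB: "frob_norm (pinv (B m)) \<le> s" if "m < M" for m
    unfolding s_def using that by (auto intro!: member_le_sum[where f = "\<lambda>m. frob_norm (pinv (B m))"])
  have pos: "0 < \<epsilon>0" using d0 s0 by (simp add: \<epsilon>0_def add_pos_nonneg)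
  show ?thesis
  proof (intro exI[of _ \<epsilon>0] conjI pos allI impI, elim conjE)
    fix \<gamma> h D \<epsilon> At E \<gamma>' h' D'
    assume \<epsilon>: "0 < \<epsilon>" "\<epsilon> < \<epsilon>0" and run: "ismd_run A Ps \<gamma> h D"
      and noisy: "noisy_run N A Ps Ceig \<epsilon> At E \<gamma>' h' D'"
      and jd: "\<forall>m<M. jd_perturbation Cjd CR \<epsilon> (E m) (ismd_G A Ps \<gamma> h D m) (ismd_G A Ps \<gamma>' h' D' m) (1\<^sub>m (ks m))"
    let ?G = "ismd_G A Ps \<gamma> h D" and ?Gh = "ismd_G A Ps \<gamma>' h' D'" and ?Ah = "A + \<epsilon> \<cdot>\<^sub>m At"
    let ?\<Omega> = "ismd_Omega A Ps \<gamma> h D" and ?\<Omega>h = "thresholded_ismd_Omega A ?Ah Ps \<gamma>' h' D'"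
    let ?c = "omega_const N (spec_norm A) (min_singular_value Ps ?G) Ceig Cjd"
    have eps: "\<epsilon> \<le> 1" "\<epsilon> * \<bar>Cjd\<bar> \<le> 1" "\<epsilon> * (real N * \<bar>CR\<bar>) \<le> 1" "\<epsilon> * (2 * (s * d)) \<le> 1"
      using small_scaled_le_1[of \<epsilon> "\<bar>Cjd\<bar>" "real N * \<bar>CR\<bar>" "2 * (s * d)"] \<epsilon> s0 d0 by (auto simp: \<epsilon>0_def)
    have sd: "s * (\<epsilon> * d) \<le> 1/2" using eps(4) by (simp add: mult_ac)
    note noise = noisy_run_props[OF noisy \<epsilon>(1)]
    note G = ismd_G_props[OF run]
    have piece: "?Gh m \<in> carrier_mat (card (Ps ! m)) (ks m)" "frob_norm (?Gh m - ?G m) \<le> \<epsilon> * d" if m: "m < M" for m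
      unfolding d_def using local_piece_perturbation[OF run noisy _ \<epsilon>(1) eps(1,2,3) m] jd m by auto
    \<comment> \<open>Needed for equality of the supports: without it a noisy piece could annihilate
      coefficients that the exact one does not.\<close>
    have Gh_fcr: "full_col_rank (?Gh m)" if m: "m < M" for m
      by (rule pinv_perturbation(1)[OF G(1)[OF m] piece(1)[OF m] G(2)[OF m] _ piece(2)[OF m] sd
            card_patch_le[OF m] ks_le[OF m]]) (use G(3)[OF m] sB[OF m] in simp)
    have Ah: "?Ah \<in> carrier_mat N N"
      using A noisy by (auto simp: noisy_run_def)
    have a: "spec_norm (?\<Omega>h - ?\<Omega>) \<le> ?c * \<epsilon>"
      unfolding thresholded_ismd_Omega_def omega_const_def d_def[symmetric]
      by (rule Omega_perturbation[OF run piece sB sd d0 Ah noise(7) \<epsilon>(1) eps(1)])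
    have \<Omega>: "?\<Omega> \<in> carrier_mat (blk_offset ks M) (blk_offset ks M)" unfolding ismd_Omega_eq[OF run] by simp
    have \<Omega>h: "?\<Omega>h \<in> carrier_mat (blk_offset ks M) (blk_offset ks M)" unfolding thresholded_ismd_Omega_def by simp
    have b: "map_mat threshold ?\<Omega>h = ?\<Omega>" if "?c * \<epsilon> < 1/2"
      by (rule threshold_eqI[OF \<Omega> elements_ismd_Omega[OF run] \<Omega>h]) (use a that in linarith)
    have c: "k < K \<Longrightarrow> patch_support Ps (col (ismd_output A Ps ?Gh P L) k) = patch_support Ps (col (ismd_output A Ps ?G P L) k)"
      "spec_norm (ismd_output A Ps ?Gh P L - ismd_output A Ps ?G P L) \<le> output_const N (spec_norm A) Ceig Cjd * \<epsilon>"
      if chol: "pivoted_cholesky K ?\<Omega> P L" for K P L k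
    proof -
      have \<epsilon>d: "0 \<le> \<epsilon> * d" using \<epsilon>(1) d0 by simp
      note PL = pivoted_cholesky_factor_bound[OF \<Omega> elements_ismd_Omega[OF run] blk_offset_le[OF ks_le_card] chol]
      note out = ismd_output_perturbation[OF G(1,2) piece(1) Gh_fcr piece(2) \<epsilon>d PL]
      show "k < K \<Longrightarrow> patch_support Ps (col (ismd_output A Ps ?Gh P L) k) = patch_support Ps (col (ismd_output A Ps ?G P L) k)"
        by (rule out(1))
      show "spec_norm (ismd_output A Ps ?Gh P L - ismd_output A Ps ?G P L) \<le> output_const N (spec_norm A) Ceig Cjd * \<epsilon>"
        using out(2) by (simp add: output_const_def d_def mult_ac)
    qed
    show "let K = mrank A;
          G = ismd_G A Ps \<gamma> h D;
          Ghat = ismd_G A Ps \<gamma>' h' D';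
          \<Omega> = ismd_Omega A Ps \<gamma> h D;
          \<Omega>hat = thresholded_ismd_Omega A (A + \<epsilon> \<cdot>\<^sub>m At) Ps \<gamma>' h' D';
          cismd = omega_const N (spec_norm A) (min_singular_value Ps G) Ceig Cjd;
          cg = output_const N (spec_norm A) Ceig Cjd
      in spec_norm (\<Omega>hat - \<Omega>) \<le> cismd * \<epsilon> \<and>
         (cismd * \<epsilon> < 1/2 \<longrightarrow>
            map_mat threshold \<Omega>hat = \<Omega> \<and>
            (\<forall>P L. pivoted_cholesky K (map_mat threshold \<Omega>hat) P L \<longrightarrow>
               pivoted_cholesky K \<Omega> P L \<and>
               (\<forall>k<K. patch_support Ps (col (ismd_output A Ps Ghat P L) k) =
                       patch_support Ps (col (ismd_output A Ps G P L) k)) \<and>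
               spec_norm (ismd_output A Ps Ghat P L - ismd_output A Ps G P L) \<le> cg * \<epsilon>))"
      unfolding Let_def
    proof (intro conjI impI allI a)
      assume "?c * \<epsilon> < 1/2"
      note thr = b[OF this]
      then show "map_mat threshold ?\<Omega>h = ?\<Omega>" .
      fix P L assume "pivoted_cholesky (mrank A) (map_mat threshold ?\<Omega>h) P L"
      then show chol: "pivoted_cholesky (mrank A) ?\<Omega> P L" unfolding thr .
      show "spec_norm (ismd_output A Ps ?Gh P L - ismd_output A Ps ?G P L) \<le> output_const N (spec_norm A) Ceig Cjd * \<epsilon>"
        by (rule c(2)[OF chol])
      show "patch_support Ps (col (ismd_output A Ps ?Gh P L) k) = patch_support Ps (col (ismd_output A Ps ?G P L) k)"
        if "k < mrank A" for k by (rule c(1)[OF chol that])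
    qed
  qed
qed

end

lemma identifiable_modes_run:
  assumes "sym_psd N A" "patch_partition N Ps" "regular_sparse A Ps"
    "intrinsic_sparse_modes A Ps \<psi>" "pairwise_identifiable Ps (mrank A) \<psi>" "ismd_run A Ps \<gamma> h D"
  shows "identifiable_modes N Ps A \<psi>"
  using assms by (intro patches.identifiable_modesI[OF patches.intro]) (auto simp: sym_psd_def)

text \<open>The order of the quantifiers encodes the admissible dependencies. \<open>Cismd\<close>
  and \<open>Cg\<close> precede \<open>N\<close> and \<open>A\<close> and see them only through
  their arguments; \<open>Cjd\<close>, \<open>CR\<close> and each \<open>\<epsilon>0\<close> follow
  \<open>A\<close> but precede runs and noise. The part with the identity as \<open>J\<close> is
  stated for arbitrary \<open>Cjd\<close> and \<open>CR\<close>, so it applies to any constants for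
  which the normalized relation holds.\<close>

theorem mainTheorem3:
  "\<exists>\<delta> > 0. \<exists>(Cismd :: nat \<Rightarrow> real \<Rightarrow> real \<Rightarrow> real \<Rightarrow> real \<Rightarrow> real) (Cg :: nat \<Rightarrow> real \<Rightarrow> real \<Rightarrow> real \<Rightarrow> real).
   \<forall>(N :: nat) (A :: real mat) (Ps :: nat set list) (Ceig :: real).
     sym_psd N A \<and> patch_partition N Ps \<and> regular_sparse A Ps \<and>
     (\<exists>\<psi>. intrinsic_sparse_modes A Ps \<psi> \<and> pairwise_identifiable Ps (mrank A) \<psi>) \<longrightarrow>
     (\<exists>Cjd CR. \<exists>\<epsilon>0 > 0. \<forall>\<gamma> h D \<epsilon> Atilde Eeig \<gamma>' h' D'.
        0 < \<epsilon> \<and> \<epsilon> < \<epsilon>0 \<and> ismd_run A Ps \<gamma> h D \<and> noisy_run N A Ps Ceig \<epsilon> Atilde Eeig \<gamma>' h' D' \<longrightarrow>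
        (\<forall>m<length Ps. \<exists>J. signed_perm_mat (loc_rank A Ps m) J \<and>
           jd_perturbation Cjd CR \<epsilon> (Eeig m) (ismd_G A Ps \<gamma> h D m) (ismd_G A Ps \<gamma>' h' D' m) J)) \<and>
     (\<forall>\<gamma> h D. ismd_run A Ps \<gamma> h D \<longrightarrow> elements_mat (ismd_Omega A Ps \<gamma> h D) \<subseteq> {-1, 0, 1}) \<and>
     (\<forall>Cjd CR. \<exists>\<epsilon>0 > 0. \<forall>\<gamma> h D \<epsilon> Atilde Eeig \<gamma>' h' D'.
        0 < \<epsilon> \<and> \<epsilon> < \<epsilon>0 \<and> ismd_run A Ps \<gamma> h D \<and> noisy_run N A Ps Ceig \<epsilon> Atilde Eeig \<gamma>' h' D' \<and>
        (\<forall>m<length Ps. jd_perturbation Cjd CR \<epsilon> (Eeig m) (ismd_G A Ps \<gamma> h D m) (ismd_G A Ps \<gamma>' h' D' m)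
           (1\<^sub>m (loc_rank A Ps m))) \<longrightarrow>
        (let K = mrank A;
             G = ismd_G A Ps \<gamma> h D;
             Ghat = ismd_G A Ps \<gamma>' h' D';
             \<Omega> = ismd_Omega A Ps \<gamma> h D;
             \<Omega>hat = thresholded_ismd_Omega A (A + \<epsilon> \<cdot>\<^sub>m Atilde) Ps \<gamma>' h' D';
             cismd = Cismd N (spec_norm A) (min_singular_value Ps G) Ceig Cjd;
             cg = Cg N (spec_norm A) Ceig Cjd
         in
          spec_norm (\<Omega>hat - \<Omega>) \<le> cismd * \<epsilon> \<and>
          (cismd * \<epsilon> < \<delta> \<longrightarrow>
             map_mat threshold \<Omega>hat = \<Omega> \<and>
             (\<forall>P L. pivoted_cholesky K (map_mat threshold \<Omega>hat) P L \<longrightarrow>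
                pivoted_cholesky K \<Omega> P L \<and>
                (\<forall>k<K. patch_support Ps (col (ismd_output A Ps Ghat P L) k) =
                        patch_support Ps (col (ismd_output A Ps G P L) k)) \<and>
                spec_norm (ismd_output A Ps Ghat P L - ismd_output A Ps G P L) \<le> cg * \<epsilon>))))"
\<comment> \<open>An entrywise error below 1/2 cannot move any of -1, 0 and 1 across the cuts at
  -0.5 and 0.5, hence the witness for \<delta>.\<close>
proof (rule exI[of _ "1/2"], rule conjI, simp, rule exI[of _ omega_const], rule exI[of _ output_const],
    intro allI impI, elim conjE exE, intro conjI allI impI, goal_cases)
  case (1 N A Ps Ceig \<psi>)
  show ?case
  \<comment> \<open>The eigendecompositions of a run supply the rank factorizations of the diagonal
    blocks from which the locale assumptions are derived. If there is no run, the claim is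
    vacuous.\<close>
  proof (cases "\<exists>\<gamma> h D. ismd_run A Ps \<gamma> h D")
    case True
    then have "identifiable_modes N Ps A \<psi>" using 1 by (blast intro: identifiable_modes_run)
    then show ?thesis by (rule identifiable_modes.jd_perturbation_exists)
  next
    case False
    then show ?thesis by (intro exI[of _ 1]) simp
  qed
next
  case (2 N A Ps Ceig \<psi> \<gamma> h D)
  then have "identifiable_modes N Ps A \<psi>" by (blast intro: identifiable_modes_run)
  then show ?case using 2 by (intro identifiable_modes.elements_ismd_Omega)
next
  case (3 N A Ps Ceig \<psi> Cjd CR)
  show ?case
  proof (cases "\<exists>\<gamma> h D. ismd_run A Ps \<gamma> h D")
    case True
    then have "identifiable_modes N Ps A \<psi>" using 3 by (blast intro: identifiable_modes_run)
    then show ?thesis by (rule identifiable_modes.thresholded_ismd_recovery)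
  next
    case False
    then show ?thesis by (intro exI[of _ 1]) simp
  qed
qed

end
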